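(* Let $1\le l\le k$ be integers and let $G$ be a $\{C_3,C_5,\ldots,C_{2l-1},C_{2k+1}\}$-free connected graph of order $n\ge 640(2k+1)$. (1) If $n$ is odd, then $$\lambda_2(G)\le\rho\big(T_{\frac{n-1}{2},2}\big),$$ with equality if and only if $G\in\mathcal I\big(T_{\frac{n-1}{2},2},T_{\frac{n-1}{2},2}\big)$ and $G$ is $\{C_3,C_5,\ldots,C_{2l-1},C_{2k+1}\}$-free. (2) If $n$ is even, then $$\lambda_2(G)\le\lambda_2\big(T_{\frac n2,2}\,uv\,T_{\frac n2,2}\big),$$ where $u$ (respectively $v$) is a vertex of (the respective copy of) $T_{\frac n2,2}$ in a partition set of $\lceil\frac n4\rceil$ vertices. Equality holds if and only if $G=T_{\frac n2,2}\,uv\,T_{\frac n2,2}$ (up to isomorphism).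
   Context: Graphs are finite and simple. $\lambda_1(G)\ge\lambda_2(G)\ge\cdots$ are the adjacency eigenvalues of $G$, and $\rho(G)=\lambda_1(G)$. $C_m$ is the cycle of length $m$. A graph is $\{C_3,C_5,\ldots,C_{2l-1},C_{2k+1}\}$-free if it contains none of these cycles as a (not necessarily induced) subgraph; when $l=1$ the set is just $\{C_{2k+1}\}$. $T_{m,2}$ is the bipartite Turán graph on $m$ vertices, i.e. $K_{\lfloor m/2\rfloor,\lceil m/2\rceil}$. For disjoint graphs $A,B$: $\mathcal I(A,B)$ is the family of connected graphs obtained from the disjoint union of $A$ and $B$ by adding one new vertex and joining it to some vertices of $A$ and some vertices of $B$; for $u\in V(A)$, $v\in V(B)$, $A\,uv\,B$ is the graph obtained from the disjoint union of $A$ and $B$ by adding the edge $uv$. *)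

theory Defs
  imports "Graph_Theory.Graph_Theory" "Jordan_Normal_Form.Char_Poly"
begin

text \<open>
  A finite simple graph is a \<^const>\<open>pair_graph\<close>: a finite vertex set together with a symmetric
  irreflexive relation, each edge being represented by its two orientations.
\<close>

section \<open>Adjacency eigenvalues\<close>

text \<open>
  The matrix depends on the chosen enumeration of the vertices only up to simultaneous permutation
  of rows and columns, so its characteristic polynomial does not depend on it.
\<close>

definition vertex_list :: "'a pair_pre_digraph \<Rightarrow> 'a list" where
  "vertex_list G = (SOME xs. distinct xs \<and> set xs = pverts G)"

definition adjacency_matrix :: "'a pair_pre_digraph \<Rightarrow> real mat" where
  "adjacency_matrix G =
     mat (card (pverts G)) (card (pverts G))
       (\<lambda>(i, j). if (vertex_list G ! i, vertex_list G ! j) \<in> parcs G then 1 else 0)"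

text \<open>
  Eigenvalues are listed in non-increasing order with algebraic multiplicity. For a simple graph
  the matrix is real symmetric, so no eigenvalue is lost by taking only the real roots and the
  list has one entry per vertex. Indices start at 1.
\<close>

definition adjacency_spectrum :: "'a pair_pre_digraph \<Rightarrow> real list" where
  "adjacency_spectrum G = rev (sorted_list_of_multiset (proots (char_poly (adjacency_matrix G))))"

definition graph_eigenvalue :: "nat \<Rightarrow> 'a pair_pre_digraph \<Rightarrow> real" where
  "graph_eigenvalue i G = adjacency_spectrum G ! (i - 1)"

definition graph_spectral_radius :: "'a pair_pre_digraph \<Rightarrow> real" where
  "graph_spectral_radius G = graph_eigenvalue 1 G"

section \<open>Forbidden odd cycles\<close>

text \<open>Intended for lengths at least 3.\<close>

definition cycle_graph :: "nat \<Rightarrow> nat pair_pre_digraph" where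
  "cycle_graph m =
     \<lparr> pverts = {..<m},
       parcs = (\<Union>i<m. {(i, Suc i mod m), (Suc i mod m, i)}) \<rparr>"

definition contains_copy :: "'a pair_pre_digraph \<Rightarrow> 'b pair_pre_digraph \<Rightarrow> bool" where
  "contains_copy G H \<longleftrightarrow>
     (\<exists>S :: 'a pair_pre_digraph.
        subgraph (with_proj S) (with_proj G) \<and> digraph_iso (with_proj S) (with_proj H))"

text \<open>
  The forbidden lengths are the odd numbers from 3 to \<open>2 * l - 1\<close> together with \<open>2 * k + 1\<close>;
  the first group is empty for \<open>l = 1\<close>.
\<close>

definition forbidden_cycle_lengths :: "nat \<Rightarrow> nat \<Rightarrow> nat set" where
  "forbidden_cycle_lengths l k = {m. odd m \<and> 3 \<le> m \<and> m \<le> 2 * l - 1} \<union> {2 * k + 1}"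

definition odd_cycles_free :: "nat \<Rightarrow> nat \<Rightarrow> 'a pair_pre_digraph \<Rightarrow> bool" where
  "odd_cycles_free l k G \<longleftrightarrow>
     (\<forall>m \<in> forbidden_cycle_lengths l k. \<not> contains_copy G (cycle_graph m))"

section \<open>Bipartite Turan graphs\<close>

definition complete_bipartite :: "'a set \<Rightarrow> 'b set \<Rightarrow> ('a + 'b) pair_pre_digraph" where
  "complete_bipartite A B =
     \<lparr> pverts = A <+> B,
       parcs = (Inl ` A) \<times> (Inr ` B) \<union> (Inr ` B) \<times> (Inl ` A) \<rparr>"

text \<open>On naturals, \<open>(m + 1) div 2\<close> is the ceiling of \<open>m / 2\<close>.\<close>

definition turan2 :: "nat \<Rightarrow> (nat + nat) pair_pre_digraph" where
  "turan2 m = complete_bipartite {..<m div 2} {..<(m + 1) div 2}"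

definition turan2_partition_sets :: "nat \<Rightarrow> (nat + nat) set set" where
  "turan2_partition_sets m = {Inl ` {..<m div 2}, Inr ` {..<(m + 1) div 2}}"

section \<open>Joining two disjoint graphs\<close>

text \<open>The sum type provides the disjoint union; \<^const>\<open>None\<close> serves as an additional vertex.\<close>

definition disjoint_union ::
    "'a pair_pre_digraph \<Rightarrow> 'b pair_pre_digraph \<Rightarrow> ('a + 'b) pair_pre_digraph" where
  "disjoint_union A B =
     \<lparr> pverts = pverts A <+> pverts B,
       parcs = map_prod Inl Inl ` parcs A \<union> map_prod Inr Inr ` parcs B \<rparr>"

definition edge_join ::
    "'a pair_pre_digraph \<Rightarrow> 'a \<Rightarrow> 'b \<Rightarrow> 'b pair_pre_digraph \<Rightarrow> ('a + 'b) pair_pre_digraph" where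
  "edge_join A u v B =
     \<lparr> pverts = pverts (disjoint_union A B),
       parcs = parcs (disjoint_union A B) \<union> {(Inl u, Inr v), (Inr v, Inl u)} \<rparr>"

definition vertex_join ::
    "'a pair_pre_digraph \<Rightarrow> 'a set \<Rightarrow> 'b set \<Rightarrow> 'b pair_pre_digraph
       \<Rightarrow> ('a + 'b) option pair_pre_digraph" where
  "vertex_join A S T B =
     \<lparr> pverts = insert None (Some ` pverts (disjoint_union A B)),
       parcs = map_prod Some Some ` parcs (disjoint_union A B)
         \<union> {None} \<times> (Some ` (S <+> T)) \<union> (Some ` (S <+> T)) \<times> {None} \<rparr>"

definition join_family ::
    "'a pair_pre_digraph \<Rightarrow> 'b pair_pre_digraph \<Rightarrow> ('a + 'b) option pair_pre_digraph set" where
  "join_family A B =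
     {vertex_join A S T B | S T. S \<subseteq> pverts A \<and> T \<subseteq> pverts B \<and>
        Digraph_Component.connected (with_proj (vertex_join A S T B))}"

section \<open>Well-formedness of the constructions\<close>

lemma pair_graph_iff:
  "pair_graph G \<longleftrightarrow> finite (pverts G) \<and> parcs G \<subseteq> pverts G \<times> pverts G \<and> sym (parcs G) \<and> irrefl (parcs G)"
proof
  assume "pair_graph G"
  then interpret pair_graph G .
  show "finite (pverts G) \<and> parcs G \<subseteq> pverts G \<times> pverts G \<and> sym (parcs G) \<and> irrefl (parcs G)"
    using pair_finite_verts in_arcsD1 in_arcsD2 pair_sym_arcs pair_no_loops
    by (fastforce simp: symmetric_def irrefl_def)
next
  assume *: "finite (pverts G) \<and> parcs G \<subseteq> pverts G \<times> pverts G \<and> sym (parcs G) \<and> irrefl (parcs G)"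
  then have "finite (parcs G)"
    by (meson finite_SigmaI finite_subset)
  with * show "pair_graph G"
    by unfold_locales (auto simp: symmetric_def irrefl_def)
qed

lemma pair_graph_cycle_graph:
  assumes "3 \<le> m"
  shows "pair_graph (cycle_graph m)"
proof -
  have "Suc i mod m \<noteq> i" if "i < m" for i
    using assms that by (cases "Suc i = m") auto
  then show ?thesis
    using assms
    by (auto simp: pair_graph_iff cycle_graph_def sym_def irrefl_def) metis
qed

lemma turan2_complete_bipartite:
  "complete_bipartite_digraph (m div 2) ((m + 1) div 2) (with_proj (turan2 m))"
  unfolding complete_bipartite_digraph_pair_def
  by (intro conjI exI[of _ "Inl ` {..<m div 2}"] exI[of _ "Inr ` {..<(m + 1) div 2}"])
    (auto simp: turan2_def complete_bipartite_def card_image Plus_def)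

lemma pair_graph_turan2: "pair_graph (turan2 m)"
  by (auto simp: pair_graph_iff turan2_def complete_bipartite_def sym_def irrefl_def)

lemma pair_graph_edge_join:
  assumes "pair_graph A" "pair_graph B" "u \<in> pverts A" "v \<in> pverts B"
  shows "pair_graph (edge_join A u v B)"
  using assms
  by (fastforce simp: pair_graph_iff edge_join_def disjoint_union_def sym_def irrefl_def)

lemma pair_graph_vertex_join:
  assumes "pair_graph A" "pair_graph B" "S \<subseteq> pverts A" "T \<subseteq> pverts B"
  shows "pair_graph (vertex_join A S T B)"
  using assms
  by (fastforce simp: pair_graph_iff vertex_join_def disjoint_union_def sym_def irrefl_def)

end

theory Submission
  imports Defs "HOL-Analysis.Function_Topology" "HOL-Analysis.Convex"
begin

text \<open>
  Let \<open>y\<close> be an eigenvector of the second eigenvalue. Since it is orthogonal to the Perron vector, it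
  takes both signs; let \<open>P\<close> and \<open>N\<close> be the sets of vertices where it is positive and negative.
  Restricting \<open>y\<close> to \<open>P\<close> or to \<open>N\<close> shows that the second eigenvalue is at most the spectral radius of
  the induced subgraphs on \<open>P\<close> and on \<open>N\<close>, and one of the two has at most \<open>n div 2\<close> vertices.

  It remains to see that a graph on \<open>m \<ge> 580 * k + 1\<close> vertices without a cycle of length \<open>2 * k + 1\<close>
  is bipartite or has spectral radius at most \<open>m / 2 - 1 / 40\<close>. The neighbourhood of a vertex contains
  no path on \<open>2 * k\<close> vertices, hence is sparse, so counting walks of length 2 bounds the radius by
  \<open>m / 2 + 2 * k\<close>. If the squared entries of the unit Perron vector are all at least \<open>9 / (10 * m)\<close>, then
  the minimum degree is at least \<open>44 * m / 100\<close> and the graph is bipartite. Otherwise one deletes a vertex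
  with a small entry, which gains \<open>1 / 40\<close> against \<open>m / 2\<close>, so after \<open>80 * k\<close> steps the excess \<open>2 * k\<close> is used up.

  For even \<open>n\<close> both sign classes have \<open>n div 2\<close> vertices and some edge joins \<open>u \<in> P\<close> to \<open>v \<in> N\<close>. If
  \<open>y u \<le> - y v\<close>, this edge acts on \<open>P\<close> as a loop of weight at most \<open>-1\<close> at \<open>u\<close>, so the second eigenvalue
  is at most the largest eigenvalue of a complete bipartite graph carrying such a loop.
\<close>

section \<open>Spectral decomposition of an adjacency matrix\<close>

text \<open>Spectral bounds are stated as inequalities
  \<open>qform E y \<le> c * (\<Sum>v\<in>V. (y v)\<^sup>2)\<close> for all \<open>y\<close>, so
  induced subgraphs, vertex sets padded by isolated vertices and weighted loops need no matrices of
  their own. The constant \<open>1 / 40\<close> serves two purposes. Deleting a vertex with a small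
  entry lowers the radius by less than 0.456, which is below \<open>1 / 2 - 1 / 40\<close>. On the
  other hand, the Turan radius and the looped eigenvalue \<open>\<theta>\<close> both lie above
  \<open>m / 2 - 1 / 40\<close>, so a non-bipartite sign class can never be extremal. In
  \<open>580 * k = 500 * k + 80 * k\<close>, the first summand keeps \<open>2 * k\<close> small
  against \<open>m\<close> during the whole descent, and the second pays for the
  \<open>80 * k\<close> deletions. For even \<open>n\<close> the obstacle is that the two sign
  classes interact through the joining edge. The loop turns this into a problem about one class, and
  equality there forces \<open>y u = - y v\<close>, after which the other class is extremal too. For
  the joined graph itself only the lower bound \<open>\<theta>\<close> is required, and a
  two-dimensional space of test vectors provides it.\<close>

lemma compact_box: "compact {x :: nat \<Rightarrow> real. \<forall>i. x i \<in> {-1..1}}"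
proof -
  have "compactin (product_topology (\<lambda>i::nat. euclidean) UNIV) (PiE UNIV (\<lambda>i. {-1..1::real}))"
    by (subst compactin_PiE) simp
  moreover have "PiE UNIV (\<lambda>i::nat. {-1..1::real}) = {x. \<forall>i. x i \<in> {-1..1}}"
    by auto
  ultimately show ?thesis
    by (simp add: euclidean_product_topology)
qed

text \<open>Vectors of dimension \<open>n\<close> are functions vanishing from \<open>n\<close> on,
  so the unit sphere of the subspace cut out by \<open>w\<close> is a closed subset of a Tychonoff
  cube and hence compact. Homogeneity carries the bound from the sphere to the subspace;
  \<open>z\<close> shows that the sphere is nonempty.\<close>

lemma quadratic_form_attains_max:
  fixes A :: "nat \<Rightarrow> nat \<Rightarrow> real" and w :: "nat \<Rightarrow> nat \<Rightarrow> real" and m n :: nat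
  assumes z0: "\<forall>i\<ge>n. z i = 0" "\<forall>j<m. (\<Sum>i<n. w j i * z i) = 0" "(\<Sum>i<n. (z i)\<^sup>2) \<noteq> 0"
  obtains x where "\<forall>i\<ge>n. x i = 0" "\<forall>j<m. (\<Sum>i<n. w j i * x i) = 0" "(\<Sum>i<n. (x i)\<^sup>2) = 1"
    "\<forall>y. (\<forall>i\<ge>n. y i = 0) \<and> (\<forall>j<m. (\<Sum>i<n. w j i * y i) = 0) \<longrightarrow>
       (\<Sum>i<n. \<Sum>j<n. A i j * y i * y j) \<le>
       (\<Sum>i<n. \<Sum>j<n. A i j * x i * x j) * (\<Sum>i<n. (y i)\<^sup>2)"
proof -
  define S where "S = {x. (\<forall>i\<ge>n. x i = 0) \<and> (\<forall>j<m. (\<Sum>i<n. w j i * x i) = 0)}"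
  have z: "z \<in> S" "(\<Sum>i<n. (z i)\<^sup>2) \<noteq> 0" using z0 by (auto simp: S_def)
  define F where "F y = (\<Sum>i<n. \<Sum>j<n. A i j * y i * y j)" for y :: "nat \<Rightarrow> real"
  define K where "K = {x \<in> S. (\<Sum>i<n. (x i)\<^sup>2) = 1}"
  have c[continuous_intros]: "continuous_on UNIV (\<lambda>x. x i)" for i :: nat
    by (rule continuous_on_product_coordinates)
  have "closed K"
  proof -
    have "K = (\<Inter>i\<in>{n..}. {x. x i = 0}) \<inter> (\<Inter>j\<in>{..<m}. {x. (\<Sum>i<n. w j i * x i) = 0}) \<inter> {x. (\<Sum>i<n. (x i)\<^sup>2) = 1}"
      by (auto simp: K_def S_def)
    also have "closed \<dots>"
      by (intro closed_Int closed_INT ballI closed_Collect_eq continuous_intros)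
    finally show ?thesis .
  qed
  moreover have "K \<subseteq> {x. \<forall>i. x i \<in> {-1..1}}"
  proof (clarify)
    fix x i assume x: "x \<in> K"
    show "x i \<in> {-1..1}"
    proof (cases "i < n")
      case True
      have "(x i)\<^sup>2 \<le> (\<Sum>i<n. (x i)\<^sup>2)"
        using True by (intro member_le_sum) auto
      then have "(x i)\<^sup>2 \<le> 1\<^sup>2" using x by (simp add: K_def)
      then have "\<bar>x i\<bar> \<le> 1" by (metis abs_le_square_iff abs_one)
      then show ?thesis by auto
    next
      case False
      then show ?thesis using x by (auto simp: K_def S_def)
    qed
  qed
  ultimately have "compact K"
    using compact_box compact_Int_closed by (metis inf.absorb_iff2)
  have norm: "\<exists>y' \<in> K. y' = (\<lambda>i. y i / sqrt (\<Sum>i<n. (y i)\<^sup>2))" if "y \<in> S" "(\<Sum>i<n. (y i)\<^sup>2) \<noteq> 0" for y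
  proof -
    define r where "r = sqrt (\<Sum>i<n. (y i)\<^sup>2)"
    have "r\<^sup>2 = (\<Sum>i<n. (y i)\<^sup>2)" by (simp add: r_def sum_nonneg)
    then have "(\<Sum>i<n. (y i / r)\<^sup>2) = 1"
      using that by (simp add: power_divide flip: sum_divide_distrib)
    moreover have "(\<lambda>i. y i / r) \<in> S"
      using that by (auto simp: S_def simp flip: sum_divide_distrib)
    ultimately show ?thesis by (auto simp: K_def r_def)
  qed
  have "K \<noteq> {}" using norm[OF z] by auto
  have "continuous_on UNIV F"
    unfolding F_def by (intro continuous_intros)
  then obtain x where x: "x \<in> K" "\<And>y. y \<in> K \<Longrightarrow> F y \<le> F x"
    using continuous_attains_sup[OF \<open>compact K\<close> \<open>K \<noteq> {}\<close>] continuous_on_subset by blast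
  show ?thesis
  proof
    show "\<forall>i\<ge>n. x i = 0" "\<forall>j<m. (\<Sum>i<n. w j i * x i) = 0" "(\<Sum>i<n. (x i)\<^sup>2) = 1"
      using x by (auto simp: K_def S_def)
  next
    have "F y \<le> F x * (\<Sum>i<n. (y i)\<^sup>2)" if y: "y \<in> S" for y
    proof (cases "(\<Sum>i<n. (y i)\<^sup>2) = 0")
      case True
      then have "\<forall>i<n. y i = 0" by (subst (asm) sum_nonneg_eq_0_iff) auto
      then show ?thesis by (simp add: F_def)
    next
      case False
      define r where "r = sqrt (\<Sum>i<n. (y i)\<^sup>2)"
      have r2: "r\<^sup>2 = (\<Sum>i<n. (y i)\<^sup>2)" by (simp add: r_def sum_nonneg)
      have "F (\<lambda>i. y i / r) = F y / r\<^sup>2"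
        by (simp add: F_def power2_eq_square sum_divide_distrib)
      moreover have "F (\<lambda>i. y i / r) \<le> F x"
        using norm[OF y False] x r_def by auto
      moreover have "r\<^sup>2 > 0" using False r2 by (simp add: r_def)
      ultimately have "F y / r\<^sup>2 \<le> F x" by simp
      then show ?thesis using \<open>r\<^sup>2 > 0\<close> r2 by (simp add: pos_divide_le_eq)
    qed
    then show "\<forall>y. (\<forall>i\<ge>n. y i = 0) \<and> (\<forall>j<m. (\<Sum>i<n. w j i * y i) = 0) \<longrightarrow>
       (\<Sum>i<n. \<Sum>j<n. A i j * y i * y j) \<le>
       (\<Sum>i<n. \<Sum>j<n. A i j * x i * x j) * (\<Sum>i<n. (y i)\<^sup>2)"
      by (simp add: F_def S_def)
  qed
qed

lemma exists_orthogonal_nonzero: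
  fixes w :: "nat \<Rightarrow> nat \<Rightarrow> real"
  assumes "m < n"
  obtains z where "\<forall>i\<ge>n. z i = 0" "\<forall>j<m. (\<Sum>i<n. w j i * z i) = 0" "(\<Sum>i<n. (z i)\<^sup>2) \<noteq> 0"
proof -
  \<comment> \<open>The equations are completed to a square system whose row \<open>m\<close> is
    zero, so it is singular; a kernel vector satisfies the first \<open>m\<close> equations in
    particular.\<close>
  define M where "M = mat\<^sub>r n n (\<lambda>j. if j = m then 0\<^sub>v n else vec n (\<lambda>i. w j i))"
  have M: "M \<in> carrier_mat n n" by (simp add: M_def)
  have "det M = 0"
    unfolding M_def by (rule det_row_0) (use assms in auto)
  then obtain v where v: "v \<in> carrier_vec n" "v \<noteq> 0\<^sub>v n" "M *\<^sub>v v = 0\<^sub>v n"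
    using det_0_iff_vec_prod_zero_field[OF M] by auto
  define z where "z i = (if i < n then v $ i else 0)" for i
  have "(\<Sum>i<n. w j i * z i) = 0" if "j < m" for j
  proof -
    have "(M *\<^sub>v v) $ j = 0" using v that assms by simp
    then show ?thesis using that assms v
      by (simp add: M_def scalar_prod_def z_def atLeast0LessThan)
  qed
  moreover have "(\<Sum>i<n. (z i)\<^sup>2) \<noteq> 0"
  proof
    assume "(\<Sum>i<n. (z i)\<^sup>2) = 0"
    then have "\<forall>i<n. z i = 0" by (subst (asm) sum_nonneg_eq_0_iff) auto
    then have "v = 0\<^sub>v n" using v by (intro eq_vecI) (auto simp: z_def)
    then show False using v by simp
  qed
  ultimately show ?thesis using that[of z] by (auto simp: z_def)
qed

text \<open>The first-order condition at a maximum: \<open>e\<close> is the size of a perturbation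
  and \<open>a\<close> the derivative in its direction.\<close>

lemma linear_coeff_eq_0:
  fixes a b :: real
  assumes "\<And>e. 2 * e * a + e\<^sup>2 * b \<le> 0"
  shows "a = 0"
proof (rule ccontr)
  assume "a \<noteq> 0"
  \<comment> \<open>With \<open>e = a / c\<close> the quadratic takes the sign of
    \<open>2 * c + b\<close>, so any \<open>c > 0\<close> with \<open>2 * c > - b\<close>
    works.\<close>
  define c where "c = \<bar>b\<bar> + 1"
  have c: "c > 0" "2 * c + b > 0" by (auto simp: c_def)
  have "2 * (a / c) * a + (a / c)\<^sup>2 * b = a\<^sup>2 * (2 * c + b) / c\<^sup>2"
    using c by (simp add: field_simps power2_eq_square)
  moreover have "\<dots> > 0" using c \<open>a \<noteq> 0\<close> by simp
  ultimately show False using assms[of "a / c"] by simp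
qed

text \<open>The last clause is the Courant-Fischer property: \<open>r i\<close> bounds the Rayleigh
  quotient on the orthogonal complement of the earlier vectors. Its double sum rebinds
  \<open>i\<close>, whereas the factor \<open>r i\<close> refers to the outer index.\<close>

definition eigensystem :: "nat \<Rightarrow> (nat \<Rightarrow> nat \<Rightarrow> real) \<Rightarrow> nat \<Rightarrow> (nat \<Rightarrow> nat \<Rightarrow> real) \<Rightarrow> (nat \<Rightarrow> real) \<Rightarrow> bool" where
  "eigensystem n A m u r \<longleftrightarrow>
     (\<forall>i<m. (\<forall>j\<ge>n. u i j = 0) \<and> (\<Sum>j<n. (u i j)\<^sup>2) = 1 \<and>
        (\<forall>j<n. (\<Sum>l<n. A j l * u i l) = r i * u i j)) \<and>
     (\<forall>i<m. \<forall>j<m. i \<noteq> j \<longrightarrow> (\<Sum>l<n. u i l * u j l) = 0) \<and>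
     (\<forall>i<m. \<forall>y. (\<forall>j\<ge>n. y j = 0) \<and> (\<forall>j<i. (\<Sum>l<n. u j l * y l) = 0) \<longrightarrow>
        (\<Sum>i<n. \<Sum>j<n. A i j * y i * y j) \<le> r i * (\<Sum>l<n. (y l)\<^sup>2))"

text \<open>Deflation: the next eigenvector maximises the form on the complement of the earlier
  ones. Symmetry makes this complement invariant, so the residual of the eigenvalue equation is an
  admissible direction of perturbation.\<close>

lemma eigensystem_exists:
  fixes A :: "nat \<Rightarrow> nat \<Rightarrow> real"
  assumes sym: "\<And>i j. i < n \<Longrightarrow> j < n \<Longrightarrow> A i j = A j i" and "m \<le> n"
  shows "\<exists>u r. eigensystem n A m u r"
  using \<open>m \<le> n\<close>
proof (induction m)
  case 0
  show ?case by (simp add: eigensystem_def)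
next
  case (Suc m)
  then obtain u r where h: "eigensystem n A m u r"
    by auto
  have u: "\<And>i. i < m \<Longrightarrow> (\<forall>j\<ge>n. u i j = 0)" "\<And>i. i < m \<Longrightarrow> (\<Sum>j<n. (u i j)\<^sup>2) = 1"
      "\<And>i j. i < m \<Longrightarrow> j < n \<Longrightarrow> (\<Sum>l<n. A j l * u i l) = r i * u i j"
      "\<And>i j. i < m \<Longrightarrow> j < m \<Longrightarrow> i \<noteq> j \<Longrightarrow> (\<Sum>l<n. u i l * u j l) = 0"
    using h by (auto simp: eigensystem_def)
  have max: "\<And>i y. i < m \<Longrightarrow> (\<forall>j\<ge>n. y j = 0) \<Longrightarrow> (\<forall>j<i. (\<Sum>l<n. u j l * y l) = 0) \<Longrightarrow>
         (\<Sum>i<n. \<Sum>j<n. A i j * y i * y j) \<le> r i * (\<Sum>l<n. (y l)\<^sup>2)"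
    using h by (simp add: eigensystem_def)
  obtain z0 where z0: "\<forall>i\<ge>n. z0 i = 0" "\<forall>j<m. (\<Sum>i<n. u j i * z0 i) = 0" "(\<Sum>i<n. (z0 i)\<^sup>2) \<noteq> 0"
    using exists_orthogonal_nonzero[of m n u] Suc.prems by (auto simp: Suc_le_eq)
  define F where "F y = (\<Sum>i<n. \<Sum>j<n. A i j * y i * y j)" for y :: "nat \<Rightarrow> real"
  obtain x where x: "\<forall>i\<ge>n. x i = 0" "\<forall>j<m. (\<Sum>i<n. u j i * x i) = 0" "(\<Sum>i<n. (x i)\<^sup>2) = 1"
    and xmax0: "\<forall>y. (\<forall>i\<ge>n. y i = 0) \<and> (\<forall>j<m. (\<Sum>i<n. u j i * y i) = 0) \<longrightarrow>
       (\<Sum>i<n. \<Sum>j<n. A i j * y i * y j) \<le>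
       (\<Sum>i<n. \<Sum>j<n. A i j * x i * x j) * (\<Sum>i<n. (y i)\<^sup>2)"
    by (rule quadratic_form_attains_max[where A = A, OF z0])
  have xmax: "F y \<le> F x * (\<Sum>i<n. (y i)\<^sup>2)"
    if "\<forall>i\<ge>n. y i = 0" "\<forall>j<m. (\<Sum>i<n. u j i * y i) = 0" for y
    using that xmax0 by (simp add: F_def)
  define g where "g j = (\<Sum>l<n. A j l * x l)" for j
  \<comment> \<open>The residual of the eigenvalue equation. When \<open>x\<close> is perturbed to
    \<open>x + e * z\<close>, the coefficient of \<open>2 * e\<close> is the squared norm of
    \<open>z\<close>, which therefore vanishes.\<close>
  define z where "z j = (if j < n then g j - F x * x j else 0)" for j
  have z_perp: "(\<Sum>l<n. u i l * z l) = 0" if "i < m" for i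
  proof -
    have "(\<Sum>l<n. u i l * g l) = (\<Sum>l<n. \<Sum>k<n. u i l * (A l k * x k))"
      by (simp add: g_def sum_distrib_left)
    also have "\<dots> = (\<Sum>k<n. \<Sum>l<n. x k * (A k l * u i l))"
      by (subst sum.swap) (auto intro!: sum.cong simp: sym)
    also have "\<dots> = (\<Sum>k<n. x k * (r i * u i k))"
      using u(3)[OF that] by (simp flip: sum_distrib_left)
    also have "\<dots> = r i * (\<Sum>k<n. u i k * x k)"
      by (simp add: sum_distrib_left algebra_simps)
    finally have 1: "(\<Sum>l<n. u i l * g l) = 0" using x(2) that by simp
    have "(\<Sum>l<n. u i l * z l) = (\<Sum>l<n. u i l * g l) - F x * (\<Sum>l<n. u i l * x l)"
      by (simp add: z_def sum_distrib_left algebra_simps flip: sum_subtractf)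
    then show ?thesis using 1 x(2) that by simp
  qed
  have z2: "(\<Sum>j<n. (z j)\<^sup>2) = (\<Sum>j<n. z j * g j) - F x * (\<Sum>j<n. z j * x j)"
    by (simp add: z_def sum_distrib_left algebra_simps power2_eq_square flip: sum_subtractf)
  have "2 * e * (\<Sum>j<n. (z j)\<^sup>2) + e\<^sup>2 * (F z - F x * (\<Sum>j<n. (z j)\<^sup>2)) \<le> 0" for e
  proof -
    let ?y = "\<lambda>j. x j + e * z j"
    have "F ?y \<le> F x * (\<Sum>i<n. (?y i)\<^sup>2)"
    proof (rule xmax)
      show "\<forall>i\<ge>n. ?y i = 0" using x by (simp add: z_def)
      show "\<forall>j<m. (\<Sum>i<n. u j i * ?y i) = 0"
      proof safe
        fix j assume "j < m"
        have "(\<Sum>i<n. u j i * ?y i) = (\<Sum>i<n. u j i * x i) + e * (\<Sum>i<n. u j i * z i)"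
          by (simp add: sum.distrib sum_distrib_left algebra_simps)
        then show "(\<Sum>i<n. u j i * ?y i) = 0" using x z_perp \<open>j < m\<close> by simp
      qed
    qed
    moreover have "(\<Sum>i<n. (?y i)\<^sup>2) = 1 + 2 * e * (\<Sum>i<n. z i * x i) + e\<^sup>2 * (\<Sum>i<n. (z i)\<^sup>2)"
      unfolding x(3)[symmetric] sum_distrib_left sum.distrib[symmetric]
      by (intro sum.cong) (auto simp: power2_eq_square algebra_simps)
    moreover have "F ?y = F x + 2 * e * (\<Sum>j<n. z j * g j) + e\<^sup>2 * F z"
    proof -
      have "F ?y = F x + e * (\<Sum>i<n. \<Sum>j<n. A i j * x i * z j) + e * (\<Sum>i<n. \<Sum>j<n. A i j * z i * x j) + e\<^sup>2 * F z"
        unfolding F_def sum_distrib_left sum.distrib[symmetric]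
        by (intro sum.cong) (auto simp: power2_eq_square algebra_simps)
      moreover have "(\<Sum>i<n. \<Sum>j<n. A i j * x i * z j) = (\<Sum>i<n. \<Sum>j<n. A i j * z i * x j)"
        by (subst sum.swap) (auto intro!: sum.cong simp: sym)
      moreover have "(\<Sum>i<n. \<Sum>j<n. A i j * z i * x j) = (\<Sum>j<n. z j * g j)"
        by (simp add: g_def sum_distrib_left algebra_simps)
      ultimately show ?thesis by simp
    qed
    ultimately show ?thesis unfolding z2 by (simp add: algebra_simps)
  qed
  then have "(\<Sum>j<n. (z j)\<^sup>2) = 0" by (rule linear_coeff_eq_0)
  then have "\<forall>j<n. z j = 0" by (subst (asm) sum_nonneg_eq_0_iff) auto
  then have eig: "(\<Sum>l<n. A j l * x l) = F x * x j" if "j < n" for j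
    using that by (auto simp: z_def g_def)
  have "eigensystem n A (Suc m) (u(m := x)) (r(m := F x))"
    unfolding eigensystem_def
  proof (intro conjI allI impI)
    fix i y
    assume "i < Suc m" and y: "(\<forall>j\<ge>n. y j = 0) \<and> (\<forall>j<i. (\<Sum>l<n. (u(m := x)) j l * y l) = 0)"
    then show "(\<Sum>i<n. \<Sum>j<n. A i j * y i * y j) \<le> (r(m := F x)) i * (\<Sum>l<n. (y l)\<^sup>2)"
      using max[of i y] xmax[of y] by (cases "i = m") (auto simp: F_def)
  next
    fix i j
    assume "i < Suc m" "j < Suc m" "i \<noteq> j"
    then show "(\<Sum>l<n. (u(m := x)) i l * (u(m := x)) j l) = 0"
      using u(4)[of i j] x(2) by (auto simp: less_Suc_eq mult.commute)
  qed (use u x eig in \<open>auto simp: less_Suc_eq\<close>)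
  then show ?case by blast
qed

text \<open>Links the sorted roots of the characteristic polynomial to the deflation: the matrix
  with columns \<open>u i\<close> is orthogonal and diagonalises \<open>A\<close>, and deflation
  yields the eigenvalues already in non-increasing order.\<close>

lemma real_symmetric_spectrum:
  fixes A :: "real mat"
  assumes A: "A \<in> carrier_mat n n" and sym: "\<And>i j. i < n \<Longrightarrow> j < n \<Longrightarrow> A $$ (i,j) = A $$ (j,i)"
  obtains u r where
    "rev (sorted_list_of_multiset (proots (char_poly A))) = map r [0..<n]"
    "eigensystem n (\<lambda>i j. A $$ (i, j)) n u r"
proof -
  obtain u r where h: "eigensystem n (\<lambda>i j. A $$ (i, j)) n u r"
    using eigensystem_exists[of n "\<lambda>i j. A $$ (i, j)" n] sym by auto
  have u: "\<And>i. i < n \<Longrightarrow> (\<forall>j\<ge>n. u i j = 0)" "\<And>i. i < n \<Longrightarrow> (\<Sum>j<n. (u i j)\<^sup>2) = 1"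
      "\<And>i j. i < n \<Longrightarrow> j < n \<Longrightarrow> (\<Sum>l<n. A $$ (j, l) * u i l) = r i * u i j"
      "\<And>i j. i < n \<Longrightarrow> j < n \<Longrightarrow> i \<noteq> j \<Longrightarrow> (\<Sum>l<n. u i l * u j l) = 0"
    using h by (auto simp: eigensystem_def)
  have max: "\<And>i y. i < n \<Longrightarrow> (\<forall>j\<ge>n. y j = 0) \<Longrightarrow> (\<forall>j<i. (\<Sum>l<n. u j l * y l) = 0) \<Longrightarrow>
         (\<Sum>i<n. \<Sum>j<n. A $$ (i, j) * y i * y j) \<le> r i * (\<Sum>l<n. (y l)\<^sup>2)"
    using h by (simp add: eigensystem_def)
  define U where "U = mat n n (\<lambda>(i, j). u j i)"
  define D where "D = mat n n (\<lambda>(i, j). if i = j then r i else 0)"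
  have U: "U \<in> carrier_mat n n" and D: "D \<in> carrier_mat n n" by (auto simp: U_def D_def)
  have "U\<^sup>T * U = 1\<^sub>m n"
    by (rule eq_matI)
      (use u(2,4) in \<open>auto simp: U_def scalar_prod_def atLeast0LessThan power2_eq_square\<close>)
  then have UU: "U * U\<^sup>T = 1\<^sub>m n"
    using U mat_mult_left_right_inverse[of "U\<^sup>T" n U] by simp
  have AU: "A * U = U * D"
  proof (rule eq_matI)
    fix i j assume "i < dim_row (U * D)" "j < dim_col (U * D)"
    then have ij: "i < n" "j < n" by (auto simp: U_def D_def)
    have "(A * U) $$ (i, j) = (\<Sum>l<n. A $$ (i, l) * u j l)"
      using ij A by (simp add: U_def scalar_prod_def atLeast0LessThan)
    moreover have "(U * D) $$ (i, j) = (\<Sum>l<n. u l i * (if l = j then r l else 0))"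
      using ij by (simp add: U_def D_def scalar_prod_def atLeast0LessThan)
    moreover have "\<dots> = (\<Sum>l<n. if l = j then u j i * r j else 0)"
      by (rule sum.cong) auto
    ultimately show "(A * U) $$ (i, j) = (U * D) $$ (i, j)"
      using u(3) ij by (simp add: sum.delta)
  qed (use A U D in auto)
  have "A = A * (U * U\<^sup>T)" using A UU by simp
  also have "\<dots> = A * U * U\<^sup>T" using A U by (simp add: assoc_mult_mat[of _ n n _ n _ n])
  finally have "A = U * D * U\<^sup>T" using AU by simp
  then have "similar_mat_wit A D U U\<^sup>T"
    using A U D UU \<open>U\<^sup>T * U = 1\<^sub>m n\<close> unfolding similar_mat_wit_def by (auto simp: Let_def)
  then have "similar_mat A D"
    unfolding similar_mat_def by blast
  moreover have "upper_triangular D" by (auto simp: D_def)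
  ultimately have "char_poly A = (\<Prod>a \<leftarrow> diag_mat D. [:- a, 1:])"
    using char_poly_similar char_poly_upper_triangular D by metis
  also have "diag_mat D = map r [0..<n]"
    by (auto simp: diag_mat_def D_def)
  finally have "char_poly A = prod_list (map (\<lambda>a. [:- a, 1:]) (map r [0..<n]))" .
  moreover have sing: "sum_list (map (\<lambda>a. {#a#}) xs) = mset xs" for xs :: "real list"
    by (induction xs) auto
  ultimately have "proots (char_poly A) = sum_list (map proots (map (\<lambda>a. [:- a, 1:]) (map r [0..<n])))"
    using proots_prod_list[of "map (\<lambda>a. [:- a, 1:]) (map r [0..<n])"] by force
  also have "\<dots> = sum_list (map (\<lambda>a. {#a#}) (map r [0..<n]))"
    by (simp add: comp_def)
  also have "\<dots> = mset (map r [0..<n])"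
    using sing[of "map r [0..<n]"] by simp
  finally have roots: "proots (char_poly A) = mset (map r [0..<n])" .
  \<comment> \<open>The vector \<open>u j\<close> is admissible in the maximality clause for
    \<open>r i\<close>, and its Rayleigh quotient is \<open>r j\<close>.\<close>
  have mono: "r j \<le> r i" if "i \<le> j" "j < n" for i j
  proof -
    have "(\<Sum>i<n. \<Sum>k<n. A $$ (i, k) * u j i * u j k) = (\<Sum>i<n. u j i * (\<Sum>k<n. A $$ (i, k) * u j k))"
      by (simp add: sum_distrib_left algebra_simps)
    also have "\<dots> = r j * (\<Sum>i<n. (u j i)\<^sup>2)"
      using that u(3) by (simp add: sum_distrib_left power2_eq_square algebra_simps)
    finally have "(\<Sum>i<n. \<Sum>k<n. A $$ (i, k) * u j i * u j k) = r j" using that u(2) by simp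
    moreover have "(\<Sum>i<n. \<Sum>k<n. A $$ (i, k) * u j i * u j k) \<le> r i * (\<Sum>l<n. (u j l)\<^sup>2)"
      using that u by (intro max) auto
    ultimately show ?thesis using u that by simp
  qed
  have "sorted (rev (map r [0..<n]))"
    unfolding sorted_wrt_rev sorted_wrt_map by (auto simp: sorted_wrt_iff_nth_less intro!: mono)
  then have "sort (map r [0..<n]) = rev (map r [0..<n])"
    by (intro properties_for_sort) auto
  then have "rev (sorted_list_of_multiset (proots (char_poly A))) = map r [0..<n]"
    unfolding roots sorted_list_of_multiset_mset by simp
  then show ?thesis using that h by blast
qed

section \<open>The quadratic form of an arc set and an eigenbasis indexed by vertices\<close>

text \<open>The form of the adjacency matrix: both orientations contribute, so every edge counts
  twice. As it depends on the arcs alone, passing to an induced subgraph is an intersection of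
  sets.\<close>

definition qform :: "('a \<times> 'a) set \<Rightarrow> ('a \<Rightarrow> real) \<Rightarrow> real" where
  "qform E x = (\<Sum>(u, v) \<in> E. x u * x v)"

lemma qform_rows:
  assumes "finite V" "E \<subseteq> V \<times> V"
  shows "qform E x = (\<Sum>v\<in>V. x v * (\<Sum>w\<in>E `` {v}. x w))"
proof -
  have "E = Sigma V (\<lambda>v. E `` {v})" using assms by auto
  moreover have "finite (E `` {v})" for v
    by (rule finite_subset[OF _ assms(1)]) (use assms(2) in auto)
  ultimately have "qform E x = (\<Sum>v\<in>V. \<Sum>w\<in>E `` {v}. x v * x w)"
    unfolding qform_def using assms(1) by (subst sum.Sigma) auto
  then show ?thesis by (simp add: sum_distrib_left)
qed

lemma sum_Image_indicator:
  assumes "finite V" "E \<subseteq> V \<times> V"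
  shows "(\<Sum>w\<in>E `` {v}. f w) = (\<Sum>w\<in>V. (if (v, w) \<in> E then 1 else 0) * (f w :: real))"
proof -
  have "(\<Sum>w\<in>V. (if (v, w) \<in> E then 1 else 0) * f w) = (\<Sum>w\<in>V. if w \<in> E `` {v} then f w else 0)"
    by (intro sum.cong) auto
  also have "\<dots> = (\<Sum>w\<in>V \<inter> E `` {v}. f w)"
    using assms by (simp add: sum.inter_restrict)
  also have "V \<inter> E `` {v} = E `` {v}" using assms by auto
  finally show ?thesis by simp
qed

text \<open>All later facts about \<open>graph_eigenvalue\<close> rest on these four properties; the
  enumeration of the vertices and the matrix do not occur again.\<close>

lemma graph_eigenbasis:
  fixes G :: "'a pair_pre_digraph"
  assumes G: "pair_graph G"
  obtains u where
    "\<And>i. i < card (pverts G) \<Longrightarrow> (\<Sum>v\<in>pverts G. (u i v)\<^sup>2) = 1"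
    "\<And>i v. i < card (pverts G) \<Longrightarrow> v \<in> pverts G \<Longrightarrow>
       (\<Sum>w\<in>parcs G `` {v}. u i w) = graph_eigenvalue (Suc i) G * u i v"
    "\<And>i j. i < card (pverts G) \<Longrightarrow> j < card (pverts G) \<Longrightarrow> i \<noteq> j \<Longrightarrow> (\<Sum>v\<in>pverts G. u i v * u j v) = 0"
    "\<And>i y. i < card (pverts G) \<Longrightarrow> (\<forall>j<i. (\<Sum>v\<in>pverts G. u j v * y v) = 0) \<Longrightarrow>
       qform (parcs G) y \<le> graph_eigenvalue (Suc i) G * (\<Sum>v\<in>pverts G. (y v)\<^sup>2)"
proof -
  define V where "V = pverts G"
  define E where "E = parcs G"
  define n where "n = card V"
  have fin: "finite V" and EV: "E \<subseteq> V \<times> V" and symE: "sym E"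
    using G by (auto simp: pair_graph_iff V_def E_def)
  define xs where "xs = vertex_list G"
  have "distinct xs \<and> set xs = V"
    unfolding xs_def vertex_list_def V_def[symmetric]
    by (rule someI_ex) (use finite_distinct_list[OF fin] in blast)
  then have xs: "distinct xs" "set xs = V" by auto
  then have len: "length xs = n" by (simp add: n_def distinct_card flip: xs(2))
  have bij: "bij_betw (\<lambda>i. xs ! i) {..<n} V"
    using bij_betw_nth[OF xs(1)] xs(2) len by auto
  have reidx: "(\<Sum>v\<in>V. f v) = (\<Sum>i<n. f (xs ! i))" for f :: "'a \<Rightarrow> real"
    using sum.reindex_bij_betw[OF bij, of f] by simp
  define A where "A = adjacency_matrix G"
  have A: "A \<in> carrier_mat n n"
    by (simp add: A_def adjacency_matrix_def n_def V_def)
  have Aij: "A $$ (i, j) = (if (xs ! i, xs ! j) \<in> E then 1 else 0)" if "i < n" "j < n" for i j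
    using that by (simp add: A_def adjacency_matrix_def n_def V_def xs_def E_def)
  have "A $$ (i, j) = A $$ (j, i)" if "i < n" "j < n" for i j
    using that symE by (auto simp: Aij sym_def)
  then obtain u r where
    spec: "rev (sorted_list_of_multiset (proots (char_poly A))) = map r [0..<n]" and
    sys: "eigensystem n (\<lambda>i j. A $$ (i, j)) n u r"
    using real_symmetric_spectrum[OF A] by blast
  have
    u1: "\<And>i. i < n \<Longrightarrow> (\<Sum>j<n. (u i j)\<^sup>2) = 1" and
    u2: "\<And>i j. i < n \<Longrightarrow> j < n \<Longrightarrow> (\<Sum>l<n. A $$ (j, l) * u i l) = r i * u i j" and
    u3: "\<And>i j. i < n \<Longrightarrow> j < n \<Longrightarrow> i \<noteq> j \<Longrightarrow> (\<Sum>l<n. u i l * u j l) = 0"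
    using sys by (auto simp: eigensystem_def)
  have
    u4: "\<And>i y. i < n \<Longrightarrow> (\<forall>j\<ge>n. y j = 0) \<Longrightarrow> (\<forall>j<i. (\<Sum>l<n. u j l * y l) = 0) \<Longrightarrow>
         (\<Sum>i<n. \<Sum>j<n. A $$ (i, j) * y i * y j) \<le> r i * (\<Sum>l<n. (y l)\<^sup>2)"
    using sys by (simp add: eigensystem_def)
  have r: "graph_eigenvalue (Suc i) G = r i" if "i < n" for i
    using that spec by (simp add: graph_eigenvalue_def adjacency_spectrum_def A_def)
  define idx where "idx = the_inv_into {..<n} (\<lambda>i. xs ! i)"
  have idx: "idx (xs ! i) = i" if "i < n" for i
    unfolding idx_def using bij that by (intro the_inv_into_f_f) (auto simp: bij_betw_def)
  define U where "U i v = u i (idx v)" for i v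
  have Ux: "U i (xs ! j) = u i j" if "j < n" for i j
    using that by (simp add: U_def idx)
  show ?thesis
  proof (rule that[of U]; fold V_def E_def n_def)
    fix i assume i: "i < n"
    show "(\<Sum>v\<in>V. (U i v)\<^sup>2) = 1" using u1[OF i] by (simp add: reidx Ux)
    show "(\<Sum>w\<in>E `` {v}. U i w) = graph_eigenvalue (Suc i) G * U i v" if "v \<in> V" for v
    proof -
      obtain j where j: "j < n" "v = xs ! j" using bij \<open>v \<in> V\<close> by (auto simp: bij_betw_def)
      have "(\<Sum>w\<in>E `` {v}. U i w) = (\<Sum>l<n. A $$ (j, l) * u i l)"
        unfolding sum_Image_indicator[OF fin EV] reidx
        using j by (intro sum.cong) (auto simp: Ux Aij)
      then show ?thesis using u2[OF i j(1)] r[OF i] j by (simp add: Ux)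
    qed
    show "(\<Sum>v\<in>V. U i v * U j v) = 0" if "j < n" "i \<noteq> j" for j
      using u3[OF i that] by (simp add: reidx Ux)
    show "qform E y \<le> graph_eigenvalue (Suc i) G * (\<Sum>v\<in>V. (y v)\<^sup>2)"
      if perp: "\<forall>j<i. (\<Sum>v\<in>V. U j v * y v) = 0" for y
    proof -
      define z where "z j = (if j < n then y (xs ! j) else 0)" for j
      have "qform E y = (\<Sum>i<n. \<Sum>j<n. A $$ (i, j) * z i * z j)"
        unfolding qform_rows[OF fin EV] sum_Image_indicator[OF fin EV] reidx
        by (intro sum.cong) (auto simp: z_def Aij sum_distrib_left algebra_simps intro!: sum.cong)
      also have "\<dots> \<le> r i * (\<Sum>l<n. (z l)\<^sup>2)"
        using perp by (intro u4[OF i]) (auto simp: reidx Ux z_def)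
      also have "(\<Sum>l<n. (z l)\<^sup>2) = (\<Sum>v\<in>V. (y v)\<^sup>2)"
        by (simp add: reidx z_def)
      finally show ?thesis using r[OF i] by simp
    qed
  qed
qed

section \<open>Odd cycles and dense graphs\<close>

text \<open>Simple graphs as bare sets. The descent interprets this for vertex-deleted subgraphs,
  and the sign classes for vertex sets enlarged by isolated vertices.\<close>

locale sgraph =
  fixes V :: "'a set" and E :: "('a \<times> 'a) set"
  assumes finV: "finite V" and EV: "E \<subseteq> V \<times> V" and symE: "sym E" and irr: "irrefl E"
begin

lemma fin_nbrs: "finite (E `` {v})"
  by (rule finite_subset[OF _ finV]) (use EV in auto)

lemma nbrs_subset: "E `` {v} \<subseteq> V"
  using EV by auto

lemma sgraph_restrict: "U \<subseteq> V \<Longrightarrow> sgraph U (E \<inter> U \<times> U)"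
  using finV symE irr by unfold_locales (auto intro: finite_subset simp: sym_def irrefl_def)

end

definition bipartite :: "('a \<times> 'a) set \<Rightarrow> bool" where
  "bipartite E \<longleftrightarrow> (\<exists>X. \<forall>(u, v) \<in> E. u \<in> X \<longleftrightarrow> v \<notin> X)"

text \<open>The list is read cyclically. It describes a genuine cycle only for
  \<open>3 \<le> n\<close>; for \<open>n = 2\<close> a single edge qualifies.\<close>

definition has_cycle :: "('a \<times> 'a) set \<Rightarrow> nat \<Rightarrow> bool" where
  "has_cycle E n \<longleftrightarrow> (\<exists>xs. distinct xs \<and> length xs = n \<and> successively (\<lambda>x y. (x, y) \<in> E) xs \<and>
     (last xs, hd xs) \<in> E)"

lemma has_cycle_mono: "has_cycle E n \<Longrightarrow> E \<subseteq> F \<Longrightarrow> has_cycle F n"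
  unfolding has_cycle_def by (auto simp: successively_conv_nth)

lemma path_of_min_degree:
  assumes "finite U" "U \<noteq> {}" "irrefl E" "sym E" and deg: "\<And>u. u \<in> U \<Longrightarrow> L \<le> card (E `` {u} \<inter> U)"
    and "j \<le> L"
  shows "\<exists>xs. distinct xs \<and> length xs = Suc j \<and> successively (\<lambda>x y. (x, y) \<in> E) xs \<and> set xs \<subseteq> U"
  using \<open>j \<le> L\<close>
proof (induction j)
  case 0
  obtain u where "u \<in> U" using assms by auto
  then show ?case by (intro exI[of _ "[u]"]) auto
next
  case (Suc j)
  then obtain xs where xs: "distinct xs" "length xs = Suc j" "successively (\<lambda>x y. (x, y) \<in> E) xs" "set xs \<subseteq> U"
    by auto
  then have "xs \<noteq> []" by auto
  define h where "h = hd xs"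
  have h: "h \<in> set xs" using \<open>xs \<noteq> []\<close> by (simp add: h_def)
  have "card (set xs - {h}) = j" using xs h by (simp add: distinct_card)
  also have "\<dots> < card (E `` {h} \<inter> U)" using deg[of h] h xs Suc.prems by auto
  finally have "\<not> E `` {h} \<inter> U \<subseteq> set xs - {h}"
    using card_mono[of "set xs - {h}" "E `` {h} \<inter> U"] by auto
  then obtain x where x: "(h, x) \<in> E" "x \<in> U" "x \<notin> set xs \<or> x = h" by auto
  moreover have "x \<noteq> h" using x \<open>irrefl E\<close> by (auto simp: irrefl_def)
  ultimately have "(x, h) \<in> E" "x \<in> U" "x \<notin> set xs" using \<open>sym E\<close> by (auto simp: sym_def)
  then show ?case
    using xs \<open>xs \<noteq> []\<close> by (intro exI[of _ "x # xs"]) (auto simp: successively_Cons h_def)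
qed

context sgraph
begin

text \<open>A path on \<open>2 * k\<close> vertices inside a neighbourhood closes up to a cycle through its centre.\<close>

lemma neighbourhood_sparse:
  assumes nc: "\<not> has_cycle E (2 * k + 1)" and k: "1 \<le> k" and U: "U \<subseteq> E `` {v}"
  shows "(\<Sum>u\<in>U. card (E `` {u} \<inter> U)) \<le> 4 * k * card U"
proof -
  have "finite U" using U fin_nbrs finite_subset by blast
  then show ?thesis using U
  proof (induction "card U" arbitrary: U)
    case 0
    then show ?case by simp
  next
    case (Suc c)
    have "U \<noteq> {}" using Suc.hyps by auto
    \<comment> \<open>Otherwise the minimum degree inside \<open>U\<close> would be at least
      \<open>2 * k - 1\<close>, which yields a path on \<open>2 * k\<close> vertices.\<close>
    have "\<exists>u\<in>U. card (E `` {u} \<inter> U) < 2 * k - 1"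
    proof (rule ccontr)
      assume "\<not> ?thesis"
      then have "\<And>u. u \<in> U \<Longrightarrow> 2 * k - 1 \<le> card (E `` {u} \<inter> U)" by force
      then obtain xs where xs: "distinct xs" "length xs = Suc (2 * k - 1)"
        "successively (\<lambda>x y. (x, y) \<in> E) xs" "set xs \<subseteq> U"
        using path_of_min_degree[OF \<open>finite U\<close> \<open>U \<noteq> {}\<close> irr symE, of "2 * k - 1" "2 * k - 1"] by auto
      then have ne: "xs \<noteq> []" by auto
      have "hd xs \<in> U" "last xs \<in> U" using xs ne by (auto simp: subset_iff)
      then have "(v, hd xs) \<in> E" "(last xs, v) \<in> E" using Suc.prems symE by (auto simp: sym_def)
      moreover have "v \<notin> set xs" using xs Suc.prems irr by (auto simp: irrefl_def)
      ultimately have "has_cycle E (2 * k + 1)"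
        using xs ne k unfolding has_cycle_def
        by (intro exI[of _ "v # xs"]) (auto simp: successively_Cons)
      then show False using nc by simp
    qed
    then obtain u where u: "u \<in> U" "card (E `` {u} \<inter> U) < 2 * k - 1" by auto
    \<comment> \<open>Removing \<open>u\<close> lowers the degree sum by twice its degree in
      \<open>U\<close>, hence by less than \<open>4 * k\<close>.\<close>
    define W where "W = U - {u}"
    have W: "finite W" "U = insert u W" "u \<notin> W" "W \<subseteq> E `` {v}" "card W = c"
      using u Suc by (auto simp: W_def)
    have "card (E `` {w} \<inter> U) = card (E `` {w} \<inter> W) + (if w \<in> E `` {u} then 1 else 0)" if "w \<in> W" for w
    proof (cases "w \<in> E `` {u}")
      case True
      then have "E `` {w} \<inter> U = insert u (E `` {w} \<inter> W)" using symE W by (auto simp: sym_def)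
      then show ?thesis using True W by simp
    next
      case False
      then have "E `` {w} \<inter> U = E `` {w} \<inter> W" using symE W by (auto simp: sym_def)
      then show ?thesis using False by simp
    qed
    then have "(\<Sum>w\<in>W. card (E `` {w} \<inter> U)) = (\<Sum>w\<in>W. card (E `` {w} \<inter> W)) + (\<Sum>w\<in>W. if w \<in> E `` {u} then 1 else 0)"
      by (simp add: sum.distrib)
    also have "(\<Sum>w\<in>W. if w \<in> E `` {u} then 1 else 0) = card (E `` {u} \<inter> W)"
      using W(1) by (simp add: sum.If_cases Int_commute Int_def)
    also have "\<dots> \<le> card (E `` {u} \<inter> U)" using W \<open>finite U\<close> by (intro card_mono) auto
    also have "(\<Sum>w\<in>W. card (E `` {w} \<inter> W)) \<le> 4 * k * card W"
      using Suc.hyps(1)[of W] W by simp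
    finally have "(\<Sum>w\<in>W. card (E `` {w} \<inter> U)) \<le> 4 * k * card W + card (E `` {u} \<inter> U)" by simp
    moreover have "(\<Sum>w\<in>U. card (E `` {w} \<inter> U)) = card (E `` {u} \<inter> U) + (\<Sum>w\<in>W. card (E `` {w} \<inter> U))"
    proof -
      have "(\<Sum>w\<in>insert u W. card (E `` {w} \<inter> U)) = card (E `` {u} \<inter> U) + (\<Sum>w\<in>W. card (E `` {w} \<inter> U))"
        using W by (intro sum.insert) auto
      then show ?thesis using W(2) by metis
    qed
    moreover have "card U = Suc (card W)" using W by simp
    ultimately show ?case using u(2) k by simp
  qed
qed

section \<open>Dense graphs without a given odd cycle are bipartite\<close>

text \<open>The path alternates between \<open>S\<close> and \<open>T\<close> and grows at its head
  by a fresh \<open>s\<close> and a fresh common neighbour of \<open>s\<close> and the old head. It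
  never has more than \<open>2 * k - 1\<close> vertices, so sets of size \<open>2 * k\<close> always
  offer a fresh one.\<close>

lemma zigzag_path:
  assumes s1: "s1 \<in> S" and disj: "S \<inter> T = {}" and fin: "finite S" "finite T"
    and S: "2 * k \<le> card S"
    and common: "\<And>s s'. s \<in> S \<Longrightarrow> s' \<in> S \<Longrightarrow> 2 * k \<le> card (E `` {s} \<inter> E `` {s'} \<inter> T)"
    and "j < k"
  shows "\<exists>xs. distinct xs \<and> length xs = 2 * j + 1 \<and> successively (\<lambda>x y. (x, y) \<in> E) xs \<and>
    set xs \<subseteq> S \<union> T \<and> hd xs \<in> S \<and> last xs = s1"
  using \<open>j < k\<close>
proof (induction j)
  case 0
  then show ?case using s1 by (intro exI[of _ "[s1]"]) auto
next
  case (Suc j)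
  then obtain xs where xs: "distinct xs" "length xs = 2 * j + 1" "successively (\<lambda>x y. (x, y) \<in> E) xs"
    "set xs \<subseteq> S \<union> T" "hd xs \<in> S" "last xs = s1" by auto
  have card: "card (set xs) < 2 * k" using xs Suc.prems by (simp add: distinct_card)
  have "\<not> S \<subseteq> set xs" using card card_mono[of "set xs" S] S by auto
  then obtain s where s: "s \<in> S" "s \<notin> set xs" by auto
  let ?C = "E `` {s} \<inter> E `` {hd xs} \<inter> T"
  have "\<not> ?C \<subseteq> set xs" using card card_mono[of "set xs" ?C] common[OF s(1) xs(5)] by auto
  then obtain c where c: "(s, c) \<in> E" "(hd xs, c) \<in> E" "c \<in> T" "c \<notin> set xs" by auto
  have "(c, hd xs) \<in> E" using c symE by (auto simp: sym_def)
  moreover have "s \<noteq> c" using s c disj by auto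
  ultimately show ?case
    using xs s c by (intro exI[of _ "s # c # xs"]) (auto simp: successively_Cons)
qed

text \<open>An edge between \<open>p\<close> and \<open>s1\<close> inside the neighbourhood
  \<open>N\<close> of \<open>a\<close> would close a zigzag path: it starts in \<open>N\<close>,
  alternates between \<open>N\<close> and its complement, ends at \<open>s1\<close> and returns
  through \<open>p\<close> and \<open>a\<close>. The exceptional set \<open>B\<close>, where common
  neighbours outside \<open>N\<close> are not guaranteed, must be avoided by \<open>s1\<close> and
  the path, but not by \<open>p\<close>.\<close>

lemma neighbourhoods_independent:
  assumes nc: "\<not> has_cycle E (2 * k + 1)" and k: "1 \<le> k" and m: "500 * k \<le> card V"
    and deg: "\<And>v. v \<in> V \<Longrightarrow> 44 / 100 * real (card V) \<le> card (E `` {v})"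
    and a: "a \<in> V"
  shows "E \<inter> (E `` {a}) \<times> (E `` {a}) = {}"
proof -
  define m where "m = real (card V)"
  have m500: "500 * real k \<le> m" using m by (simp add: m_def)
  have k1: "1 \<le> real k" using k by simp
  define N where "N = E `` {a}"
  have N: "finite N" "N \<subseteq> V" "44 / 100 * m \<le> card N" "card N \<le> m"
    using deg[OF a] fin_nbrs nbrs_subset card_mono[OF finV nbrs_subset[of a]]
    by (auto simp: N_def m_def)
  \<comment> \<open>Outside \<open>B\<close> a vertex keeps at least \<open>29 / 100 * m\<close>
    neighbours outside \<open>N\<close>, slightly more than half of the at most
    \<open>56 / 100 * m\<close> vertices there.\<close>
  define B where "B = {s \<in> N. 15 / 100 * m < card (E `` {s} \<inter> N)}"
  have B: "finite B" "B \<subseteq> N" using N by (auto simp: B_def)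
  have "card B * (15 / 100 * m) = (\<Sum>s\<in>B. 15 / 100 * m)" by simp
  also have "\<dots> \<le> (\<Sum>s\<in>B. real (card (E `` {s} \<inter> N)))"
    by (intro sum_mono) (auto simp: B_def)
  also have "\<dots> \<le> (\<Sum>s\<in>N. real (card (E `` {s} \<inter> N)))"
    using N B by (intro sum_mono2) auto
  also have "\<dots> \<le> 4 * k * real (card N)"
  proof -
    have "real (\<Sum>s\<in>N. card (E `` {s} \<inter> N)) \<le> real (4 * k * card N)"
      using neighbourhood_sparse[OF nc k, of N a] by (simp only: N_def of_nat_le_iff)
    then show ?thesis by simp
  qed
  also have "\<dots> \<le> 4 * k * m" using N by (intro mult_left_mono) auto
  finally have "(15 * real (card B)) * m \<le> (400 * real k) * m" by (simp add: algebra_simps)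
  then have "15 * real (card B) \<le> 400 * real k" 
    by (rule mult_right_le_imp_le) (use m500 k1 in auto)
  then have cardB: "real (card B) \<le> 54 / 1000 * m" using m500 by simp
  define T where "T = V - N - {a}"
  have T: "finite T" "T \<subseteq> V" using finV by (auto simp: T_def)
  have good: False if p: "p \<in> N" and s1: "s1 \<in> N - B" and ps: "(p, s1) \<in> E" for p s1
  proof -
    define S where "S = N - B - {p}"
    have "p \<noteq> s1" using ps irr by (auto simp: irrefl_def)
    then have s1S: "s1 \<in> S" using s1 by (auto simp: S_def)
    have finS: "finite S" using N by (auto simp: S_def)
    have "card N \<le> card (S \<union> B \<union> {p})"
      using finS B by (intro card_mono) (auto simp: S_def)
    also have "\<dots> \<le> card S + card B + 1"
      using card_Un_le[of "S \<union> B" "{p}"] card_Un_le[of S B] by simp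
    finally have "2 * k \<le> card S" using N cardB m500 k1 by linarith
    moreover have "2 * k \<le> card (E `` {s} \<inter> E `` {s'} \<inter> T)" if ss: "s \<in> S" "s' \<in> S" for s s'
    proof -
      \<comment> \<open>Two sets of size \<open>29 / 100 * m\<close> inside \<open>V - N\<close>
        share at least \<open>2 / 100 * m\<close> vertices, that is at least \<open>10 * k\<close>.
        At most one of them is lost, because \<open>a\<close> does not belong to
        \<open>T\<close>.\<close>
      have big: "29 / 100 * m \<le> card (E `` {s} - N)" if "s \<in> S" for s
      proof -
        have "s \<in> V" using that N by (auto simp: S_def)
        have "card (E `` {s}) = card (E `` {s} - N) + card (E `` {s} \<inter> N)"
          using fin_nbrs[of s] by (simp add: card_Diff_subset_Int card_mono)
        moreover have "card (E `` {s} \<inter> N) \<le> 15 / 100 * m" using that by (auto simp: S_def B_def)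
        ultimately show ?thesis using deg[OF \<open>s \<in> V\<close>] by (simp add: m_def)
      qed
      let ?A = "E `` {s} - N" and ?B = "E `` {s'} - N"
      have "card ?A + card ?B = card (?A \<union> ?B) + card (?A \<inter> ?B)"
        using fin_nbrs by (intro card_Un_Int) auto
      moreover have "card (?A \<union> ?B) \<le> card (V - N)"
        using nbrs_subset finV by (intro card_mono) blast+
      moreover have "card (V - N) = card V - card N" using N by (simp add: card_Diff_subset)
      moreover have "card (?A \<inter> ?B) \<le> card (insert a (E `` {s} \<inter> E `` {s'} \<inter> T))"
        using fin_nbrs nbrs_subset by (intro card_mono) (auto simp: T_def)
      moreover have "\<dots> \<le> Suc (card (E `` {s} \<inter> E `` {s'} \<inter> T))"
        using fin_nbrs by (simp add: card_insert_if)
      ultimately have "real (card ?A) + card ?B \<le> (m - card N) + card (E `` {s} \<inter> E `` {s'} \<inter> T) + 1"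
        using N by (simp add: m_def)
      then show ?thesis using big[OF ss(1)] big[OF ss(2)] N m500 k1 by linarith
    qed
    moreover have "S \<inter> T = {}" by (auto simp: S_def T_def)
    ultimately obtain xs where xs: "distinct xs" "length xs = 2 * (k - 1) + 1"
      "successively (\<lambda>x y. (x, y) \<in> E) xs" "set xs \<subseteq> S \<union> T" "hd xs \<in> S" "last xs = s1"
      using zigzag_path[OF s1S _ finS T(1), of k "k - 1"] k by auto
    have "a \<notin> N" using irr by (auto simp: N_def irrefl_def)
    moreover have "(s1, p) \<in> E" "(p, a) \<in> E" "(a, hd xs) \<in> E"
      using ps p symE xs(5) by (auto simp: sym_def N_def S_def)
    moreover have "p \<notin> S \<union> T" "a \<notin> S \<union> T" using p \<open>a \<notin> N\<close> by (auto simp: S_def T_def)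
    moreover have "xs \<noteq> []" using xs by auto
    \<comment> \<open>The zigzag path has \<open>2 * k - 1\<close> vertices, and \<open>p\<close>
      and \<open>a\<close> complete the cycle.\<close>
    ultimately have "has_cycle E (2 * k + 1)"
      using xs k p unfolding has_cycle_def
      by (intro exI[of _ "xs @ [p, a]"]) (auto simp: successively_append_iff)
    then show False using nc by simp
  qed
  \<comment> \<open>By \<open>good\<close>, which constrains only the endpoint \<open>s1\<close>,
    all neighbours in \<open>N\<close> of a vertex of \<open>B\<close> lie in \<open>B\<close>.
    There are more than \<open>15 / 100 * m\<close> of them, but \<open>B\<close> has at most
    \<open>54 / 1000 * m\<close> elements.\<close>
  have "B = {}"
  proof (rule ccontr)
    assume "B \<noteq> {}"
    then obtain p where p: "p \<in> B" by auto
    have "E `` {p} \<inter> N \<subseteq> B" using good p B by auto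
    then have "card (E `` {p} \<inter> N) \<le> card B" using B by (intro card_mono)
    then show False using p cardB by (auto simp: B_def)
  qed
  then show ?thesis using good by (auto simp: N_def)
qed

text \<open>An argument of Andrasfai type: independent neighbourhoods exclude triangles, the minimum
  degree excludes closed walks of length 5, and then having a common neighbour with a fixed vertex
  \<open>a\<close> is a 2-colouring.\<close>

lemma bipartite_of_min_degree:
  assumes nc: "\<not> has_cycle E (2 * k + 1)" and k: "1 \<le> k" and m: "500 * k \<le> card V"
    and deg: "\<And>v. v \<in> V \<Longrightarrow> 44 / 100 * real (card V) \<le> card (E `` {v})"
  shows "bipartite E"
proof -
  have "card V > 0" using m k by linarith
  then have pos: "real (card V) > 0" by simp
  have inV: "u \<in> V \<and> v \<in> V" if "(u, v) \<in> E" for u v using that EV by auto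
  have tri: False if "(u, v) \<in> E" "(v, w) \<in> E" "(w, u) \<in> E" for u v w
    using neighbourhoods_independent[OF assms, of u] that inV symE by (fastforce simp: sym_def)
  have card_ind: "real (card (E `` {v})) = (\<Sum>w\<in>V. of_bool ((v, w) \<in> E))" for v
  proof -
    have "V \<inter> {w. (v, w) \<in> E} = E `` {v}" using EV by auto
    then show ?thesis using finV by (simp add: of_bool_def sum.If_cases)
  qed
  \<comment> \<open>The five vertices may coincide. Without triangles no vertex is adjacent to both
    ends of an arc, so each vertex sees at most two of the five positions, whereas the degrees add
    up to at least \<open>220 / 100\<close> times \<open>card V\<close>.\<close>
  have c5: False if c: "(v0, v1) \<in> E" "(v1, v2) \<in> E" "(v2, v3) \<in> E" "(v3, v4) \<in> E" "(v4, v0) \<in> E"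
    for v0 v1 v2 v3 v4
  proof -
    have nonadj: "\<not> ((u, w) \<in> E \<and> (v, w) \<in> E)" if "(u, v) \<in> E" for u v w
      using tri that symE by (meson symD)
    have "real (card (E `` {v0})) + card (E `` {v1}) + card (E `` {v2}) + card (E `` {v3}) + card (E `` {v4})
      = (\<Sum>w\<in>V. of_bool ((v0, w) \<in> E) + of_bool ((v1, w) \<in> E) + of_bool ((v2, w) \<in> E) +
            of_bool ((v3, w) \<in> E) + of_bool ((v4, w) \<in> E))"
      by (simp add: card_ind sum.distrib)
    also have "\<dots> \<le> (\<Sum>w\<in>V. 2)"
    proof (rule sum_mono)
      fix w
      show "of_bool ((v0, w) \<in> E) + of_bool ((v1, w) \<in> E) + of_bool ((v2, w) \<in> E) +
            of_bool ((v3, w) \<in> E) + of_bool ((v4, w) \<in> E) \<le> (2 :: real)"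
        using nonadj[OF c(1), of w] nonadj[OF c(2), of w] nonadj[OF c(3), of w] nonadj[OF c(4), of w]
          nonadj[OF c(5), of w] by (auto simp: of_bool_def)
    qed
    also have "\<dots> = 2 * real (card V)" by simp
    finally show False using deg[of v0] deg[of v1] deg[of v2] deg[of v3] deg[of v4] inV c pos by fastforce
  qed
  obtain a where a: "a \<in> V" using \<open>card V > 0\<close> by (metis card_gt_0_iff ex_in_conv)
  \<comment> \<open>An arc within \<open>X\<close> gives a closed walk of length 5 through
    \<open>a\<close>; an arc outside \<open>X\<close> gives three disjoint neighbourhoods, together
    larger than \<open>V\<close>.\<close>
  define X where "X = {v. E `` {v} \<inter> E `` {a} \<noteq> {}}"
  have "u \<in> X \<longleftrightarrow> w \<notin> X" if uw: "(u, w) \<in> E" for u w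
  proof
    assume "u \<in> X"
    then obtain p where p: "(u, p) \<in> E" "(a, p) \<in> E" by (auto simp: X_def)
    show "w \<notin> X"
    proof
      assume "w \<in> X"
      then obtain q where q: "(w, q) \<in> E" "(a, q) \<in> E" by (auto simp: X_def)
      show False using c5[of w u p a q] p q uw symE by (auto simp: sym_def)
    qed
  next
    assume w: "w \<notin> X"
    show "u \<in> X"
    proof (rule ccontr)
      assume u: "u \<notin> X"
      have "E `` {u} \<inter> E `` {w} = {}"
      proof (rule equals0I)
        fix x assume "x \<in> E `` {u} \<inter> E `` {w}"
        then have "(w, x) \<in> E" "(x, u) \<in> E" using symE by (auto simp: sym_def)
        then show False using tri[OF uw] by blast
      qed
      then have "card (E `` {u} \<union> E `` {w} \<union> E `` {a}) = card (E `` {u}) + card (E `` {w}) + card (E `` {a})"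
        using u w fin_nbrs by (subst card_Un_disjoint; auto simp: X_def card_Un_disjoint)+
      moreover have "card (E `` {u} \<union> E `` {w} \<union> E `` {a}) \<le> card V"
        using nbrs_subset finV by (intro card_mono) auto
      ultimately show False using deg[of u] deg[of w] deg[OF a] inV[OF uw] pos by auto
    qed
  qed
  then show ?thesis by (auto simp: bipartite_def)
qed

end

section \<open>Spectral radius of graphs without a given odd cycle\<close>

context sgraph
begin

lemma top_eigenvector:
  assumes "V \<noteq> {}"
  obtains r x where "(\<Sum>v\<in>V. (x v)\<^sup>2) = 1" "\<And>v. v \<in> V \<Longrightarrow> (\<Sum>w\<in>E `` {v}. x w) = r * x v"
    "\<And>y. qform E y \<le> r * (\<Sum>v\<in>V. (y v)\<^sup>2)"
proof -
  define G where "G = \<lparr>pverts = V, parcs = E\<rparr>"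
  have pg: "pair_graph G"
    using finV EV symE irr by (simp add: G_def pair_graph_iff)
  have c: "0 < card (pverts G)" using assms finV by (simp add: G_def card_gt_0_iff)
  obtain u where u:
    "\<And>i. i < card (pverts G) \<Longrightarrow> (\<Sum>v\<in>pverts G. (u i v)\<^sup>2) = 1"
    "\<And>i v. i < card (pverts G) \<Longrightarrow> v \<in> pverts G \<Longrightarrow>
       (\<Sum>w\<in>parcs G `` {v}. u i w) = graph_eigenvalue (Suc i) G * u i v"
    "\<And>i j. i < card (pverts G) \<Longrightarrow> j < card (pverts G) \<Longrightarrow> i \<noteq> j \<Longrightarrow> (\<Sum>v\<in>pverts G. u i v * u j v) = 0"
    "\<And>i y. i < card (pverts G) \<Longrightarrow> (\<forall>j<i. (\<Sum>v\<in>pverts G. u j v * y v) = 0) \<Longrightarrow>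
       qform (parcs G) y \<le> graph_eigenvalue (Suc i) G * (\<Sum>v\<in>pverts G. (y v)\<^sup>2)"
    by (rule graph_eigenbasis[OF pg]) (rule that; assumption)
  show ?thesis
    by (rule that[of "u 0" "graph_eigenvalue (Suc 0) G"])
      (use u(1)[OF c] u(2)[OF c] u(4)[OF c] in \<open>auto simp: G_def\<close>)
qed

lemma card_split_nbrs: "card (E `` {u}) = card (E `` {u} \<inter> A) + card (E `` {u} - A)"
  using fin_nbrs[of u] by (metis Int_lower1 card_Diff_subset_Int card_mono finite_Int le_add_diff_inverse)

text \<open>Applying the eigenvalue equation twice at a vertex \<open>v\<close> of largest absolute
  entry bounds \<open>r\<^sup>2\<close> by the number of walks of length 2 from \<open>v\<close>.
  With \<open>d\<close> the degree of \<open>v\<close>, at most \<open>4 * k * d\<close> of them end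
  inside its neighbourhood by sparsity, and at most \<open>d * (m - d)\<close> end outside.\<close>

lemma crude_spectral_bound:
  assumes nc: "\<not> has_cycle E (2 * k + 1)" and k: "1 \<le> k"
  shows "qform E y \<le> (card V / 2 + 2 * k) * (\<Sum>v\<in>V. (y v)\<^sup>2)"
proof (cases "V = {}")
  case True
  then have "E = {}" using EV by auto
  then show ?thesis using True by (simp add: qform_def)
next
  case False
  then obtain r x where x: "(\<Sum>v\<in>V. (x v)\<^sup>2) = 1" "\<And>v. v \<in> V \<Longrightarrow> (\<Sum>w\<in>E `` {v}. x w) = r * x v"
    and max: "\<And>y. qform E y \<le> r * (\<Sum>v\<in>V. (y v)\<^sup>2)"
    using top_eigenvector by metis
  have "Max ((\<lambda>v. \<bar>x v\<bar>) ` V) \<in> (\<lambda>v. \<bar>x v\<bar>) ` V" using finV False by (intro Max_in) auto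
  then obtain v where v: "v \<in> V" "\<bar>x v\<bar> = Max ((\<lambda>v. \<bar>x v\<bar>) ` V)" by auto
  have le: "\<bar>x w\<bar> \<le> \<bar>x v\<bar>" if "w \<in> V" for w
    using that finV v by auto
  have pos: "\<bar>x v\<bar> > 0"
  proof (rule ccontr)
    assume "\<not> ?thesis"
    then have "\<forall>w\<in>V. x w = 0" using le by auto
    then show False using x(1) by simp
  qed
  let ?N = "E `` {v}"
  define d where "d = real (card ?N)"
  define m where "m = real (card V)"
  have dm: "d \<le> m" using card_mono[OF finV nbrs_subset] by (simp add: d_def m_def)
  have "r\<^sup>2 * \<bar>x v\<bar> = \<bar>r * (r * x v)\<bar>" by (simp add: power2_eq_square abs_mult)
  also have "r * (r * x v) = (\<Sum>u\<in>?N. r * x u)" using x(2)[OF v(1)] by (simp flip: sum_distrib_left)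
  also have "\<dots> = (\<Sum>u\<in>?N. \<Sum>w\<in>E `` {u}. x w)"
    using EV by (intro sum.cong refl x(2)[symmetric]) auto
  also have "\<bar>\<dots>\<bar> \<le> (\<Sum>u\<in>?N. \<Sum>w\<in>E `` {u}. \<bar>x v\<bar>)"
    using le nbrs_subset by (intro order_trans[OF sum_abs] sum_mono order_trans[OF sum_abs]) auto
  also have "\<dots> = real (\<Sum>u\<in>?N. card (E `` {u})) * \<bar>x v\<bar>" by (simp add: sum_distrib_right)
  finally have "r\<^sup>2 \<le> real (\<Sum>u\<in>?N. card (E `` {u}))" using pos by simp
  also have "(\<Sum>u\<in>?N. card (E `` {u})) = (\<Sum>u\<in>?N. card (E `` {u} \<inter> ?N)) + (\<Sum>u\<in>?N. card (E `` {u} - ?N))"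
    unfolding sum.distrib[symmetric] by (intro sum.cong card_split_nbrs refl)
  also have "\<dots> \<le> 4 * k * card ?N + card ?N * (card V - card ?N)"
  proof (rule add_mono)
    show "(\<Sum>u\<in>?N. card (E `` {u} \<inter> ?N)) \<le> 4 * k * card ?N"
      using neighbourhood_sparse[OF nc k order_refl] by simp
    have "card (E `` {u} - ?N) \<le> card V - card ?N" for u
      using card_mono[of "V - ?N" "E `` {u} - ?N"] nbrs_subset finV fin_nbrs
      by (auto simp: card_Diff_subset)
    then show "(\<Sum>u\<in>?N. card (E `` {u} - ?N)) \<le> card ?N * (card V - card ?N)"
      using sum_bounded_above[of ?N "\<lambda>u. card (E `` {u} - ?N)"] by simp
  qed
  also have "real \<dots> = 4 * k * d + d * (m - d)"
    using dm by (simp add: d_def m_def of_nat_diff)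
  finally have r2: "r\<^sup>2 \<le> 4 * k * d + d * (m - d)" by simp
  \<comment> \<open>The expression is \<open>d * (m + 4 * k - d)\<close>, which is largest at
    \<open>d = m / 2 + 2 * k\<close>.\<close>
  also have "\<dots> \<le> (m / 2 + 2 * k)\<^sup>2"
    using zero_le_power2[of "d - (m / 2 + 2 * k)"] by (simp add: power2_eq_square algebra_simps)
  finally have "r \<le> m / 2 + 2 * k"
    using power2_le_imp_le[of r "m / 2 + 2 * k"] by (simp add: m_def)
  then have "r * (\<Sum>v\<in>V. (y v)\<^sup>2) \<le> (m / 2 + 2 * k) * (\<Sum>v\<in>V. (y v)\<^sup>2)"
    by (intro mult_right_mono sum_nonneg) auto
  then show ?thesis using max[of y] by (simp add: m_def)
qed

lemma qform_delete:
  "qform E x = qform (E \<inter> (V - {v}) \<times> (V - {v})) x + 2 * x v * (\<Sum>w\<in>E `` {v}. x w)"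
proof -
  let ?A = "E \<inter> (V - {v}) \<times> (V - {v})" and ?B = "Pair v ` (E `` {v})" and ?C = "(\<lambda>w. (w, v)) ` (E `` {v})"
  have "finite E" using finV EV by (meson finite_SigmaI finite_subset)
  have "E = ?A \<union> ?B \<union> ?C" using EV symE by (auto simp: sym_def)
  then have "qform E x = (\<Sum>(u, w)\<in>?A \<union> ?B \<union> ?C. x u * x w)" by (simp add: qform_def)
  also have "\<dots> = (\<Sum>(u, w)\<in>?A. x u * x w) + (\<Sum>(u, w)\<in>?B. x u * x w) + (\<Sum>(u, w)\<in>?C. x u * x w)"
    using \<open>finite E\<close> fin_nbrs irr by (subst sum.union_disjoint; (auto simp: irrefl_def)?)+
  also have "(\<Sum>(u, w)\<in>?B. x u * x w) = x v * (\<Sum>w\<in>E `` {v}. x w)"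
    by (subst sum.reindex) (auto simp: inj_on_def sum_distrib_left)
  also have "(\<Sum>(u, w)\<in>?C. x u * x w) = x v * (\<Sum>w\<in>E `` {v}. x w)"
    by (subst sum.reindex) (auto simp: inj_on_def sum_distrib_left mult.commute)
  finally show ?thesis by (simp add: qform_def)
qed

lemma qform_bipartite_le:
  assumes bip: "\<And>u v. (u, v) \<in> E \<Longrightarrow> u \<in> X \<longleftrightarrow> v \<notin> X"
  shows "qform E y \<le> 2 * ((\<Sum>v\<in>V \<inter> X. \<bar>y v\<bar>) * (\<Sum>v\<in>V - X. \<bar>y v\<bar>))"
proof -
  let ?A = "V \<inter> X" and ?B = "V - X"
  have "qform E y \<le> (\<Sum>(u, v)\<in>E. \<bar>y u\<bar> * \<bar>y v\<bar>)"
    unfolding qform_def by (intro sum_mono) (auto simp flip: abs_mult)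
  also have "\<dots> \<le> (\<Sum>(u, v)\<in>?A \<times> ?B \<union> ?B \<times> ?A. \<bar>y u\<bar> * \<bar>y v\<bar>)"
    using finV EV bip by (intro sum_mono2) fastforce+
  also have "\<dots> = (\<Sum>(u, v)\<in>?A \<times> ?B. \<bar>y u\<bar> * \<bar>y v\<bar>) + (\<Sum>(u, v)\<in>?B \<times> ?A. \<bar>y u\<bar> * \<bar>y v\<bar>)"
    using finV by (intro sum.union_disjoint) auto
  also have "\<dots> = 2 * ((\<Sum>v\<in>?A. \<bar>y v\<bar>) * (\<Sum>v\<in>?B. \<bar>y v\<bar>))"
    by (simp add: sum.cartesian_product[symmetric] sum_product[symmetric] mult.commute)
  finally show ?thesis .
qed

text \<open>Cauchy-Schwarz on each side, then the inequality of the two means between the sides. Any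
  \<open>s\<close> above the geometric mean of the part sizes is allowed, so the lemma serves for
  \<open>card V / 2\<close> as well as for the exact radius.\<close>

lemma qform_bipartite_le_sqrt:
  assumes bip: "\<And>u v. (u, v) \<in> E \<Longrightarrow> u \<in> X \<longleftrightarrow> v \<notin> X"
    and s: "0 \<le> s" "real (card (V \<inter> X)) * card (V - X) \<le> s\<^sup>2"
  shows "qform E y \<le> s * (\<Sum>v\<in>V. (y v)\<^sup>2)"
proof -
  let ?A = "V \<inter> X" and ?B = "V - X"
  define a where "a = (\<Sum>v\<in>?A. \<bar>y v\<bar>)"
  define b where "b = (\<Sum>v\<in>?B. \<bar>y v\<bar>)"
  define \<alpha> where "\<alpha> = (\<Sum>v\<in>?A. (y v)\<^sup>2)"
  define \<beta> where "\<beta> = (\<Sum>v\<in>?B. (y v)\<^sup>2)"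
  have nn: "\<alpha> \<ge> 0" "\<beta> \<ge> 0" by (auto simp: \<alpha>_def \<beta>_def sum_nonneg)
  have "a\<^sup>2 \<le> \<alpha> * card ?A" "b\<^sup>2 \<le> \<beta> * card ?B"
    using sum_squared_le_sum_of_squares[of "\<lambda>v. \<bar>y v\<bar>"] by (auto simp: a_def b_def \<alpha>_def \<beta>_def)
  then have "a\<^sup>2 * b\<^sup>2 \<le> (\<alpha> * card ?A) * (\<beta> * card ?B)"
    using nn by (intro mult_mono) auto
  then have "(a * b)\<^sup>2 \<le> (real (card ?A) * card ?B) * (\<alpha> * \<beta>)"
    by (simp add: power_mult_distrib algebra_simps)
  also have "\<dots> \<le> s\<^sup>2 * (\<alpha> * \<beta>)" using s nn by (intro mult_right_mono) auto
  also have "\<dots> \<le> s\<^sup>2 * ((\<alpha> + \<beta>) / 2)\<^sup>2"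
    using zero_le_power2[of "\<alpha> - \<beta>"]
    by (intro mult_left_mono) (auto simp: power2_eq_square field_simps)
  finally have "(a * b)\<^sup>2 \<le> (s * ((\<alpha> + \<beta>) / 2))\<^sup>2" by (simp only: power_mult_distrib)
  then have "a * b \<le> s * ((\<alpha> + \<beta>) / 2)"
    by (rule power2_le_imp_le) (use s nn in auto)
  moreover have "\<alpha> + \<beta> = (\<Sum>v\<in>V. (y v)\<^sup>2)"
    using finV by (simp add: \<alpha>_def \<beta>_def sum.Int_Diff[of V _ X])
  moreover have "qform E y \<le> 2 * (a * b)"
    using qform_bipartite_le[OF bip] by (simp add: a_def b_def)
  ultimately show ?thesis by simp
qed

lemma qform_bipartite_half:
  assumes "bipartite E"
  shows "qform E y \<le> card V / 2 * (\<Sum>v\<in>V. (y v)\<^sup>2)"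
proof -
  obtain X where "\<forall>(u, v) \<in> E. u \<in> X \<longleftrightarrow> v \<notin> X"
    using assms unfolding bipartite_def by auto
  then have X: "u \<in> X \<longleftrightarrow> v \<notin> X" if "(u, v) \<in> E" for u v
    using that by blast
  have "card V = card (V \<inter> X) + card (V - X)"
    by (rule card_Int_Diff[OF finV])
  then have "real (card (V \<inter> X)) * card (V - X) \<le> (card V / 2)\<^sup>2"
    using zero_le_power2[of "real (card (V \<inter> X)) - card (V - X)"]
    by (simp add: power2_eq_square field_simps)
  then show ?thesis by (intro qform_bipartite_le_sqrt[OF X]) auto
qed

section \<open>Flat eigenvectors, deletion of a vertex, and the descent\<close>

text \<open>By Cauchy-Schwarz \<open>(r * x v)\<^sup>2 \<le> S * d\<close>, where \<open>S\<close>
  is the mass on the neighbourhood. If \<open>d < 44 / 100 * m\<close>, the non-neighbours carry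
  mass at least 0.504, so the right side is at most about \<open>0.218 * m\<close>, while flatness
  makes the left side at least about \<open>0.225 * m\<close>.\<close>

lemma min_degree_of_flat_eigenvector:
  assumes unit: "(\<Sum>v\<in>V. (x v)\<^sup>2) = 1" and eig: "(\<Sum>w\<in>E `` {v}. x w) = r * x v"
    and flat: "\<And>w. w \<in> V \<Longrightarrow> 9 / 10 / card V \<le> (x w)\<^sup>2"
    and r: "card V / 2 - 1 / 40 \<le> r" and m: "500 \<le> card V" and v: "v \<in> V"
  shows "44 / 100 * real (card V) \<le> card (E `` {v})"
proof (rule ccontr)
  define m where "m = real (card V)"
  have m500: "500 \<le> m" using m by (simp add: m_def)
  let ?N = "E `` {v}"
  define d where "d = real (card ?N)"
  define S where "S = (\<Sum>w\<in>?N. (x w)\<^sup>2)"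
  assume "\<not> ?thesis"
  then have d: "d < 44 / 100 * m" "0 \<le> d" by (auto simp: d_def m_def)
  have "(r * x v)\<^sup>2 \<le> S * d"
    using sum_squared_le_sum_of_squares[of x ?N] eig by (simp add: S_def d_def)
  moreover have "S \<le> 496 / 1000"
  proof -
    have "(m - d) * (9 / 10 / m) = (\<Sum>w\<in>V - ?N. 9 / 10 / m)"
      using nbrs_subset finV fin_nbrs card_mono[OF finV nbrs_subset[of v]]
      by (simp add: card_Diff_subset m_def d_def of_nat_diff)
    also have "\<dots> \<le> (\<Sum>w\<in>V - ?N. (x w)\<^sup>2)"
      using flat by (intro sum_mono) (auto simp: m_def)
    also have "\<dots> = 1 - S"
      using unit nbrs_subset finV fin_nbrs by (simp add: S_def sum_diff)
    finally have "S \<le> 1 - (m - d) * (9 / 10 / m)" by simp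
    moreover have "(56 / 100 * m) * (9 / 10 / m) \<le> (m - d) * (9 / 10 / m)"
      using d m500 by (intro mult_right_mono) auto
    moreover have "(56 / 100 * m) * (9 / 10 / m) = 504 / 1000" using m500 by simp
    ultimately show ?thesis by linarith
  qed
  then have "S * d \<le> 496 / 1000 * (44 / 100 * m)"
    using d by (intro mult_mono) auto
  \<comment> \<open>\<open>4999 / 10000 * m\<close> is at most \<open>m / 2 - 1 / 40\<close> because
    \<open>500 \<le> m\<close>.\<close>
  moreover have "(4999 / 10000 * m)\<^sup>2 * (9 / 10 / m) \<le> r\<^sup>2 * (x v)\<^sup>2"
    using flat[OF v] r m500 by (intro mult_mono power_mono) (auto simp: m_def)
  moreover have "(4999 / 10000 * m)\<^sup>2 * (9 / 10 / m) = 4999 / 10000 * (4999 / 10000) * (9 / 10) * m"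
    using m500 by (simp add: power2_eq_square)
  ultimately show False using m500 by (simp add: power_mult_distrib)
qed

text \<open>Let \<open>t\<close> be the mass at \<open>v\<close>. Splitting off its row and column
  gives \<open>r * (1 - 2 * t) \<le> c * (1 - t)\<close>, so \<open>r - c\<close> is at most
  \<open>c * t / (1 - 2 * t)\<close>. With \<open>t\<close> at most \<open>9 / 10 / m\<close> and
  \<open>c\<close> close to \<open>m / 2\<close> this is about 0.45, while half the order drops by
  \<open>1 / 2\<close>; the difference is the gain.\<close>

lemma deletion_step:
  assumes unit: "(\<Sum>v\<in>V. (x v)\<^sup>2) = 1" and eig: "\<And>v. v \<in> V \<Longrightarrow> (\<Sum>w\<in>E `` {v}. x w) = r * x v"
    and v: "v \<in> V" "(x v)\<^sup>2 \<le> 9 / 10 / card V"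
    and bound: "qform (E \<inter> (V - {v}) \<times> (V - {v})) x \<le> c * (\<Sum>w\<in>V - {v}. (x w)\<^sup>2)"
    and c: "0 \<le> c" "c \<le> card V / 2 + 2 * k" and m: "500 * k \<le> card V" and k: "1 \<le> k"
  shows "r \<le> c + 1 / 2 - 1 / 40"
proof -
  define m where "m = real (card V)"
  have m500: "500 * real k \<le> m" "500 \<le> m" using m k by (auto simp: m_def)
  define t where "t = (x v)\<^sup>2"
  have "qform E x = r"
    using unit by (simp add: qform_rows[OF finV EV] eig power2_eq_square algebra_simps flip: sum_distrib_left)
  moreover have "(\<Sum>w\<in>V - {v}. (x w)\<^sup>2) = 1 - t"
    using unit v finV by (simp add: t_def sum_diff1)
  then have "qform (E \<inter> (V - {v}) \<times> (V - {v})) x \<le> c * (1 - t)"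
    using bound by simp
  moreover have "qform E x = qform (E \<inter> (V - {v}) \<times> (V - {v})) x + 2 * r * t"
    using qform_delete[of x v] eig[OF v(1)] by (simp add: t_def power2_eq_square)
  ultimately have "r - 2 * r * t \<le> c * (1 - t)" by simp
  moreover have "0 \<le> t" "t \<le> 9 / 10 / m" using v by (auto simp: t_def m_def)
  moreover have "9 / 10 / m \<le> 9 / 10 / 500" using m500 by (intro divide_left_mono) auto
  \<comment> \<open>The factor 504 / 1000 is \<open>1 / 2 + 2 / 500\<close>, since
    \<open>2 * k\<close> is at most \<open>2 / 500 * m\<close>.\<close>
  moreover have "c * t \<le> 504 / 1000 * m * (9 / 10 / m)"
    using calculation c m500 by (intro mult_mono) (auto simp: m_def)
  then have "c * t \<le> 504 / 1000 * (9 / 10)" using m500 by simp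
  ultimately have t: "t \<le> 9 / 5000" "0 \<le> t" "c * t \<le> 4536 / 10000" and r: "r * (1 - 2 * t) \<le> c * (1 - t)"
    by (auto simp: algebra_simps)
  have "c * (1 - t) \<le> (c + 475 / 1000) * (1 - 2 * t)"
    using t by (simp add: algebra_simps)
  then have "r * (1 - 2 * t) \<le> (c + 475 / 1000) * (1 - 2 * t)" using r by linarith
  then have "r \<le> c + 475 / 1000" using t by (simp add: mult_le_cancel_right)
  then show ?thesis by simp
qed

text \<open>The excess \<open>c\<close> over half the order is kept abstract: the descent uses it
  with shrinking \<open>c\<close>, the stability result with \<open>c = 0\<close>.\<close>

lemma nonbipartite_step:
  assumes nc: "\<not> has_cycle E (2 * k + 1)" and k: "1 \<le> k" and m: "500 * k < card V"
    and bound: "\<And>v y. v \<in> V \<Longrightarrow> qform (E \<inter> (V - {v}) \<times> (V - {v})) y \<le>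
      ((real (card V) - 1) / 2 + c) * (\<Sum>w\<in>V - {v}. (y w)\<^sup>2)"
    and c: "0 \<le> c" "c \<le> 2 * k" and nb: "\<not> bipartite E"
  shows "qform E y \<le> (card V / 2 + c - 1 / 40) * (\<Sum>v\<in>V. (y v)\<^sup>2)"
proof -
  have "V \<noteq> {}" using m by auto
  then obtain r x where x: "(\<Sum>v\<in>V. (x v)\<^sup>2) = 1" "\<And>v. v \<in> V \<Longrightarrow> (\<Sum>w\<in>E `` {v}. x w) = r * x v"
    and max: "\<And>y. qform E y \<le> r * (\<Sum>v\<in>V. (y v)\<^sup>2)"
    using top_eigenvector by metis
  have "r \<le> card V / 2 + c - 1 / 40"
  proof (rule ccontr)
    assume r: "\<not> ?thesis"
    show False
    proof (cases "\<forall>v\<in>V. 9 / 10 / card V \<le> (x v)\<^sup>2")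
      case True
      have "44 / 100 * real (card V) \<le> card (E `` {v})" if "v \<in> V" for v
        using True r c m k by (intro min_degree_of_flat_eigenvector[OF x(1) x(2)] that) auto
      then have "bipartite E" using m by (intro bipartite_of_min_degree[OF nc k]) auto
      then show False using nb by simp
    next
      case False
      then obtain v where v: "v \<in> V" "(x v)\<^sup>2 < 9 / 10 / card V" by fastforce
      have "r \<le> ((real (card V) - 1) / 2 + c) + 1 / 2 - 1 / 40"
        by (rule deletion_step[OF x v(1) _ bound[OF v(1)]]) (use v c k m in \<open>auto simp: field_simps\<close>)
      then show False using r by (simp add: field_simps)
    qed
  qed
  then have "r * (\<Sum>v\<in>V. (y v)\<^sup>2) \<le> (card V / 2 + c - 1 / 40) * (\<Sum>v\<in>V. (y v)\<^sup>2)"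
    by (intro mult_right_mono sum_nonneg) auto
  then show ?thesis using max[of y] by simp
qed

end

text \<open>Here \<open>j\<close> is the number of deletions still available before the order could
  fall below \<open>500 * k\<close>. The crude bound is the case \<open>j = 0\<close>, and each
  deletion saves \<open>1 / 40\<close>. The excess is truncated at 0 because a bipartite graph met
  on the way guarantees no more than that.\<close>

lemma spectral_bound_descent:
  assumes "sgraph V E" and nc: "\<not> has_cycle E (2 * k + 1)" and k: "1 \<le> k"
    and m: "500 * k + j \<le> card V"
  shows "qform E y \<le> (card V / 2 + max 0 (2 * k - j / 40)) * (\<Sum>v\<in>V. (y v)\<^sup>2)"
  using assms
proof (induction j arbitrary: V E y)
  case 0
  interpret sgraph V E by fact
  show ?case using crude_spectral_bound[OF 0(2) k] by simp
next
  case (Suc j)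
  interpret sgraph V E by fact
  let ?c = "max 0 (2 * real k - j / 40)" and ?c' = "max 0 (2 * real k - Suc j / 40)"
  have nn: "0 \<le> (\<Sum>v\<in>V. (y v)\<^sup>2)" by (simp add: sum_nonneg)
  have "qform E y \<le> (card V / 2 + ?c') * (\<Sum>v\<in>V. (y v)\<^sup>2)"
  proof (cases "bipartite E")
    case True
    have "card V / 2 * (\<Sum>v\<in>V. (y v)\<^sup>2) \<le> (card V / 2 + ?c') * (\<Sum>v\<in>V. (y v)\<^sup>2)"
      using nn by (intro mult_right_mono) auto
    then show ?thesis using qform_bipartite_half[OF True, of y] by simp
  next
    case False
    have "qform E y \<le> (card V / 2 + ?c - 1 / 40) * (\<Sum>v\<in>V. (y v)\<^sup>2)"
    proof (rule nonbipartite_step[OF Suc.prems(2) k _ _ _ _ False])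
      fix v y assume v: "v \<in> V"
      have card: "card V = Suc (card (V - {v}))" using v finV by (simp only: card_Suc_Diff1)
      have "\<not> has_cycle (E \<inter> (V - {v}) \<times> (V - {v})) (2 * k + 1)"
        using Suc.prems(2) has_cycle_mono by blast
      moreover have "sgraph (V - {v}) (E \<inter> (V - {v}) \<times> (V - {v}))"
        by (intro sgraph_restrict) auto
      ultimately show "qform (E \<inter> (V - {v}) \<times> (V - {v})) y \<le>
          ((real (card V) - 1) / 2 + ?c) * (\<Sum>w\<in>V - {v}. (y w)\<^sup>2)"
        using Suc.IH[of "V - {v}" "E \<inter> (V - {v}) \<times> (V - {v})" y] Suc.prems(4) k unfolding card by simp
    qed (use Suc.prems k in auto)
    also have "\<dots> \<le> (card V / 2 + ?c') * (\<Sum>v\<in>V. (y v)\<^sup>2)"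
      using nn by (intro mult_right_mono) (auto simp: max_def field_simps)
    finally show ?thesis .
  qed
  then show ?case by simp
qed

context sgraph
begin

lemma spectral_turan_bound:
  assumes nc: "\<not> has_cycle E (2 * k + 1)" and k: "1 \<le> k" and m: "580 * k \<le> card V"
  shows "qform E y \<le> card V / 2 * (\<Sum>v\<in>V. (y v)\<^sup>2)"
  using spectral_bound_descent[OF sgraph_axioms nc k, of "80 * k" y] m by simp

text \<open>Vertex-deleted subgraphs still have \<open>580 * k\<close> vertices and thus excess 0,
  so one further deletion step pushes the radius below half the order.\<close>

lemma spectral_turan_stability:
  assumes nc: "\<not> has_cycle E (2 * k + 1)" and k: "1 \<le> k" and m: "580 * k < card V"
    and nb: "\<not> bipartite E"
  shows "qform E y \<le> (card V / 2 - 1 / 40) * (\<Sum>v\<in>V. (y v)\<^sup>2)"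
proof -
  have "qform E y \<le> (card V / 2 + 0 - 1 / 40) * (\<Sum>v\<in>V. (y v)\<^sup>2)"
  proof (rule nonbipartite_step[OF nc k _ _ _ _ nb])
    fix v y assume v: "v \<in> V"
    interpret D: sgraph "V - {v}" "E \<inter> (V - {v}) \<times> (V - {v})"
      by (intro sgraph_restrict) auto
    have card: "card V = Suc (card (V - {v}))" using v finV by (simp only: card_Suc_Diff1)
    have "\<not> has_cycle (E \<inter> (V - {v}) \<times> (V - {v})) (2 * k + 1)"
      using nc has_cycle_mono by blast
    then have "qform (E \<inter> (V - {v}) \<times> (V - {v})) y \<le>
        real (card (V - {v})) / 2 * (\<Sum>w\<in>V - {v}. (y w)\<^sup>2)"
      using spectral_bound_descent[OF D.sgraph_axioms _ k, of "80 * k" y] m card by simp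
    then show "qform (E \<inter> (V - {v}) \<times> (V - {v})) y \<le>
          ((real (card V) - 1) / 2 + 0) * (\<Sum>w\<in>V - {v}. (y w)\<^sup>2)"
      unfolding card by simp
  qed (use m in auto)
  then show ?thesis by simp
qed

end

section \<open>Isomorphic copies and the second eigenvalue\<close>

lemma pair_graph_wf: "pair_graph G \<Longrightarrow> wf_digraph (with_proj G)"
  by (auto simp: pair_graph_iff wf_digraph_def)

lemma sgraph_pair_graph: "pair_graph G \<Longrightarrow> sgraph (pverts G) (parcs G)"
  by (auto simp: pair_graph_iff sgraph_def)

text \<open>A digraph isomorphism also carries an arc map and end maps; for pair graphs these are
  determined by the vertex map. The converse is \<open>digraph_iso_pairE\<close>.\<close>

lemma digraph_iso_pairI:
  assumes G: "pair_graph G" and f: "bij_betw f (pverts G) (pverts H)"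
    and H: "parcs H \<subseteq> pverts H \<times> pverts H"
    and iff: "\<And>u v. u \<in> pverts G \<Longrightarrow> v \<in> pverts G \<Longrightarrow> (u, v) \<in> parcs G \<longleftrightarrow> (f u, f v) \<in> parcs H"
  shows "digraph_iso (with_proj G) (with_proj H)"
proof -
  let ?h = "\<lparr>iso_verts = f, iso_arcs = map_prod f f, iso_head = snd, iso_tail = fst\<rparr>"
  have GV: "parcs G \<subseteq> pverts G \<times> pverts G" using G by (simp add: pair_graph_iff)
  have inj: "inj_on f (pverts G)" and img: "f ` pverts G = pverts H"
    using f by (auto simp: bij_betw_def)
  have "inj_on (map_prod f f) (parcs G)"
    using inj GV by (auto intro!: inj_on_subset[OF map_prod_inj_on[OF inj inj]])
  then have "pre_digraph.digraph_isomorphism (with_proj G) ?h"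
    using pair_graph_wf[OF G] inj by (auto simp: pre_digraph.digraph_isomorphism_def)
  moreover have "map_prod f f ` parcs G = parcs H"
  proof (intro equalityI subsetI)
    fix e assume "e \<in> map_prod f f ` parcs G"
    then obtain u v where uv: "(u, v) \<in> parcs G" "e = (f u, f v)" by auto
    then show "e \<in> parcs H" using GV iff by auto
  next
    fix e assume e: "e \<in> parcs H"
    then obtain p q where pq: "e = (p, q)" "p \<in> pverts H" "q \<in> pverts H"
      using H by (cases e) auto
    then have "p \<in> f ` pverts G" "q \<in> f ` pverts G" by (simp_all add: img)
    then obtain u v where uv: "u \<in> pverts G" "v \<in> pverts G" "e = (f u, f v)"
      using pq(1) by blast
    then show "e \<in> map_prod f f ` parcs G" using e iff by force
  qed
  then have "with_proj H = app_iso ?h (with_proj G)"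
    using img by (simp add: app_iso_def with_proj_def)
  ultimately show ?thesis unfolding digraph_iso_def by blast
qed

lemma digraph_iso_pairE:
  assumes "digraph_iso (with_proj G) (with_proj H)" and G: "pair_graph G"
  obtains f where "bij_betw f (pverts G) (pverts H)" "parcs H = map_prod f f ` parcs G"
proof -
  obtain h where h: "pre_digraph.digraph_isomorphism (with_proj G) h" "with_proj H = app_iso h (with_proj G)"
    using assms by (auto simp: digraph_iso_def)
  have tail: "iso_tail h = fst" and head: "iso_head h = snd"
    and V: "pverts H = iso_verts h ` pverts G" and A: "parcs H = iso_arcs h ` parcs G"
    using h(2) by (auto simp: app_iso_def with_proj_def)
  have "iso_arcs h (u, v) = (iso_verts h u, iso_verts h v)" if "(u, v) \<in> parcs G" for u v
    using h(1) that unfolding pre_digraph.digraph_isomorphism_def tail head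
    by (metis fst_conv snd_conv prod.collapse with_proj_simps(2,4,5))
  then have "parcs H = map_prod (iso_verts h) (iso_verts h) ` parcs G"
    unfolding A by (intro image_cong) auto
  moreover have "bij_betw (iso_verts h) (pverts G) (pverts H)"
    using h(1) V by (simp add: bij_betw_def pre_digraph.digraph_isomorphism_def)
  ultimately show ?thesis using that by blast
qed

lemma contains_cycle_graph:
  assumes G: "pair_graph G" and cyc: "has_cycle (parcs G) n" and n: "3 \<le> n"
  shows "contains_copy G (cycle_graph n)"
proof -
  obtain xs where xs: "distinct xs" "length xs = n" "successively (\<lambda>x y. (x, y) \<in> parcs G) xs"
    "(last xs, hd xs) \<in> parcs G" using cyc by (auto simp: has_cycle_def)
  have symG: "sym (parcs G)" and GV: "parcs G \<subseteq> pverts G \<times> pverts G"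
    using G by (auto simp: pair_graph_iff)
  define f where "f i = xs ! i" for i
  \<comment> \<open>Only the arcs of the cycle are taken, since a copy need not be induced.\<close>
  define S where "S = \<lparr>pverts = set xs, parcs = map_prod f f ` parcs (cycle_graph n)\<rparr>"
  have step: "(f i, f (Suc i mod n)) \<in> parcs G" if "i < n" for i
  proof (cases "Suc i = n")
    case True
    have "xs \<noteq> []" using xs(2) n by auto
    with True have "f i = last xs" "f (Suc i mod n) = hd xs"
      using xs(2) True[symmetric] by (auto simp: f_def last_conv_nth hd_conv_nth)
    then show ?thesis using xs by simp
  next
    case False
    then show ?thesis using xs that by (simp add: f_def successively_conv_nth)
  qed
  then have sub: "parcs S \<subseteq> parcs G"
    using symG by (auto simp: S_def cycle_graph_def dest: symD)
  have memG: "set xs \<subseteq> pverts G"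
  proof
    fix x assume "x \<in> set xs"
    then obtain i where "i < n" "x = f i" using xs by (metis f_def in_set_conv_nth)
    then show "x \<in> pverts G" using step GV by auto
  qed
  have bij: "bij_betw f {..<n} (set xs)"
    unfolding f_def[abs_def] using bij_betw_nth[OF xs(1)] xs(2) by auto
  have pgC: "pair_graph (cycle_graph n)" using pair_graph_cycle_graph[OF n] .
  have CV: "parcs (cycle_graph n) \<subseteq> {..<n} \<times> {..<n}"
    using pgC by (simp add: pair_graph_iff cycle_graph_def)
  have SV: "parcs S \<subseteq> set xs \<times> set xs"
    using CV bij by (auto simp: S_def bij_betw_def)
  have "digraph_iso (with_proj (cycle_graph n)) (with_proj S)"
  proof (rule digraph_iso_pairI[OF pgC])
    show "bij_betw f (pverts (cycle_graph n)) (pverts S)"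
      using bij by (simp add: S_def cycle_graph_def)
    show "parcs S \<subseteq> pverts S \<times> pverts S" using SV by (simp add: S_def)
    fix u v assume uv: "u \<in> pverts (cycle_graph n)" "v \<in> pverts (cycle_graph n)"
    have inj: "inj_on f {..<n}" using bij by (simp add: bij_betw_def)
    show "(u, v) \<in> parcs (cycle_graph n) \<longleftrightarrow> (f u, f v) \<in> parcs S"
    proof
      assume "(f u, f v) \<in> parcs S"
      then obtain u' v' where "(u', v') \<in> parcs (cycle_graph n)" "f u = f u'" "f v = f v'"
        by (auto simp: S_def)
      moreover then have "u = u'" "v = v'"
        using inj uv CV by (auto simp: inj_on_def cycle_graph_def)
      ultimately show "(u, v) \<in> parcs (cycle_graph n)" by simp
    qed (auto simp: S_def)
  qed
  then have "digraph_iso (with_proj S) (with_proj (cycle_graph n))"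
    using digraph_iso_swap pair_graph_wf[OF pgC] by blast
  moreover have "subgraph (with_proj S) (with_proj G)"
    using sub memG SV pair_graph_wf[OF G]
    by (auto simp: subgraph_def compatible_def wf_digraph_def S_def)
  ultimately show ?thesis unfolding contains_copy_def by blast
qed

section \<open>Variational description of the second eigenvalue\<close>

text \<open>The min-max principle: the plane spanned by \<open>x\<close> and \<open>y\<close>
  contains a nonzero vector orthogonal to the top eigenvector, and its Rayleigh quotient is at most
  the second eigenvalue.\<close>

lemma second_eigenvalue_ge:
  assumes G: "pair_graph G" and c2: "2 \<le> card (pverts G)"
    and indep: "\<And>a b :: real. (\<Sum>v\<in>pverts G. (a * x v + b * y v)\<^sup>2) = 0 \<Longrightarrow> a = 0 \<and> b = 0"
    and ge: "\<And>a b. c * (\<Sum>v\<in>pverts G. (a * x v + b * y v)\<^sup>2) \<le> qform (parcs G) (\<lambda>v. a * x v + b * y v)"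
  shows "c \<le> graph_eigenvalue 2 G"
proof -
  let ?V = "pverts G"
  obtain u where u:
    "\<And>i. i < card (pverts G) \<Longrightarrow> (\<Sum>v\<in>pverts G. (u i v)\<^sup>2) = 1"
    "\<And>i v. i < card (pverts G) \<Longrightarrow> v \<in> pverts G \<Longrightarrow>
       (\<Sum>w\<in>parcs G `` {v}. u i w) = graph_eigenvalue (Suc i) G * u i v"
    "\<And>i j. i < card (pverts G) \<Longrightarrow> j < card (pverts G) \<Longrightarrow> i \<noteq> j \<Longrightarrow> (\<Sum>v\<in>pverts G. u i v * u j v) = 0"
    "\<And>i y. i < card (pverts G) \<Longrightarrow> (\<forall>j<i. (\<Sum>v\<in>pverts G. u j v * y v) = 0) \<Longrightarrow>
       qform (parcs G) y \<le> graph_eigenvalue (Suc i) G * (\<Sum>v\<in>pverts G. (y v)\<^sup>2)"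
    by (rule graph_eigenbasis[OF G]) (rule that; assumption)
  define \<alpha> where "\<alpha> = (\<Sum>v\<in>?V. u 0 v * x v)"
  define \<beta> where "\<beta> = (\<Sum>v\<in>?V. u 0 v * y v)"
  \<comment> \<open>A nontrivial solution of one homogeneous equation in two unknowns, namely
    \<open>\<beta>\<close> and \<open>- \<alpha>\<close> unless both vanish.\<close>
  obtain a b where ab: "a * \<alpha> + b * \<beta> = 0" "a \<noteq> 0 \<or> b \<noteq> 0"
  proof (cases "\<alpha> = 0 \<and> \<beta> = 0")
    case True
    then show ?thesis using that[of 1 0] by simp
  next
    case False
    then show ?thesis using that[of \<beta> "- \<alpha>"] by (auto simp: algebra_simps)
  qed
  define z where "z v = a * x v + b * y v" for v
  have "(\<Sum>v\<in>?V. u 0 v * z v) = a * \<alpha> + b * \<beta>"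
    by (simp add: z_def \<alpha>_def \<beta>_def sum_distrib_left sum.distrib algebra_simps)
  then have "qform (parcs G) z \<le> graph_eigenvalue 2 G * (\<Sum>v\<in>?V. (z v)\<^sup>2)"
    using u(4)[of 1 z] c2 ab(1) by (simp add: numeral_2_eq_2)
  moreover have "c * (\<Sum>v\<in>?V. (z v)\<^sup>2) \<le> qform (parcs G) z"
    using ge[of a b] by (simp add: z_def[abs_def])
  moreover have "(\<Sum>v\<in>?V. (z v)\<^sup>2) > 0"
    using indep[of a b] ab(2) sum_nonneg[of ?V "\<lambda>v. (z v)\<^sup>2"] by (force simp: z_def)
  ultimately show ?thesis
    by (meson mult_right_le_imp_le order_trans)
qed

lemma second_eigenvector:
  assumes G: "pair_graph G" and c2: "2 \<le> card (pverts G)"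
  obtains x y where "(\<Sum>v\<in>pverts G. (x v)\<^sup>2) = 1" "(\<Sum>v\<in>pverts G. (y v)\<^sup>2) = 1"
    "(\<Sum>v\<in>pverts G. x v * y v) = 0"
    "\<And>v. v \<in> pverts G \<Longrightarrow> (\<Sum>w\<in>parcs G `` {v}. x w) = graph_eigenvalue 1 G * x v"
    "\<And>v. v \<in> pverts G \<Longrightarrow> (\<Sum>w\<in>parcs G `` {v}. y w) = graph_eigenvalue 2 G * y v"
    "\<And>z. qform (parcs G) z \<le> graph_eigenvalue 1 G * (\<Sum>v\<in>pverts G. (z v)\<^sup>2)"
proof -
  obtain u where u:
    "\<And>i. i < card (pverts G) \<Longrightarrow> (\<Sum>v\<in>pverts G. (u i v)\<^sup>2) = 1"
    "\<And>i v. i < card (pverts G) \<Longrightarrow> v \<in> pverts G \<Longrightarrow>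
       (\<Sum>w\<in>parcs G `` {v}. u i w) = graph_eigenvalue (Suc i) G * u i v"
    "\<And>i j. i < card (pverts G) \<Longrightarrow> j < card (pverts G) \<Longrightarrow> i \<noteq> j \<Longrightarrow> (\<Sum>v\<in>pverts G. u i v * u j v) = 0"
    "\<And>i y. i < card (pverts G) \<Longrightarrow> (\<forall>j<i. (\<Sum>v\<in>pverts G. u j v * y v) = 0) \<Longrightarrow>
       qform (parcs G) y \<le> graph_eigenvalue (Suc i) G * (\<Sum>v\<in>pverts G. (y v)\<^sup>2)"
    by (rule graph_eigenbasis[OF G]) (rule that; assumption)
  have c: "0 < card (pverts G)" "1 < card (pverts G)" using c2 by auto
  show ?thesis
    by (rule that[of "u 0" "u 1"])
      (use u(1)[OF c(1)] u(1)[OF c(2)] u(2)[OF c(1)] u(2)[OF c(2)] u(3)[OF c(1) c(2)] u(4)[OF c(1)] in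
        \<open>auto simp: numeral_2_eq_2\<close>)
qed

lemma qform_eigenvector:
  assumes "finite V" "E \<subseteq> V \<times> V" and eig: "\<And>v. v \<in> V \<Longrightarrow> (\<Sum>w\<in>E `` {v}. x w) = r * x v"
  shows "qform E x = r * (\<Sum>v\<in>V. (x v)\<^sup>2)"
  by (simp add: qform_rows[OF assms(1,2)] eig power2_eq_square sum_distrib_left algebra_simps)

lemma qform_image:
  assumes "inj_on f V" "E \<subseteq> V \<times> V"
  shows "qform (map_prod f f ` E) z = qform E (\<lambda>v. z (f v))"
proof -
  have "inj_on (map_prod f f) E"
    using assms by (auto intro!: inj_on_subset[OF map_prod_inj_on[OF assms(1,1)]])
  then show ?thesis by (simp add: qform_def sum.reindex case_prod_beta)
qed

text \<open>Invariance without permuting matrices: two eigenvectors of \<open>H\<close>, pulled back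
  along \<open>f\<close>, span a test plane in \<open>G\<close>.\<close>

lemma second_eigenvalue_iso_le:
  assumes G: "pair_graph G" and H: "pair_graph H" and c2: "2 \<le> card (pverts G)"
    and f: "bij_betw f (pverts G) (pverts H)" and arcs: "parcs H = map_prod f f ` parcs G"
  shows "graph_eigenvalue 2 H \<le> graph_eigenvalue 2 G"
proof -
  have GV: "parcs G \<subseteq> pverts G \<times> pverts G" using G by (simp add: pair_graph_iff)
  have HV: "finite (pverts H)" "parcs H \<subseteq> pverts H \<times> pverts H" using H by (auto simp: pair_graph_iff)
  have inj: "inj_on f (pverts G)" using f by (simp add: bij_betw_def)
  have cH: "2 \<le> card (pverts H)" using c2 bij_betw_same_card[OF f] by simp
  obtain x y where xy: "(\<Sum>v\<in>pverts H. (x v)\<^sup>2) = 1" "(\<Sum>v\<in>pverts H. (y v)\<^sup>2) = 1"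
    "(\<Sum>v\<in>pverts H. x v * y v) = 0"
    "\<And>v. v \<in> pverts H \<Longrightarrow> (\<Sum>w\<in>parcs H `` {v}. x w) = graph_eigenvalue 1 H * x v"
    "\<And>v. v \<in> pverts H \<Longrightarrow> (\<Sum>w\<in>parcs H `` {v}. y w) = graph_eigenvalue 2 H * y v"
    "\<And>z. qform (parcs H) z \<le> graph_eigenvalue 1 H * (\<Sum>v\<in>pverts H. (z v)\<^sup>2)"
    by (rule second_eigenvector[OF H cH]) (rule that; assumption)
  let ?l1 = "graph_eigenvalue 1 H" and ?l2 = "graph_eigenvalue 2 H"
  have le: "?l2 \<le> ?l1" using xy(6)[of y] qform_eigenvector[OF HV xy(5)] xy(2) by simp
  have norm: "(\<Sum>v\<in>pverts G. (a * x (f v) + b * y (f v))\<^sup>2) = a\<^sup>2 + b\<^sup>2" for a b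
  proof -
    have "(\<Sum>v\<in>pverts G. (a * x (f v) + b * y (f v))\<^sup>2) = (\<Sum>v\<in>pverts H. (a * x v + b * y v)\<^sup>2)"
      using sum.reindex_bij_betw[OF f, of "\<lambda>v. (a * x v + b * y v)\<^sup>2"] by simp
    also have "\<dots> = a\<^sup>2 * (\<Sum>v\<in>pverts H. (x v)\<^sup>2) + 2 * a * b * (\<Sum>v\<in>pverts H. x v * y v) + b\<^sup>2 * (\<Sum>v\<in>pverts H. (y v)\<^sup>2)"
      unfolding sum_distrib_left sum.distrib[symmetric]
      by (intro sum.cong) (auto simp: power2_eq_square algebra_simps)
    finally show ?thesis using xy by simp
  qed
  have qf: "qform (parcs G) (\<lambda>v. a * x (f v) + b * y (f v)) = a\<^sup>2 * ?l1 + b\<^sup>2 * ?l2" for a b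
  proof -
    have "qform (parcs G) (\<lambda>v. a * x (f v) + b * y (f v)) = qform (parcs H) (\<lambda>v. a * x v + b * y v)"
      unfolding arcs using qform_image[OF inj GV, of "\<lambda>v. a * x v + b * y v"] by simp
    also have "\<dots> = (\<Sum>v\<in>pverts H. (a * x v + b * y v) * (a * (\<Sum>w\<in>parcs H `` {v}. x w) + b * (\<Sum>w\<in>parcs H `` {v}. y w)))"
      unfolding qform_rows[OF HV] by (simp add: sum.distrib sum_distrib_left)
    also have "\<dots> = (\<Sum>v\<in>pverts H. (a * x v + b * y v) * (a * (?l1 * x v) + b * (?l2 * y v)))"
      using xy(4,5) by (intro sum.cong) auto
    also have "\<dots> = a\<^sup>2 * ?l1 * (\<Sum>v\<in>pverts H. (x v)\<^sup>2) + a * b * (?l1 + ?l2) * (\<Sum>v\<in>pverts H. x v * y v) + b\<^sup>2 * ?l2 * (\<Sum>v\<in>pverts H. (y v)\<^sup>2)"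
      unfolding sum_distrib_left sum.distrib[symmetric]
      by (intro sum.cong) (auto simp: power2_eq_square algebra_simps)
    finally show ?thesis using xy by simp
  qed
  show ?thesis
  proof (rule second_eigenvalue_ge[OF G c2])
    fix a b :: real
    show "a = 0 \<and> b = 0" if "(\<Sum>v\<in>pverts G. (a * x (f v) + b * y (f v))\<^sup>2) = 0"
      using that by (simp add: norm)
    have "a\<^sup>2 * ?l2 \<le> a\<^sup>2 * ?l1" using le by (intro mult_left_mono) auto
    then show "?l2 * (\<Sum>v\<in>pverts G. (a * x (f v) + b * y (f v))\<^sup>2) \<le>
        qform (parcs G) (\<lambda>v. a * x (f v) + b * y (f v))"
      by (simp add: norm qf algebra_simps)
  qed
qed

lemma second_eigenvalue_iso:
  assumes G: "pair_graph G" and H: "pair_graph H" and c2: "2 \<le> card (pverts G)"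
    and iso: "digraph_iso (with_proj G) (with_proj H)"
  shows "graph_eigenvalue 2 G = graph_eigenvalue 2 H"
proof -
  obtain f where f: "bij_betw f (pverts G) (pverts H)" "parcs H = map_prod f f ` parcs G"
    using digraph_iso_pairE[OF iso G] .
  have iso': "digraph_iso (with_proj H) (with_proj G)"
    using digraph_iso_swap pair_graph_wf[OF G] iso by blast
  obtain g where g: "bij_betw g (pverts H) (pverts G)" "parcs G = map_prod g g ` parcs H"
    using digraph_iso_pairE[OF iso' H] .
  show ?thesis
    using second_eigenvalue_iso_le[OF G H c2 f] second_eigenvalue_iso_le[OF H G _ g]
      bij_betw_same_card[OF f(1)] c2 by simp
qed

text \<open>The form in which connectedness enters the arguments of Perron-Frobenius type and the
  analysis of equality.\<close>

lemma connected_closed_set: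
  assumes G: "pair_graph G" and c: "Digraph_Component.connected (with_proj G)"
    and S: "S \<subseteq> pverts G" "S \<noteq> {}" and closed: "\<And>u v. (u, v) \<in> parcs G \<Longrightarrow> u \<in> S \<Longrightarrow> v \<in> S"
  shows "S = pverts G"
proof -
  have symG: "sym (parcs G)" using G by (simp add: pair_graph_iff)
  obtain u where u: "u \<in> S" using S by auto
  have "v \<in> S" if "v \<in> pverts G" for v
  proof -
    have "(u, v) \<in> rtrancl_on (pverts G) ((parcs G)\<^sup>s)"
      using c u S that unfolding connected_conv by auto
    then show ?thesis
      by (induction rule: rtrancl_on_induct)
        (use u closed symG in \<open>auto simp: symcl_def dest: symD\<close>)
  qed
  then show ?thesis using S by auto
qed

section \<open>Quadratic forms of bipartite graphs\<close>

text \<open>Unlike in \<open>complete_bipartite\<close>, both sides live in one type, so induced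
  subgraphs of an arbitrary graph can be compared with it.\<close>

definition cbip :: "'a set \<Rightarrow> 'a set \<Rightarrow> ('a \<times> 'a) set" where
  "cbip A B = A \<times> B \<union> B \<times> A"

lemma cbip_commute: "cbip A B = cbip B A"
  by (auto simp: cbip_def)

lemma sgraph_cbip: "finite A \<Longrightarrow> finite B \<Longrightarrow> A \<inter> B = {} \<Longrightarrow> sgraph (A \<union> B) (cbip A B)"
  by (auto simp: sgraph_def cbip_def sym_def irrefl_def)

lemma qform_cbip:
  assumes "finite A" "finite B" "A \<inter> B = {}"
  shows "qform (cbip A B) y = 2 * ((\<Sum>v\<in>A. y v) * (\<Sum>v\<in>B. y v))"
proof -
  have "qform (cbip A B) y = (\<Sum>(u, v)\<in>A \<times> B. y u * y v) + (\<Sum>(u, v)\<in>B \<times> A. y u * y v)"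
    unfolding qform_def cbip_def using assms by (intro sum.union_disjoint) auto
  then show ?thesis
    by (simp add: sum.cartesian_product[symmetric] sum_product[symmetric] mult.commute)
qed

lemma qform_mono_positive:
  assumes "finite F" "E \<subseteq> F" and pos: "\<And>u v. (u, v) \<in> F \<Longrightarrow> 0 < y u \<and> 0 < y v"
  shows "qform E y \<le> qform F y" "E \<noteq> F \<Longrightarrow> qform E y < qform F y"
proof -
  show "qform E y \<le> qform F y"
    unfolding qform_def using assms by (intro sum_mono2) (auto intro!: mult_nonneg_nonneg less_imp_le)
  assume "E \<noteq> F"
  then obtain p q where e: "(p, q) \<in> F - E" using assms by auto
  show "qform E y < qform F y"
    unfolding qform_def
    by (rule sum_strict_mono2[OF assms(1,2) e]) (use e pos in \<open>auto intro!: mult_pos_pos mult_nonneg_nonneg less_imp_le\<close>)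
qed

text \<open>Moving the factors apart lowers the product. The condition \<open>0 < s\<close> in the
  equality case excludes the product 0, which does not determine its factors.\<close>

lemma balanced_product_aux:
  fixes a b s t :: nat
  assumes "a + b \<le> s + t" "s \<le> t" "t \<le> s + 1" "a \<le> b"
  shows "a * b \<le> s * t" and "a * b = s * t \<Longrightarrow> 0 < s \<Longrightarrow> a = s \<and> b = t"
proof -
  have "a * b \<le> s * t \<and> (a * b = s * t \<longrightarrow> 0 < s \<longrightarrow> a = s \<and> b = t)"
  proof (cases "a < s")
    \<comment> \<open>If \<open>a = s - d\<close>, then \<open>b\<close> gains at most
      \<open>d\<close>, and \<open>a * d\<close> is less than \<open>d * t\<close>.\<close>
    case True
    then obtain d where d: "s = a + d" "0 < d" by (metis less_imp_add_positive)
    have "a * b \<le> a * (t + d)" using assms d by (intro mult_left_mono) auto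
    also have "\<dots> < s * t" using True assms d by (auto simp: algebra_simps intro: mult_strict_right_mono)
    finally show ?thesis by auto
  next
    case False
    then have "a = s" "b \<le> t" using assms by auto
    then show ?thesis by auto
  qed
  then show "a * b \<le> s * t" "a * b = s * t \<Longrightarrow> 0 < s \<Longrightarrow> a = s \<and> b = t" by auto
qed

lemma balanced_product:
  fixes a b s t :: nat
  assumes "a + b \<le> s + t" "s \<le> t" "t \<le> s + 1"
  shows "a * b \<le> s * t"
    and "a * b = s * t \<Longrightarrow> 0 < s \<Longrightarrow> a = s \<and> b = t \<or> a = t \<and> b = s"
  using balanced_product_aux[OF assms] balanced_product_aux[of b a, OF _ assms(2,3)] assms(1)
  by (cases "a \<le> b"; force simp: algebra_simps)+

text \<open>Positivity of \<open>y\<close> makes each missing arc a strict loss, so equality forces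
  \<open>E\<close> to be complete bipartite with the optimal part sizes.\<close>

lemma bipartite_qform_bound:
  fixes s t :: nat
  assumes fin: "finite A" "finite B" and disj: "A \<inter> B = {}" and E: "E \<subseteq> cbip A B"
    and card: "card A + card B \<le> s + t" and st: "s \<le> t" "t \<le> s + 1" "0 < s"
    and pos: "\<And>v. v \<in> A \<union> B \<Longrightarrow> 0 < y v" and ne: "A \<union> B \<noteq> {}"
  shows "qform E y \<le> sqrt (s * t) * (\<Sum>v\<in>A \<union> B. (y v)\<^sup>2)"
    and "qform E y = sqrt (s * t) * (\<Sum>v\<in>A \<union> B. (y v)\<^sup>2) \<Longrightarrow>
      E = cbip A B \<and> (card A = s \<and> card B = t \<or> card A = t \<and> card B = s)"
proof -
  interpret K: sgraph "A \<union> B" "cbip A B" using sgraph_cbip fin disj by blast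
  let ?S = "\<Sum>v\<in>A \<union> B. (y v)\<^sup>2"
  have S: "?S > 0" using ne pos fin by (intro sum_pos zero_less_power pos) auto
  have "qform (cbip A B) y \<le> sqrt (card A * card B) * ?S"
  proof (rule K.qform_bipartite_le_sqrt)
    show "u \<in> A \<longleftrightarrow> v \<notin> A" if "(u, v) \<in> cbip A B" for u v
      using that disj by (auto simp: cbip_def)
    have "(A \<union> B) \<inter> A = A" "A \<union> B - A = B" using disj by auto
    then show "real (card ((A \<union> B) \<inter> A)) * card (A \<union> B - A) \<le> (sqrt (card A * card B))\<^sup>2" by simp
  qed auto
  moreover have finF: "finite (cbip A B)" using fin by (simp add: cbip_def)
  have posF: "0 < y u \<and> 0 < y v" if "(u, v) \<in> cbip A B" for u v
    using that pos by (auto simp: cbip_def)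
  note mono = qform_mono_positive[of "cbip A B" E y, OF finF E posF]
  note bp = balanced_product[OF card st(1,2)]
  have le: "sqrt (card A * card B) * ?S \<le> sqrt (s * t) * ?S"
    using S bp(1) by (intro mult_right_mono real_sqrt_le_mono) (auto simp flip: of_nat_mult)
  ultimately show "qform E y \<le> sqrt (s * t) * ?S" using mono(1) by linarith
  assume eq: "qform E y = sqrt (s * t) * ?S"
  have "E = cbip A B"
  proof (rule ccontr)
    assume "E \<noteq> cbip A B"
    then show False using mono(2) eq le \<open>qform (cbip A B) y \<le> _\<close> by linarith
  qed
  moreover have "sqrt (card A * card B) * ?S = sqrt (s * t) * ?S"
    using mono(1) eq le \<open>qform (cbip A B) y \<le> _\<close> by linarith
  then have "sqrt (real (card A * card B)) = sqrt (real (s * t))" using S by simp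
  then have "card A * card B = s * t" by (simp only: real_sqrt_eq_iff of_nat_eq_iff)
  ultimately show "E = cbip A B \<and> (card A = s \<and> card B = t \<or> card A = t \<and> card B = s)"
    using bp(2) st(3) by simp
qed

text \<open>
  The number \<open>\<theta>\<close> is the largest eigenvalue of the complete bipartite graph with part sizes
  \<open>s \<le> t\<close> carrying a loop of weight \<open>-1\<close> at a vertex of the part of size \<open>t\<close>.
\<close>

lemma loop_weight_bound:
  fixes a b s t :: nat and \<theta> :: real
  assumes sum: "a + b = s + t" and st: "s \<le> t" "t \<le> s + 1" "0 < s" and a: "1 \<le> a"
    and th: "0 < \<theta>" "(\<theta> + 1) * (s * t - \<theta>\<^sup>2) = s" "s < \<theta> + 1"
  shows "b * ((real a - 1) / \<theta> + 1 / (\<theta> + 1)) \<le> \<theta>"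
    and "b * ((real a - 1) / \<theta> + 1 / (\<theta> + 1)) = \<theta> \<Longrightarrow> a = t \<and> b = s"
proof -
  \<comment> \<open>Clears the denominators of the eigenvalue equation of the looped graph with part
    sizes \<open>a\<close> and \<open>b\<close>: if the entries on the other side sum to
    \<open>\<sigma>\<close>, the unlooped vertices of the first side carry
    \<open>\<sigma> / \<theta>\<close> and the looped one
    \<open>\<sigma> / (\<theta> + 1)\<close>.\<close>
  have eq: "(\<theta> - b * ((real a - 1) / \<theta> + 1 / (\<theta> + 1))) * (\<theta> * (\<theta> + 1)) =
      b - (\<theta> + 1) * (real (a * b) - \<theta>\<^sup>2)"
  proof -
    have "(\<theta> + 1) / (\<theta> + 1) = 1" using th(1) by simp
    then have "((real a - 1) / \<theta> + 1 / (\<theta> + 1)) * (\<theta> * (\<theta> + 1)) = (real a - 1) * (\<theta> + 1) + \<theta>"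
      using th(1) by (simp add: distrib_right)
    then have "(b * ((real a - 1) / \<theta> + 1 / (\<theta> + 1))) * (\<theta> * (\<theta> + 1)) = b * ((real a - 1) * (\<theta> + 1) + \<theta>)"
      by (simp only: mult.assoc)
    then show ?thesis unfolding left_diff_distrib by (simp add: algebra_simps power2_eq_square)
  qed
  have expand: "(\<theta> + 1) * (real (a * b) - \<theta>\<^sup>2) = (\<theta> + 1) * (real (a * b) - s * t) + s"
    using th(2) by (simp add: algebra_simps)
  note bp = balanced_product[OF eq_refl[OF sum] st(1,2)]
  \<comment> \<open>For the optimal product the expression is \<open>b - s\<close>. Otherwise the
    product drops by at least 1, which gains \<open>\<theta> + 1\<close>, more than the
    \<open>s\<close> that has to be compensated.\<close>
  have *: "0 \<le> b - (\<theta> + 1) * (real (a * b) - \<theta>\<^sup>2) \<and>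
      (b - (\<theta> + 1) * (real (a * b) - \<theta>\<^sup>2) = 0 \<longrightarrow> a = t \<and> b = s)"
  proof (cases "a * b = s * t")
    case True
    then have "a = s \<and> b = t \<or> a = t \<and> b = s" using bp(2) st by simp
    then show ?thesis using True st unfolding expand by (auto simp flip: of_nat_mult)
  next
    case False
    then have "a * b + 1 \<le> s * t" using bp(1) by simp
    then have "real (a * b + 1) \<le> real (s * t)" by (simp only: of_nat_le_iff)
    then have "real (a * b) - real s * real t \<le> -1" by simp
    then have "(\<theta> + 1) * (real (a * b) - s * t) \<le> (\<theta> + 1) * (-1)"
      using th(1) by (intro mult_left_mono) auto
    then show ?thesis using th(3) unfolding expand by auto
  qed
  have pos: "\<theta> * (\<theta> + 1) > 0" using th(1) by simp
  show "b * ((real a - 1) / \<theta> + 1 / (\<theta> + 1)) \<le> \<theta>"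
  proof -
    have "0 \<le> (\<theta> - b * ((real a - 1) / \<theta> + 1 / (\<theta> + 1))) * (\<theta> * (\<theta> + 1))" using * eq by simp
    then have "0 \<le> \<theta> - b * ((real a - 1) / \<theta> + 1 / (\<theta> + 1))"
      using pos by (simp only: zero_le_mult_iff) auto
    then show ?thesis by simp
  qed
  assume "b * ((real a - 1) / \<theta> + 1 / (\<theta> + 1)) = \<theta>"
  then show "a = t \<and> b = s" using * eq by simp
qed

text \<open>Each product \<open>2 * (y v * \<sigma>)\<close> is split by a weighted inequality of
  means, with weight \<open>\<theta> + 1\<close> at \<open>u\<close> and \<open>\<theta>\<close>
  elsewhere; the extra 1 is absorbed by the loop. These weights are sharp at the eigenvector of the
  extremal looped graph.\<close>

lemma looped_bipartite_qform_bound: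
  fixes s t :: nat and \<theta> :: real
  assumes fin: "finite A" "finite B" and disj: "A \<inter> B = {}" and E: "E \<subseteq> cbip A B"
    and card: "card A + card B = s + t" and st: "s \<le> t" "t \<le> s + 1" "0 < s"
    and th: "0 < \<theta>" "(\<theta> + 1) * (s * t - \<theta>\<^sup>2) = s" "s < \<theta> + 1"
    and pos: "\<And>v. v \<in> A \<union> B \<Longrightarrow> 0 < y v" and u: "u \<in> A"
  shows "qform E y - (y u)\<^sup>2 \<le> \<theta> * (\<Sum>v\<in>A \<union> B. (y v)\<^sup>2)"
    and "qform E y - (y u)\<^sup>2 = \<theta> * (\<Sum>v\<in>A \<union> B. (y v)\<^sup>2) \<Longrightarrow>
      E = cbip A B \<and> card A = t \<and> card B = s"
proof -
  have finF: "finite (cbip A B)" using fin by (simp add: cbip_def)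
  have posF: "0 < y u \<and> 0 < y v" if "(u, v) \<in> cbip A B" for u v
    using that pos by (auto simp: cbip_def)
  note mono = qform_mono_positive[of "cbip A B" E y, OF finF E posF]
  define SA where "SA = (\<Sum>v\<in>A. (y v)\<^sup>2)"
  define SB where "SB = (\<Sum>v\<in>B. (y v)\<^sup>2)"
  define \<sigma> where "\<sigma> = (\<Sum>v\<in>B. y v)"
  have SAB: "(\<Sum>v\<in>A \<union> B. (y v)\<^sup>2) = SA + SB"
    using fin disj by (simp add: SA_def SB_def sum.union_disjoint)
  have amgm: "2 * (p * \<sigma>) \<le> c * p\<^sup>2 + \<sigma>\<^sup>2 / c" if "0 < c" for p c :: real
  proof -
    have "0 \<le> (c * p - \<sigma>)\<^sup>2 / c" using that by simp
    also have "\<dots> = c * p\<^sup>2 + \<sigma>\<^sup>2 / c - 2 * (p * \<sigma>)"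
      using that by (simp add: field_simps power2_eq_square)
    finally show ?thesis by simp
  qed
  have c1: "1 \<le> card A" using u fin by (metis One_nat_def Suc_leI card_gt_0_iff empty_iff)
  have "qform (cbip A B) y = (\<Sum>v\<in>A. 2 * (y v * \<sigma>))"
    unfolding qform_cbip[OF fin disj] \<sigma>_def[symmetric]
    by (simp only: sum_distrib_left[symmetric] sum_distrib_right[symmetric])
  also have "\<dots> = 2 * (y u * \<sigma>) + (\<Sum>v\<in>A - {u}. 2 * (y v * \<sigma>))"
    using fin u by (simp add: sum.remove)
  also have "\<dots> \<le> ((\<theta> + 1) * (y u)\<^sup>2 + \<sigma>\<^sup>2 / (\<theta> + 1)) + (\<Sum>v\<in>A - {u}. \<theta> * (y v)\<^sup>2 + \<sigma>\<^sup>2 / \<theta>)"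
    using th(1) by (intro add_mono sum_mono amgm) auto
  also have "(\<Sum>v\<in>A - {u}. \<theta> * (y v)\<^sup>2 + \<sigma>\<^sup>2 / \<theta>) = \<theta> * (SA - (y u)\<^sup>2) + (real (card A) - 1) * (\<sigma>\<^sup>2 / \<theta>)"
    using fin u c1 by (simp add: sum.distrib SA_def sum_diff1 of_nat_diff flip: sum_distrib_left)
  finally have 1: "qform (cbip A B) y - (y u)\<^sup>2 \<le> \<theta> * SA + \<sigma>\<^sup>2 * ((real (card A) - 1) / \<theta> + 1 / (\<theta> + 1))"
    by (simp add: algebra_simps)
  let ?k = "(real (card A) - 1) / \<theta> + 1 / (\<theta> + 1)"
  have k: "0 \<le> ?k" using c1 th(1) by simp
  have "\<sigma>\<^sup>2 \<le> SB * card B"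
    using sum_squared_le_sum_of_squares[of y B] by (simp add: \<sigma>_def SB_def)
  then have "\<sigma>\<^sup>2 * ?k \<le> SB * card B * ?k" using k by (intro mult_right_mono)
  then have 2: "\<sigma>\<^sup>2 * ?k \<le> (card B * ?k) * SB" by (simp add: algebra_simps)
  note lw = loop_weight_bound[OF card st c1 th]
  have SB0: "0 \<le> SB" by (simp add: SB_def sum_nonneg)
  have 3: "(card B * ?k) * SB \<le> \<theta> * SB" using lw(1) SB0 by (intro mult_right_mono) auto
  show "qform E y - (y u)\<^sup>2 \<le> \<theta> * (\<Sum>v\<in>A \<union> B. (y v)\<^sup>2)"
    using 1 2 3 mono(1) unfolding SAB by (simp add: algebra_simps)
  assume eq: "qform E y - (y u)\<^sup>2 = \<theta> * (\<Sum>v\<in>A \<union> B. (y v)\<^sup>2)"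
  then have eq': "qform E y - (y u)\<^sup>2 = \<theta> * SA + \<theta> * SB" unfolding SAB by (simp add: algebra_simps)
  have "E = cbip A B" using mono(2) eq' 1 2 3 by fastforce
  moreover have "(card B * ?k) * SB = \<theta> * SB" using mono(1) eq' 1 2 3 by linarith
  \<comment> \<open>Needed to cancel \<open>SB\<close>. If it vanished, \<open>B\<close> would be
    empty and the form 0, but then the left side of the assumed equality would be negative.\<close>
  moreover have "SB \<noteq> 0"
  proof
    assume "SB = 0"
    then have "B = {}" using fin pos by (force simp: SB_def sum_nonneg_eq_0_iff)
    then have "qform E y = 0" using E by (auto simp: cbip_def qform_def)
    moreover have "0 < (y u)\<^sup>2" "0 \<le> \<theta> * SA"
      using pos[of u] u th(1) by (auto simp: SA_def sum_nonneg)
    moreover have "\<theta> * SB = 0" using \<open>SB = 0\<close> by simp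
    ultimately show False using eq' by linarith
  qed
  ultimately show "E = cbip A B \<and> card A = t \<and> card B = s" using lw(2) by simp
qed

text \<open>Intermediate values between \<open>sqrt (s * t - 1)\<close>, where the cubic equals
  \<open>lo + 1\<close>, and \<open>sqrt (s * t)\<close>, where it is 0. The loop thus costs so
  little that the root stays within \<open>1 / 40\<close> of half the order.\<close>

lemma loop_eigenvalue_exists:
  fixes s t :: nat
  assumes st: "s \<le> t" "t \<le> s + 1" "26 \<le> s"
  obtains \<theta> :: real where "0 < \<theta>" "(\<theta> + 1) * (s * t - \<theta>\<^sup>2) = s" "s < \<theta> + 1"
    "real (s + t) / 2 - 1 / 40 < \<theta>"
proof -
  define f where "f \<theta> = (\<theta> + 1) * (real s * t - \<theta>\<^sup>2)" for \<theta> :: real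
  have s1: "real s \<ge> 26" "real s \<le> t" "real t \<le> s + 1" using st by auto
  define lo where "lo = sqrt (real s * t - 1)"
  define hi where "hi = sqrt (real s * t)"
  have "real s * s \<le> real s * t" using s1 by (intro mult_left_mono) auto
  moreover have "26 * 26 \<le> real s * real s" using s1 by (intro mult_mono) auto
  ultimately have st1: "real s * t \<ge> 1" "real s * s \<le> real s * t" by auto
  have lo2: "lo\<^sup>2 = real s * t - 1" using st1 by (simp add: lo_def)
  have hi2: "hi\<^sup>2 = real s * t" by (simp add: hi_def)
  have "real s - 1 \<le> lo"
  proof -
    have "(real s - 1)\<^sup>2 = real s * s - 2 * s + 1" by (simp add: power2_eq_square algebra_simps)
    then have "(real s - 1)\<^sup>2 \<le> lo\<^sup>2" unfolding lo2 using st1 s1 by linarith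
    then show ?thesis by (rule power2_le_imp_le) (simp add: lo_def st1)
  qed
  have "f lo \<ge> s" using \<open>real s - 1 \<le> lo\<close> by (simp add: f_def lo2)
  moreover have "f hi \<le> s" by (simp add: f_def hi2)
  moreover have "lo \<le> hi" by (simp add: lo_def hi_def)
  moreover have "continuous_on {lo..hi} f" unfolding f_def by (intro continuous_intros)
  ultimately obtain \<theta> where th: "lo \<le> \<theta>" "\<theta> \<le> hi" "f \<theta> = s"
    using IVT2'[of f hi s lo] by auto
  \<comment> \<open>This fixes the threshold 26: \<open>(s + t) / 40\<close> is at least 1.3, which
    exceeds \<open>1 + 1 / 4 + 1 / 1600\<close>.\<close>
  have big: "real (s + t) / 2 - 1 / 40 < lo"
  proof -
    have "(real (s + t) / 2 - 1 / 40)\<^sup>2 < lo\<^sup>2"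
    proof -
      have "(real t - s)\<^sup>2 \<le> 1" using s1 by (intro power_le_one) auto
      moreover have "(real (s + t) / 2 - 1 / 40)\<^sup>2 = real s * t + (real t - s)\<^sup>2 / 4 - real (s + t) / 40 + 1 / 1600"
        by (simp add: power2_eq_square field_simps)
      moreover have "1 + 1 / 4 + 1 / 1600 < real (s + t) / 40" using s1 by (simp add: divide_simps)
      ultimately show ?thesis unfolding lo2 by linarith
    qed
    then show ?thesis by (rule power2_less_imp_less) (simp add: lo_def st1)
  qed
  have gt: "real (s + t) / 2 - 1 / 40 < \<theta>" by (rule less_le_trans[OF big th(1)])
  have "real s < real (s + t) / 2 - 1 / 40 + 1" using s1 by (simp add: divide_simps)
  then have lt: "s < \<theta> + 1" by (rule less_trans) (rule add_strict_right_mono[OF gt])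
  have "0 \<le> real (s + t) / 2 - 1 / 40" using s1 by (simp add: divide_simps)
  then have pos: "0 < \<theta>" by (rule le_less_trans[OF _ gt])
  show ?thesis
    by (rule that[OF pos _ lt gt]) (use th(3) in \<open>simp add: f_def\<close>)
qed

section \<open>Sign classes of an eigenvector\<close>

context sgraph
begin

text \<open>The first variation in the single coordinate \<open>v\<close> gives the eigenvalue
  equation at \<open>v\<close>.\<close>

lemma maximizer_is_eigenvector:
  assumes max: "\<And>y. qform E y \<le> r * (\<Sum>v\<in>V. (y v)\<^sup>2)"
    and x: "qform E x = r * (\<Sum>v\<in>V. (x v)\<^sup>2)" and v: "v \<in> V"
  shows "(\<Sum>w\<in>E `` {v}. x w) = r * x v"
proof -
  let ?g = "\<Sum>w\<in>E `` {v}. x w"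
  have "2 * e * (?g - r * x v) + e\<^sup>2 * (- r) \<le> 0" for e
  proof -
    define y where "y = x(v := x v + e)"
    have "v \<notin> E `` {v}" using irr by (auto simp: irrefl_def)
    then have "(\<Sum>w\<in>E `` {v}. y w) = ?g" by (intro sum.cong) (auto simp: y_def)
    moreover have "qform (E \<inter> (V - {v}) \<times> (V - {v})) y = qform (E \<inter> (V - {v}) \<times> (V - {v})) x"
      unfolding qform_def by (intro sum.cong) (auto simp: y_def split: if_splits)
    ultimately have "qform E y = qform E x + 2 * e * ?g"
      using qform_delete[of y v] qform_delete[of x v] by (simp add: y_def algebra_simps)
    moreover have "(\<Sum>v\<in>V. (y v)\<^sup>2) = (\<Sum>v\<in>V. (x v)\<^sup>2) + 2 * e * x v + e\<^sup>2"
    proof -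
      have "(\<Sum>w\<in>V - {v}. (y w)\<^sup>2) = (\<Sum>w\<in>V - {v}. (x w)\<^sup>2)"
        by (intro sum.cong) (auto simp: y_def)
      then show ?thesis
        using finV v by (simp add: sum.remove y_def power2_eq_square algebra_simps)
    qed
    ultimately show ?thesis using max[of y] x by (simp add: algebra_simps)
  qed
  then have "?g - r * x v = 0" by (rule linear_coeff_eq_0)
  then show ?thesis by simp
qed

text \<open>At a zero of a nonnegative eigenvector the neighbouring entries sum to 0 and hence
  vanish, so the zero set is closed under adjacency.\<close>

lemma nonneg_eigenvector_positive:
  fixes x :: "'a \<Rightarrow> real"
  assumes conn: "\<And>S. S \<subseteq> V \<Longrightarrow> S \<noteq> {} \<Longrightarrow> (\<And>u v. (u, v) \<in> E \<Longrightarrow> u \<in> S \<Longrightarrow> v \<in> S) \<Longrightarrow> S = V"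
    and eig: "\<And>v. v \<in> V \<Longrightarrow> (\<Sum>w\<in>E `` {v}. x w) = r * x v"
    and nn: "\<And>v. v \<in> V \<Longrightarrow> 0 \<le> x v" and u: "u \<in> V" "x u \<noteq> 0" and v: "v \<in> V"
  shows "0 < x v"
proof (rule ccontr)
  assume "\<not> ?thesis"
  then have "x v = 0" using nn[OF v] by simp
  define Z where "Z = {v \<in> V. x v = 0}"
  have "Z = V"
  proof (rule conn)
    show "Z \<subseteq> V" "Z \<noteq> {}" using v \<open>x v = 0\<close> by (auto simp: Z_def)
    fix p q assume pq: "(p, q) \<in> E" "p \<in> Z"
    then have "(\<Sum>w\<in>E `` {p}. x w) = 0" using eig[of p] by (simp add: Z_def)
    then have "\<forall>w\<in>E `` {p}. x w = 0"
      using fin_nbrs nbrs_subset nn by (subst (asm) sum_nonneg_eq_0_iff) auto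
    then show "q \<in> Z" using pq EV by (auto simp: Z_def)
  qed
  then show False using u by (auto simp: Z_def)
qed

text \<open>Perron-Frobenius: replacing \<open>x\<close> by its absolute value does not decrease the
  form, so the absolute value is again a maximiser and thus an eigenvector.\<close>

lemma top_eigenvector_one_sign:
  assumes conn: "\<And>S. S \<subseteq> V \<Longrightarrow> S \<noteq> {} \<Longrightarrow> (\<And>u v. (u, v) \<in> E \<Longrightarrow> u \<in> S \<Longrightarrow> v \<in> S) \<Longrightarrow> S = V"
    and eig: "\<And>v. v \<in> V \<Longrightarrow> (\<Sum>w\<in>E `` {v}. x w) = r * x v"
    and max: "\<And>y. qform E y \<le> r * (\<Sum>v\<in>V. (y v)\<^sup>2)"
    and ne: "(\<Sum>v\<in>V. (x v)\<^sup>2) \<noteq> 0"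
  shows "(\<forall>v\<in>V. 0 < x v) \<or> (\<forall>v\<in>V. x v < 0)"
proof (cases "\<exists>u\<in>V. 0 < x u")
  case True
  then obtain u where u: "u \<in> V" "0 < x u" by auto
  define h where "h v = \<bar>x v\<bar>" for v
  have "qform E x \<le> qform E h"
    unfolding qform_def by (intro sum_mono) (auto simp: h_def simp flip: abs_mult)
  moreover have "(\<Sum>v\<in>V. (h v)\<^sup>2) = (\<Sum>v\<in>V. (x v)\<^sup>2)" by (simp add: h_def)
  ultimately have "qform E h = r * (\<Sum>v\<in>V. (h v)\<^sup>2)"
    using max[of h] qform_eigenvector[OF finV EV eig] by simp
  then have eigh: "(\<Sum>w\<in>E `` {v}. h w) = r * h v" if "v \<in> V" for v
    using maximizer_is_eigenvector[OF max _ that] by blast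
  \<comment> \<open>The sum of \<open>x\<close> and its absolute value is a nonnegative eigenvector
    that is nonzero at \<open>u\<close>, and it vanishes wherever \<open>x\<close> is not
    positive.\<close>
  have "0 < h v + x v" if "v \<in> V" for v
  proof (rule nonneg_eigenvector_positive[where x = "\<lambda>v. h v + x v" and u = u and r = r, OF conn])
    fix w assume "w \<in> V"
    show "(\<Sum>w\<in>E `` {w}. h w + x w) = r * (h w + x w)"
      using eig eigh \<open>w \<in> V\<close> by (simp add: sum.distrib algebra_simps)
    show "0 \<le> h w + x w" by (simp add: h_def)
  qed (use u that in \<open>auto simp: h_def\<close>)
  then have "\<forall>v\<in>V. 0 < x v" by (force simp: h_def abs_if split: if_splits)
  then show ?thesis by simp
next
  case False
  have "\<exists>u\<in>V. x u \<noteq> 0" using ne by (rule contrapos_np) simp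
  then obtain u where u: "u \<in> V" "x u \<noteq> 0" by auto
  have "0 < - x v" if "v \<in> V" for v
  proof (rule nonneg_eigenvector_positive[where x = "\<lambda>v. - x v" and u = u and r = r, OF conn])
    fix w assume "w \<in> V"
    show "(\<Sum>w\<in>E `` {w}. - x w) = r * (- x w)"
      using eig \<open>w \<in> V\<close> by (simp add: sum_negf)
    show "0 \<le> - x w" using False \<open>w \<in> V\<close> by force
  qed (use u that in auto)
  then show ?thesis by auto
qed

section \<open>From an eigenvector to its sign classes\<close>

text \<open>The eigenvalue equation is paired with the restriction of \<open>x\<close> to
  \<open>P\<close>; zero entries drop out. The subtracted sum has only negative terms, so
  \<open>r\<close> is at most the Rayleigh quotient on \<open>P\<close>, with equality exactly when
  no arc leads from \<open>P\<close> to \<open>N\<close>. In the even case the same sum produces the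
  loop.\<close>

lemma positive_part_identity:
  assumes eig: "\<And>v. v \<in> V \<Longrightarrow> (\<Sum>w\<in>E `` {v}. x w) = r * x v"
  defines "P \<equiv> {v \<in> V. 0 < x v}" and "N \<equiv> {v \<in> V. x v < 0}"
  shows "qform (E \<inter> P \<times> P) x = r * (\<Sum>v\<in>P. (x v)\<^sup>2) - (\<Sum>(u, w)\<in>E \<inter> P \<times> N. x u * x w)"
proof -
  have finP: "finite P" using finV by (simp add: P_def)
  have row: "(\<Sum>w\<in>E `` {v} \<inter> P. x w) = r * x v - (\<Sum>w\<in>E `` {v} \<inter> N. x w)" if "v \<in> P" for v
  proof -
    have "r * x v = (\<Sum>w\<in>E `` {v}. x w)" using eig[of v] that by (simp add: P_def)
    also have "\<dots> = (\<Sum>w\<in>(E `` {v} \<inter> P) \<union> (E `` {v} \<inter> N). x w)"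
      using fin_nbrs nbrs_subset by (intro sum.mono_neutral_right) (auto simp: P_def N_def; force)+
    also have "\<dots> = (\<Sum>w\<in>E `` {v} \<inter> P. x w) + (\<Sum>w\<in>E `` {v} \<inter> N. x w)"
      using fin_nbrs by (intro sum.union_disjoint) (auto simp: P_def N_def)
    finally show ?thesis by simp
  qed
  have "qform (E \<inter> P \<times> P) x = (\<Sum>v\<in>P. x v * (\<Sum>w\<in>(E \<inter> P \<times> P) `` {v}. x w))"
    using finP by (intro qform_rows) auto
  also have "\<dots> = (\<Sum>v\<in>P. x v * (\<Sum>w\<in>E `` {v} \<inter> P. x w))"
    by (intro sum.cong arg_cong2[where f = "(*)"] refl) auto
  also have "\<dots> = (\<Sum>v\<in>P. r * (x v)\<^sup>2 - (\<Sum>w\<in>E `` {v} \<inter> N. x v * x w))"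
    by (intro sum.cong) (auto simp: row algebra_simps power2_eq_square sum_distrib_left)
  also have "\<dots> = r * (\<Sum>v\<in>P. (x v)\<^sup>2) - (\<Sum>v\<in>P. \<Sum>w\<in>E `` {v} \<inter> N. x v * x w)"
    by (simp add: sum_subtractf sum_distrib_left)
  also have "(\<Sum>v\<in>P. \<Sum>w\<in>E `` {v} \<inter> N. x v * x w) = (\<Sum>(u, w)\<in>Sigma P (\<lambda>v. E `` {v} \<inter> N). x u * x w)"
    using finP fin_nbrs by (intro sum.Sigma) auto
  also have "Sigma P (\<lambda>v. E `` {v} \<inter> N) = E \<inter> P \<times> N" by auto
  finally show ?thesis .
qed

text \<open>A sign class may be too small for the spectral bounds, which require a minimal order. It
  is filled up to \<open>m\<close> vertices that are isolated in the induced arc set, and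
  \<open>y\<close> is extended by 0.\<close>

lemma part_subgraph:
  assumes U: "U \<subseteq> V" "card U \<le> m" "m \<le> card V" and nc: "\<not> has_cycle E (2 * k + 1)"
  obtains W where "sgraph W (E \<inter> U \<times> U)" "\<not> has_cycle (E \<inter> U \<times> U) (2 * k + 1)" "card W = m"
    "\<And>y. (\<Sum>v\<in>W. (if v \<in> U then y v else 0)\<^sup>2) = (\<Sum>v\<in>U. (y v :: real)\<^sup>2)"
    "\<And>y. qform (E \<inter> U \<times> U) (\<lambda>v. if v \<in> U then y v else 0) = qform (E \<inter> U \<times> U) y"
proof -
  obtain W where W: "U \<subseteq> W" "W \<subseteq> V" "card W = m"
    using exists_subset_between[OF U(2,3,1) finV] by auto
  have finW: "finite W" using W finV finite_subset by auto
  show ?thesis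
  proof (rule that[of W])
    show "sgraph W (E \<inter> U \<times> U)"
      using finW W symE irr by (auto simp: sgraph_def sym_def irrefl_def)
    show "\<not> has_cycle (E \<inter> U \<times> U) (2 * k + 1)" using nc has_cycle_mono by blast
    show "card W = m" by fact
    fix y :: "'a \<Rightarrow> real"
    show "(\<Sum>v\<in>W. (if v \<in> U then y v else 0)\<^sup>2) = (\<Sum>v\<in>U. (y v)\<^sup>2)"
      using finW W by (intro sum.mono_neutral_cong_right) auto
    show "qform (E \<inter> U \<times> U) (\<lambda>v. if v \<in> U then y v else 0) = qform (E \<inter> U \<times> U) y"
      unfolding qform_def by (intro sum.cong) auto
  qed
qed

lemma part_bound:
  assumes U: "U \<subseteq> V" "card U \<le> m" "m \<le> card V" and nc: "\<not> has_cycle E (2 * k + 1)"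
    and k: "1 \<le> k" "580 * k \<le> m"
  shows "qform (E \<inter> U \<times> U) y \<le> m / 2 * (\<Sum>v\<in>U. (y v)\<^sup>2)"
proof -
  obtain W where W: "sgraph W (E \<inter> U \<times> U)" "\<not> has_cycle (E \<inter> U \<times> U) (2 * k + 1)" "card W = m"
    "\<And>y. (\<Sum>v\<in>W. (if v \<in> U then y v else 0)\<^sup>2) = (\<Sum>v\<in>U. (y v :: real)\<^sup>2)"
    "\<And>y. qform (E \<inter> U \<times> U) (\<lambda>v. if v \<in> U then y v else 0) = qform (E \<inter> U \<times> U) y"
    by (rule part_subgraph[OF assms(1-4)]) (rule that; assumption)
  show ?thesis
    using sgraph.spectral_turan_bound[OF W(1,2) k(1), of "\<lambda>v. if v \<in> U then y v else 0"] k W by simp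
qed

lemma part_stability:
  assumes U: "U \<subseteq> V" "card U \<le> m" "m \<le> card V" and nc: "\<not> has_cycle E (2 * k + 1)"
    and k: "1 \<le> k" "580 * k < m" and nb: "\<not> bipartite (E \<inter> U \<times> U)"
  shows "qform (E \<inter> U \<times> U) y \<le> (m / 2 - 1 / 40) * (\<Sum>v\<in>U. (y v)\<^sup>2)"
proof -
  obtain W where W: "sgraph W (E \<inter> U \<times> U)" "\<not> has_cycle (E \<inter> U \<times> U) (2 * k + 1)" "card W = m"
    "\<And>y. (\<Sum>v\<in>W. (if v \<in> U then y v else 0)\<^sup>2) = (\<Sum>v\<in>U. (y v :: real)\<^sup>2)"
    "\<And>y. qform (E \<inter> U \<times> U) (\<lambda>v. if v \<in> U then y v else 0) = qform (E \<inter> U \<times> U) y"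
    by (rule part_subgraph[OF assms(1-4)]) (rule that; assumption)
  show ?thesis
    using sgraph.spectral_turan_stability[OF W(1,2) k(1) _ nb, of "\<lambda>v. if v \<in> U then y v else 0"] k W by simp
qed

lemma bipartite_part:
  assumes "bipartite (E \<inter> U \<times> U)" and U: "U \<subseteq> V"
  obtains A B where "finite A" "finite B" "A \<inter> B = {}" "A \<union> B = U" "E \<inter> U \<times> U \<subseteq> cbip A B"
    "card A + card B = card U"
proof -
  obtain X where "\<forall>(u, v) \<in> E \<inter> U \<times> U. u \<in> X \<longleftrightarrow> v \<notin> X"
    using assms unfolding bipartite_def by auto
  then have X: "u \<in> X \<longleftrightarrow> v \<notin> X" if "(u, v) \<in> E \<inter> U \<times> U" for u v using that by blast
  have finU: "finite U" using U finV finite_subset by auto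
  show ?thesis
  proof (rule that[of "U \<inter> X" "U - X"])
    show "E \<inter> U \<times> U \<subseteq> cbip (U \<inter> X) (U - X)"
    proof
      fix e assume "e \<in> E \<inter> U \<times> U"
      then show "e \<in> cbip (U \<inter> X) (U - X)" using X by (cases e) (auto simp: cbip_def)
    qed
    show "card (U \<inter> X) + card (U - X) = card U" using card_Int_Diff[OF finU, of X] by simp
  qed (use finU in auto)
qed

end

lemma second_eigenvector_both_signs:
  assumes G: "pair_graph G" and c2: "2 \<le> card (pverts G)"
    and conn: "Digraph_Component.connected (with_proj G)"
  obtains y where
    "\<And>v. v \<in> pverts G \<Longrightarrow> (\<Sum>w\<in>parcs G `` {v}. y w) = graph_eigenvalue 2 G * y v"
    "{v \<in> pverts G. 0 < y v} \<noteq> {}" "{v \<in> pverts G. y v < 0} \<noteq> {}"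
proof -
  interpret sgraph "pverts G" "parcs G" using sgraph_pair_graph[OF G] .
  obtain x y where x: "(\<Sum>v\<in>pverts G. (x v)\<^sup>2) = 1" and y: "(\<Sum>v\<in>pverts G. (y v)\<^sup>2) = 1"
    and xy: "(\<Sum>v\<in>pverts G. x v * y v) = 0"
    and eigx: "\<And>v. v \<in> pverts G \<Longrightarrow> (\<Sum>w\<in>parcs G `` {v}. x w) = graph_eigenvalue 1 G * x v"
    and eigy: "\<And>v. v \<in> pverts G \<Longrightarrow> (\<Sum>w\<in>parcs G `` {v}. y w) = graph_eigenvalue 2 G * y v"
    and max: "\<And>z. qform (parcs G) z \<le> graph_eigenvalue 1 G * (\<Sum>v\<in>pverts G. (z v)\<^sup>2)"
    by (rule second_eigenvector[OF G c2]) (rule that; assumption)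
  have sign: "(\<forall>v\<in>pverts G. 0 < x v) \<or> (\<forall>v\<in>pverts G. x v < 0)"
    by (rule top_eigenvector_one_sign[OF connected_closed_set[OF G conn] eigx max]) (use x in auto)
  obtain s :: real where s: "\<And>v. v \<in> pverts G \<Longrightarrow> 0 < s * x v"
    using sign that[of 1] that[of "-1"] by auto
  have perp: "(\<Sum>v\<in>pverts G. s * x v * y v) = 0"
    using xy by (simp add: mult.assoc flip: sum_distrib_left)
  have "(\<Sum>v\<in>pverts G. (y v)\<^sup>2) \<noteq> 0" using y by simp
  then have "\<exists>u\<in>pverts G. y u \<noteq> 0" by (rule contrapos_np) simp
  then obtain u where u: "u \<in> pverts G" "y u \<noteq> 0" by auto
  \<comment> \<open>If \<open>c * y\<close> were nonnegative, its orthogonality to the positive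
    vector \<open>s * x\<close> would make it vanish.\<close>
  have zero: "y u = 0" if nn: "\<And>v. v \<in> pverts G \<Longrightarrow> 0 \<le> c * y v" and c: "c \<noteq> 0" for c
  proof -
    have nn': "0 \<le> c * (s * x v * y v)" if "v \<in> pverts G" for v
      using mult_nonneg_nonneg[OF less_imp_le[OF s[OF that]] nn[OF that]] by (simp add: ac_simps)
    have "(\<Sum>v\<in>pverts G. c * (s * x v * y v)) = 0"
      using perp by (simp flip: sum_distrib_left)
    then have "\<forall>v\<in>pverts G. c * (s * x v * y v) = 0"
      using nn' finV by (subst (asm) sum_nonneg_eq_0_iff) auto
    then have "c * (s * x u * y u) = 0" using u by blast
    then show ?thesis using s[OF u(1)] c by auto
  qed
  have pos: "\<exists>v\<in>pverts G. 0 < y v"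
    using zero[of "-1"] u by force
  have neg: "\<exists>v\<in>pverts G. y v < 0"
    using zero[of 1] u by force
  show ?thesis by (rule that[OF eigy]) (use pos neg in auto)
qed

section \<open>Copies of the Turan graph\<close>

lemma turan2_sets:
  "pverts (turan2 m) = Inl ` {..<m div 2} \<union> Inr ` {..<(m + 1) div 2}"
  "parcs (turan2 m) = cbip (Inl ` {..<m div 2}) (Inr ` {..<(m + 1) div 2})"
  by (auto simp: turan2_def complete_bipartite_def cbip_def)

lemma card_turan2: "card (pverts (turan2 m)) = m"
proof -
  have "card (pverts (turan2 m)) = m div 2 + (m + 1) div 2"
    unfolding turan2_sets by (subst card_Un_disjoint) (auto simp: card_image)
  then show ?thesis by simp
qed

lemma turan2_parts:
  assumes "X \<in> turan2_partition_sets m"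
  obtains Y where "pverts (turan2 m) = X \<union> Y" "parcs (turan2 m) = cbip X Y" "X \<inter> Y = {}"
    "finite X" "finite Y" "card X + card Y = m"
proof -
  let ?L = "Inl ` {..<m div 2} :: (nat + nat) set" and ?R = "Inr ` {..<(m + 1) div 2} :: (nat + nat) set"
  have c: "card ?L + card ?R = m" by (simp add: card_image)
  consider "X = ?L" | "X = ?R" using assms by (auto simp: turan2_partition_sets_def)
  then show ?thesis
  proof cases
    case 1
    show ?thesis by (rule that[of ?R]) (use 1 c in \<open>auto simp: turan2_sets\<close>)
  next
    case 2
    show ?thesis by (rule that[of ?L]) (use 2 c in \<open>auto simp: turan2_sets cbip_commute\<close>)
  qed
qed

text \<open>The Perron vector: constant on each side, scaled so that both sides carry the same
  mass.\<close>

lemma cbip_test_vector: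
  assumes "finite A" "finite B" "A \<inter> B = {}" "0 < card A" "0 < card B"
  obtains h where "qform (cbip A B) h = sqrt (card A * card B) * (\<Sum>v\<in>A \<union> B. (h v)\<^sup>2)"
    "0 < (\<Sum>v\<in>A \<union> B. (h v)\<^sup>2)"
proof -
  define h where "h v = (if v \<in> A then sqrt (card B) else sqrt (card A))" for v
  have hA: "(\<Sum>v\<in>A. h v) = card A * sqrt (card B)" "(\<Sum>v\<in>A. (h v)\<^sup>2) = card A * card B"
    by (auto simp: h_def)
  have "v \<notin> A" if "v \<in> B" for v using that assms by auto
  then have hB: "(\<Sum>v\<in>B. h v) = card B * sqrt (card A)" "(\<Sum>v\<in>B. (h v)\<^sup>2) = card B * card A"
    by (auto simp: h_def)
  have "(\<Sum>v\<in>A \<union> B. (h v)\<^sup>2) = 2 * (real (card A) * card B)"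
    using assms by (simp add: sum.union_disjoint hA hB)
  moreover have "qform (cbip A B) h = sqrt (card A * card B) * (2 * (real (card A) * card B))"
    by (simp add: qform_cbip[OF assms(1-3)] hA hB real_sqrt_mult)
  ultimately show ?thesis using that[of h] assms(4,5) by simp
qed

lemma turan2_test_vector:
  assumes "2 \<le> m"
  obtains h where
    "qform (parcs (turan2 m)) h = sqrt (real (m div 2) * real ((m + 1) div 2)) * (\<Sum>v\<in>pverts (turan2 m). (h v)\<^sup>2)"
    "0 < (\<Sum>v\<in>pverts (turan2 m). (h v)\<^sup>2)"
proof -
  let ?L = "Inl ` {..<m div 2} :: (nat + nat) set" and ?R = "Inr ` {..<(m + 1) div 2} :: (nat + nat) set"
  have card: "card ?L = m div 2" "card ?R = (m + 1) div 2" by (simp_all add: card_image)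
  have "finite ?L" "finite ?R" "?L \<inter> ?R = {}" "0 < card ?L" "0 < card ?R"
    using assms unfolding card by auto
  then obtain h where "qform (cbip ?L ?R) h = sqrt (card ?L * card ?R) * (\<Sum>v\<in>?L \<union> ?R. (h v)\<^sup>2)"
    "0 < (\<Sum>v\<in>?L \<union> ?R. (h v)\<^sup>2)"
    by (rule cbip_test_vector)
  then show ?thesis using that[of h] unfolding turan2_sets card by simp
qed

lemma turan2_spectral_radius:
  assumes "2 \<le> m"
  shows "graph_spectral_radius (turan2 m) = sqrt (real (m div 2) * real ((m + 1) div 2))"
proof -
  let ?L = "Inl ` {..<m div 2} :: (nat + nat) set" and ?R = "Inr ` {..<(m + 1) div 2} :: (nat + nat) set"
  let ?T = "turan2 m" and ?s = "sqrt (real (m div 2) * real ((m + 1) div 2))"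
  have card: "card ?L = m div 2" "card ?R = (m + 1) div 2" by (simp_all add: card_image)
  have c2: "2 \<le> card (pverts ?T)" using assms by (simp add: card_turan2)
  interpret T: sgraph "pverts ?T" "parcs ?T" using sgraph_pair_graph[OF pair_graph_turan2] .
  obtain x y where x: "(\<Sum>v\<in>pverts ?T. (x v)\<^sup>2) = 1"
    and eig: "\<And>v. v \<in> pverts ?T \<Longrightarrow> (\<Sum>w\<in>parcs ?T `` {v}. x w) = graph_eigenvalue 1 ?T * x v"
    and max: "\<And>z. qform (parcs ?T) z \<le> graph_eigenvalue 1 ?T * (\<Sum>v\<in>pverts ?T. (z v)\<^sup>2)"
    by (rule second_eigenvector[OF pair_graph_turan2 c2]) (rule that; assumption)
  have "qform (parcs ?T) x \<le> ?s * (\<Sum>v\<in>pverts ?T. (x v)\<^sup>2)"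
  proof (rule T.qform_bipartite_le_sqrt[of ?L])
    fix u v assume "(u, v) \<in> parcs ?T"
    then show "u \<in> ?L \<longleftrightarrow> v \<notin> ?L" by (auto simp: turan2_sets cbip_def)
  next
    have "pverts ?T \<inter> ?L = ?L" "pverts ?T - ?L = ?R" by (auto simp: turan2_sets)
    then show "real (card (pverts ?T \<inter> ?L)) * card (pverts ?T - ?L) \<le> ?s\<^sup>2" using card by simp
  qed simp
  then have "graph_eigenvalue 1 ?T \<le> ?s"
    using x qform_eigenvector[OF T.finV T.EV eig] by simp
  moreover obtain h where h: "qform (parcs ?T) h = ?s * (\<Sum>v\<in>pverts ?T. (h v)\<^sup>2)"
    "0 < (\<Sum>v\<in>pverts ?T. (h v)\<^sup>2)"
    using turan2_test_vector[OF assms] .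
  then have "?s \<le> graph_eigenvalue 1 ?T"
    using max[of h] by simp
  ultimately show ?thesis by (simp add: graph_spectral_radius_def)
qed

text \<open>The image of one vertex is prescribed because the edge of the even extremal graph
  attaches at given vertices \<open>u\<close> and \<open>v\<close>.\<close>

lemma bij_betw_pointed:
  assumes "finite A" "finite B" "card A = card B" "u \<in> A" "u' \<in> B"
  obtains f where "bij_betw f A B" "f u = u'"
proof -
  have "card (A - {u}) = card (B - {u'})" using assms by simp
  then obtain g where g: "bij_betw g (A - {u}) (B - {u'})"
    using assms finite_same_card_bij[of "A - {u}" "B - {u'}"] by auto
  define f where "f = g(u := u')"
  have "bij_betw f (A - {u}) (B - {u'})"
    using g by (subst bij_betw_cong[of "A - {u}" f g]) (auto simp: f_def)
  moreover have "bij_betw f {u} {u'}" by (simp add: bij_betw_def f_def)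
  ultimately have "bij_betw f (A - {u} \<union> {u}) (B - {u'} \<union> {u'})"
    by (rule bij_betw_combine) auto
  then show ?thesis using that[of f] assms by (simp add: f_def insert_absorb)
qed

lemma cbip_bij:
  assumes fin: "finite A" "finite B" "finite A'" "finite B'"
    and disj: "A \<inter> B = {}" "A' \<inter> B' = {}"
    and card: "card A = card A'" "card B = card B'" and u: "u \<in> A" "u' \<in> A'"
  obtains f where "bij_betw f (A \<union> B) (A' \<union> B')" "f u = u'"
    "\<And>p q. p \<in> A \<union> B \<Longrightarrow> q \<in> A \<union> B \<Longrightarrow> (p, q) \<in> cbip A B \<longleftrightarrow> (f p, f q) \<in> cbip A' B'"
proof -
  obtain g where g: "bij_betw g A A'" "g u = u'"
    using bij_betw_pointed[OF fin(1,3) card(1) u] .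
  obtain h where h: "bij_betw h B B'" using finite_same_card_bij[OF fin(2,4) card(2)] by auto
  define f where "f v = (if v \<in> A then g v else h v)" for v
  have fA: "bij_betw f A A'" using g by (subst bij_betw_cong[of A f g]) (auto simp: f_def)
  have fB: "bij_betw f B B'" using h disj by (subst bij_betw_cong[of B f h]) (auto simp: f_def)
  have A: "f p \<in> A'" if "p \<in> A" for p using fA that by (auto simp: bij_betw_def)
  have B: "f p \<in> B'" if "p \<in> B" for p using fB that by (auto simp: bij_betw_def)
  show ?thesis
  proof (rule that[of f])
    show "bij_betw f (A \<union> B) (A' \<union> B')" using bij_betw_combine[OF fA fB disj(2)] .
    show "f u = u'" using g u by (simp add: f_def)
    fix p q assume pq: "p \<in> A \<union> B" "q \<in> A \<union> B"
    have "p \<in> A \<longleftrightarrow> f p \<in> A'" "p \<in> B \<longleftrightarrow> f p \<in> B'" "q \<in> A \<longleftrightarrow> f q \<in> A'" "q \<in> B \<longleftrightarrow> f q \<in> B'"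
      using pq A B disj by blast+
    then show "(p, q) \<in> cbip A B \<longleftrightarrow> (f p, f q) \<in> cbip A' B'" by (simp add: cbip_def)
  qed
qed

definition turan_copy :: "('a \<times> 'a) set \<Rightarrow> nat \<Rightarrow> 'a set \<Rightarrow> bool" where
  "turan_copy E m U \<longleftrightarrow> (\<exists>A B. finite A \<and> finite B \<and> A \<inter> B = {} \<and> A \<union> B = U \<and> E \<inter> U \<times> U = cbip A B \<and>
     card A = m div 2 \<and> card B = (m + 1) div 2)"

lemma turan_copy_card: "turan_copy E m U \<Longrightarrow> card U = m"
proof -
  assume "turan_copy E m U"
  then obtain A B where "finite A" "finite B" "A \<inter> B = {}" "A \<union> B = U" "card A = m div 2" "card B = (m + 1) div 2"
    unfolding turan_copy_def by (elim exE conjE) (rule that; assumption)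
  then have "card U = m div 2 + (m + 1) div 2" using card_Un_disjoint[of A B] by simp
  then show ?thesis by simp
qed

lemma turan_copy_bij:
  assumes "turan_copy E m U" "2 \<le> m"
  obtains f where "bij_betw f U (pverts (turan2 m))"
    "\<And>p q. p \<in> U \<Longrightarrow> q \<in> U \<Longrightarrow> (p, q) \<in> E \<longleftrightarrow> (f p, f q) \<in> parcs (turan2 m)"
proof -
  let ?L = "Inl ` {..<m div 2} :: (nat + nat) set" and ?R = "Inr ` {..<(m + 1) div 2} :: (nat + nat) set"
  obtain A B where AB: "finite A" "finite B" "A \<inter> B = {}" "A \<union> B = U" "E \<inter> U \<times> U = cbip A B"
    "card A = m div 2" "card B = (m + 1) div 2"
    using assms(1) unfolding turan_copy_def by (elim exE conjE) (rule that; assumption)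
  have card: "card A = card ?L" "card B = card ?R" using AB by (simp_all add: card_image)
  have fin: "finite ?L" "finite ?R" "?L \<inter> ?R = {}" by auto
  have "A \<noteq> {}" using AB assms(2) by auto
  then obtain u where u: "u \<in> A" by auto
  have u': "Inl 0 \<in> ?L" using assms(2) by auto
  obtain f where f: "bij_betw f (A \<union> B) (?L \<union> ?R)"
    "\<And>p q. p \<in> A \<union> B \<Longrightarrow> q \<in> A \<union> B \<Longrightarrow> (p, q) \<in> cbip A B \<longleftrightarrow> (f p, f q) \<in> cbip ?L ?R"
    by (rule cbip_bij[OF AB(1,2) fin(1,2) AB(3) fin(3) card u u']) (rule that; assumption)
  show ?thesis
  proof (rule that[of f])
    show "bij_betw f U (pverts (turan2 m))" using f(1) AB(4) by (simp add: turan2_sets)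
    fix p q assume pq: "p \<in> U" "q \<in> U"
    have "(p, q) \<in> E \<longleftrightarrow> (p, q) \<in> cbip A B" using pq AB(5) by blast
    then show "(p, q) \<in> E \<longleftrightarrow> (f p, f q) \<in> parcs (turan2 m)"
      using f(2) pq AB(4) by (simp add: turan2_sets)
  qed
qed

lemma balanced_halves:
  fixes m :: nat
  shows "m div 2 \<le> (m + 1) div 2" "(m + 1) div 2 \<le> m div 2 + 1" "m div 2 + (m + 1) div 2 = m"
  by auto

text \<open>The looped eigenvalue \<open>\<theta>\<close> separates the two sides: its equation has
  a positive right side, which puts it below \<open>sqrt (s * t)\<close>. The bound 52 is twice the
  threshold 26.\<close>

lemma half_less_sqrt:
  assumes "52 \<le> m"
  shows "real m / 2 - 1 / 40 < sqrt (real (m div 2) * real ((m + 1) div 2))"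
proof -
  obtain \<theta> where th: "0 < \<theta>" "(\<theta> + 1) * (real (m div 2) * real ((m + 1) div 2) - \<theta>\<^sup>2) = real (m div 2)"
    "real (m div 2 + (m + 1) div 2) / 2 - 1 / 40 < \<theta>"
    by (rule loop_eigenvalue_exists[OF balanced_halves(1,2)[of m]]) (use assms in auto)
  have "0 < (\<theta> + 1) * (real (m div 2) * real ((m + 1) div 2) - \<theta>\<^sup>2)" using th assms by simp
  then have "\<theta>\<^sup>2 < real (m div 2) * real ((m + 1) div 2)" using th(1) by (simp add: zero_less_mult_iff)
  then have "\<theta> < sqrt (real (m div 2) * real ((m + 1) div 2))" by (rule real_less_rsqrt)
  then show ?thesis using th(3) unfolding balanced_halves(3) by (rule less_trans[rotated])
qed

context sgraph
begin

text \<open>A non-bipartite class loses \<open>1 / 40\<close> against \<open>m / 2\<close>, more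
  than the rounding loss of the Turan radius, so it falls strictly short; a bipartite class is
  settled by the balanced product.\<close>

lemma part_turan_bound:
  assumes U: "U \<subseteq> V" "card U \<le> m" "m \<le> card V" "U \<noteq> {}" and nc: "\<not> has_cycle E (2 * k + 1)"
    and k: "1 \<le> k" "580 * k < m" and pos: "\<And>v. v \<in> U \<Longrightarrow> 0 < y v"
  defines "\<tau> \<equiv> sqrt (real (m div 2) * real ((m + 1) div 2))"
  shows "qform (E \<inter> U \<times> U) y \<le> \<tau> * (\<Sum>v\<in>U. (y v)\<^sup>2)"
    and "qform (E \<inter> U \<times> U) y = \<tau> * (\<Sum>v\<in>U. (y v)\<^sup>2) \<Longrightarrow> turan_copy E m U"
proof -
  have finU: "finite U" using U finV finite_subset by auto
  have S: "0 < (\<Sum>v\<in>U. (y v)\<^sup>2)" using U(4) finU by (intro sum_pos zero_less_power pos) auto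
  have m: "52 \<le> m" using k by linarith
  have "qform (E \<inter> U \<times> U) y \<le> \<tau> * (\<Sum>v\<in>U. (y v)\<^sup>2) \<and>
    (qform (E \<inter> U \<times> U) y = \<tau> * (\<Sum>v\<in>U. (y v)\<^sup>2) \<longrightarrow> turan_copy E m U)"
  proof (cases "bipartite (E \<inter> U \<times> U)")
    case False
    have "qform (E \<inter> U \<times> U) y \<le> (m / 2 - 1 / 40) * (\<Sum>v\<in>U. (y v)\<^sup>2)"
      by (rule part_stability[OF U(1-3) nc k False])
    also have "\<dots> < \<tau> * (\<Sum>v\<in>U. (y v)\<^sup>2)"
      using S half_less_sqrt[OF m] unfolding \<tau>_def by (intro mult_strict_right_mono) auto
    finally show ?thesis by simp
  next
    case True
    obtain A B where AB: "finite A" "finite B" "A \<inter> B = {}" "A \<union> B = U" "E \<inter> U \<times> U \<subseteq> cbip A B"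
      "card A + card B = card U"
      by (rule bipartite_part[OF True U(1)]) (rule that; assumption)
    have card: "card A + card B \<le> m div 2 + (m + 1) div 2" using AB U(2) unfolding balanced_halves(3) by simp
    have s0: "0 < m div 2" using m by simp
    have posAB: "0 < y v" if "v \<in> A \<union> B" for v using pos that AB(4) by simp
    have ne: "A \<union> B \<noteq> {}" using AB(4) U(4) by simp
    note b = bipartite_qform_bound[OF AB(1-3,5) card balanced_halves(1,2)[of m] s0, of y, OF posAB ne]
    show ?thesis
    proof (intro conjI impI)
      show "qform (E \<inter> U \<times> U) y \<le> \<tau> * (\<Sum>v\<in>U. (y v)\<^sup>2)"
        using b(1) AB(4) by (simp add: \<tau>_def)
      assume "qform (E \<inter> U \<times> U) y = \<tau> * (\<Sum>v\<in>U. (y v)\<^sup>2)"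
      then have c: "E \<inter> U \<times> U = cbip A B"
        "card A = m div 2 \<and> card B = (m + 1) div 2 \<or> card A = (m + 1) div 2 \<and> card B = m div 2"
        using b(2) AB(4) by (simp_all add: \<tau>_def)
      from c(2) show "turan_copy E m U"
      proof
        assume "card A = m div 2 \<and> card B = (m + 1) div 2"
        then show ?thesis using AB(1-4) c(1) unfolding turan_copy_def by blast
      next
        assume "card A = (m + 1) div 2 \<and> card B = m div 2"
        then have "finite B \<and> finite A \<and> B \<inter> A = {} \<and> B \<union> A = U \<and> E \<inter> U \<times> U = cbip B A \<and>
          card B = m div 2 \<and> card A = (m + 1) div 2"
          using AB(1-4) c(1) by (simp add: cbip_commute Int_commute Un_commute)
        then show ?thesis unfolding turan_copy_def by blast
      qed
    qed
  qed
  then show "qform (E \<inter> U \<times> U) y \<le> \<tau> * (\<Sum>v\<in>U. (y v)\<^sup>2)"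
    "qform (E \<inter> U \<times> U) y = \<tau> * (\<Sum>v\<in>U. (y v)\<^sup>2) \<Longrightarrow> turan_copy E m U" by auto
qed

lemma positive_part_turan:
  assumes eig: "\<And>v. v \<in> V \<Longrightarrow> (\<Sum>w\<in>E `` {v}. x w) = r * x v"
    and nc: "\<not> has_cycle E (2 * k + 1)" and k: "1 \<le> k" "580 * k < m"
  defines "P \<equiv> {v \<in> V. 0 < x v}" and "N \<equiv> {v \<in> V. x v < 0}"
  assumes P: "P \<noteq> {}" "card P \<le> m" and m: "m \<le> card V"
  defines "\<tau> \<equiv> sqrt (real (m div 2) * real ((m + 1) div 2))"
  shows "r \<le> \<tau>" and "r = \<tau> \<Longrightarrow> turan_copy E m P \<and> E \<inter> P \<times> N = {}"
proof -
  have PV: "P \<subseteq> V" by (auto simp: P_def)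
  then have finP: "finite P" using finV finite_subset by auto
  have pos: "0 < x v" if "v \<in> P" for v using that by (simp add: P_def)
  have S: "0 < (\<Sum>v\<in>P. (x v)\<^sup>2)" using P(1) finP by (intro sum_pos zero_less_power pos) auto
  have finE: "finite (E \<inter> P \<times> N)"
    using finV by (intro finite_Int disjI2 finite_cartesian_product) (auto simp: P_def N_def)
  have neg: "x u * x w < 0" if "(u, w) \<in> E \<inter> P \<times> N" for u w
    using that by (auto simp: P_def N_def mult_pos_neg)
  let ?c = "\<Sum>(u, w)\<in>E \<inter> P \<times> N. x u * x w"
  have c: "?c \<le> 0" using neg by (intro sum_nonpos) (auto intro: less_imp_le)
  have id: "qform (E \<inter> P \<times> P) x = r * (\<Sum>v\<in>P. (x v)\<^sup>2) - ?c"
    using positive_part_identity[OF eig] unfolding P_def N_def by blast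
  note pt = part_turan_bound[OF PV P(2) m P(1) nc k, of x, OF pos, folded \<tau>_def]
  have "r * (\<Sum>v\<in>P. (x v)\<^sup>2) \<le> \<tau> * (\<Sum>v\<in>P. (x v)\<^sup>2)" using pt(1) id c by linarith
  then show "r \<le> \<tau>" using S by simp
  assume r: "r = \<tau>"
  have "?c = 0" "qform (E \<inter> P \<times> P) x = \<tau> * (\<Sum>v\<in>P. (x v)\<^sup>2)" using pt(1) id c r by simp_all
  moreover have "E \<inter> P \<times> N = {}"
  proof (rule ccontr)
    assume "E \<inter> P \<times> N \<noteq> {}"
    then have "0 < (\<Sum>(u, w)\<in>E \<inter> P \<times> N. - (x u * x w))"
      using finE neg by (intro sum_pos) auto
    moreover have "(\<Sum>(u, w)\<in>E \<inter> P \<times> N. - (x u * x w)) = - ?c"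
      by (simp add: case_prod_unfold sum_negf)
    ultimately show False using \<open>?c = 0\<close> by simp
  qed
  ultimately show "turan_copy E m P \<and> E \<inter> P \<times> N = {}" using pt(2) by simp
qed

end

section \<open>Extremal structure\<close>

lemma vertex_join_arcs [simp]:
  "(Some (Inl p), Some (Inl q)) \<in> parcs (vertex_join A S T B) \<longleftrightarrow> (p, q) \<in> parcs A"
  "(Some (Inr p'), Some (Inr q')) \<in> parcs (vertex_join A S T B) \<longleftrightarrow> (p', q') \<in> parcs B"
  "(Some (Inl p), Some (Inr q')) \<notin> parcs (vertex_join A S T B)"
  "(Some (Inr p'), Some (Inl q)) \<notin> parcs (vertex_join A S T B)"
  "(None, Some (Inl p)) \<in> parcs (vertex_join A S T B) \<longleftrightarrow> p \<in> S"
  "(None, Some (Inr p')) \<in> parcs (vertex_join A S T B) \<longleftrightarrow> p' \<in> T"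
  "(Some (Inl p), None) \<in> parcs (vertex_join A S T B) \<longleftrightarrow> p \<in> S"
  "(Some (Inr p'), None) \<in> parcs (vertex_join A S T B) \<longleftrightarrow> p' \<in> T"
  "(None, None) \<notin> parcs (vertex_join A S T B)"
  by (auto simp: vertex_join_def disjoint_union_def)

lemma edge_join_arcs [simp]:
  "(Inl p, Inl q) \<in> parcs (edge_join A u v B) \<longleftrightarrow> (p, q) \<in> parcs A"
  "(Inr p', Inr q') \<in> parcs (edge_join A u v B) \<longleftrightarrow> (p', q') \<in> parcs B"
  "(Inl p, Inr q') \<in> parcs (edge_join A u v B) \<longleftrightarrow> p = u \<and> q' = v"
  "(Inr p', Inl q) \<in> parcs (edge_join A u v B) \<longleftrightarrow> p' = v \<and> q = u"
  by (auto simp: edge_join_def disjoint_union_def)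

lemma pverts_joins:
  "pverts (vertex_join A S T B) = insert None (Some ` (pverts A <+> pverts B))"
  "pverts (edge_join A u v B) = pverts A <+> pverts B"
  by (auto simp: vertex_join_def edge_join_def disjoint_union_def)

lemma pair_graph_fin: "pair_graph G \<Longrightarrow> finite (parcs G) \<and> finite (pverts G) \<and> parcs G \<subseteq> pverts G \<times> pverts G"
  unfolding pair_graph_iff by (meson finite_SigmaI finite_subset)

lemma qform_scale: "qform E (\<lambda>v. c * h v) = c\<^sup>2 * qform E h"
  by (simp add: qform_def case_prod_unfold power2_eq_square sum_distrib_left algebra_simps)

lemma qform_disjoint_union:
  assumes "pair_graph A" "pair_graph B"
  shows "qform (parcs (disjoint_union A B)) z = qform (parcs A) (\<lambda>p. z (Inl p)) + qform (parcs B) (\<lambda>p. z (Inr p))"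
proof -
  have "qform (parcs (disjoint_union A B)) z =
      qform (map_prod Inl Inl ` parcs A) z + qform (map_prod Inr Inr ` parcs B) z"
    unfolding disjoint_union_def qform_def using pair_graph_fin[OF assms(1)] pair_graph_fin[OF assms(2)]
    by (simp, intro sum.union_disjoint) auto
  also have "qform (map_prod Inl Inl ` parcs A) z = qform (parcs A) (\<lambda>p. z (Inl p))"
    using pair_graph_fin[OF assms(1)] by (intro qform_image[of _ "pverts A"]) auto
  also have "qform (map_prod Inr Inr ` parcs B) z = qform (parcs B) (\<lambda>p. z (Inr p))"
    using pair_graph_fin[OF assms(2)] by (intro qform_image[of _ "pverts B"]) auto
  finally show ?thesis .
qed

lemma qform_vertex_join:
  assumes A: "pair_graph A" and B: "pair_graph B" and S: "S \<subseteq> pverts A" "T \<subseteq> pverts B" and z: "z None = 0"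
  shows "qform (parcs (vertex_join A S T B)) z =
    qform (parcs A) (\<lambda>p. z (Some (Inl p))) + qform (parcs B) (\<lambda>p. z (Some (Inr p)))"
proof -
  let ?D = "parcs (disjoint_union A B)"
  have fin: "finite (parcs (vertex_join A S T B))"
    using pair_graph_fin[OF pair_graph_vertex_join[OF assms(1-4)]] by simp
  have "qform (parcs (vertex_join A S T B)) z = qform (map_prod Some Some ` ?D) z"
    unfolding qform_def using fin
    by (intro sum.mono_neutral_right) (auto simp: vertex_join_def z)
  also have "\<dots> = qform ?D (\<lambda>p. z (Some p))"
    by (intro qform_image[of _ UNIV]) auto
  finally show ?thesis by (simp add: qform_disjoint_union[OF A B])
qed

lemma qform_edge_join:
  assumes A: "pair_graph A" and B: "pair_graph B"
  shows "qform (parcs (edge_join A u v B)) z =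
    qform (parcs A) (\<lambda>p. z (Inl p)) + qform (parcs B) (\<lambda>p. z (Inr p)) + 2 * z (Inl u) * z (Inr v)"
proof -
  let ?D = "parcs (disjoint_union A B)"
  have fin: "finite ?D"
    using pair_graph_fin[OF A] pair_graph_fin[OF B] by (simp add: disjoint_union_def)
  have "qform (parcs (edge_join A u v B)) z = qform ?D z + qform {(Inl u, Inr v), (Inr v, Inl u)} z"
  proof -
    have arcs: "parcs (edge_join A u v B) = ?D \<union> {(Inl u, Inr v), (Inr v, Inl u)}"
      by (simp add: edge_join_def)
    show ?thesis
      unfolding qform_def arcs using fin by (intro sum.union_disjoint) (auto simp: disjoint_union_def)
  qed
  moreover have "qform {(Inl u, Inr v), (Inr v, Inl u)} z = 2 * z (Inl u) * z (Inr v)"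
    by (simp add: qform_def)
  ultimately show ?thesis by (simp add: qform_disjoint_union[OF A B])
qed

lemma sum_sum_type:
  assumes "finite A" "finite B"
  shows "(\<Sum>v\<in>A <+> B. f v) = (\<Sum>p\<in>A. f (Inl p)) + (\<Sum>p\<in>B. f (Inr p))"
  using assms by (simp add: sum.Plus comp_def)

section \<open>The extremal graphs attain the bounds\<close>

text \<open>The Perron vectors of the two copies, extended by 0, span a plane with constant Rayleigh
  quotient. All arcs at the new vertex are invisible there, whatever \<open>S\<close> and
  \<open>T\<close> are.\<close>

lemma vertex_join_eigenvalue_ge:
  assumes S: "S \<subseteq> pverts (turan2 m)" "T \<subseteq> pverts (turan2 m)" and m: "2 \<le> m"
  shows "sqrt (real (m div 2) * real ((m + 1) div 2)) \<le> graph_eigenvalue 2 (vertex_join (turan2 m) S T (turan2 m))"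
    (is "?s \<le> graph_eigenvalue 2 ?H")
proof -
  let ?T = "turan2 m"
  have fin: "finite (pverts ?T)" using pair_graph_fin[OF pair_graph_turan2] by simp
  obtain h where h: "qform (parcs ?T) h = ?s * (\<Sum>v\<in>pverts ?T. (h v)\<^sup>2)"
    "0 < (\<Sum>v\<in>pverts ?T. (h v)\<^sup>2)"
    using turan2_test_vector[OF m] .
  let ?h2 = "\<Sum>v\<in>pverts ?T. (h v)\<^sup>2"
  define x where "x v = (case v of Some (Inl p) \<Rightarrow> h p | _ \<Rightarrow> 0)" for v :: "((nat + nat) + (nat + nat)) option"
  define y where "y v = (case v of Some (Inr p) \<Rightarrow> h p | _ \<Rightarrow> 0)" for v :: "((nat + nat) + (nat + nat)) option"
  have norm: "(\<Sum>v\<in>pverts ?H. (a * x v + b * y v)\<^sup>2) = (a\<^sup>2 + b\<^sup>2) * ?h2" for a b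
  proof -
    have "(\<Sum>v\<in>pverts ?H. (a * x v + b * y v)\<^sup>2) =
        (\<Sum>v\<in>pverts ?T <+> pverts ?T. (a * x (Some v) + b * y (Some v))\<^sup>2)"
      unfolding pverts_joins using fin
      by (subst sum.insert) (auto simp: x_def y_def sum.reindex comp_def)
    also have "\<dots> = (\<Sum>p\<in>pverts ?T. (a * h p)\<^sup>2) + (\<Sum>p\<in>pverts ?T. (b * h p)\<^sup>2)"
      unfolding sum_sum_type[OF fin fin] by (simp add: x_def y_def)
    finally show ?thesis by (simp add: power_mult_distrib distrib_right flip: sum_distrib_left)
  qed
  have qf: "qform (parcs ?H) (\<lambda>v. a * x v + b * y v) = (a\<^sup>2 + b\<^sup>2) * (?s * ?h2)" for a b
    by (subst qform_vertex_join[OF pair_graph_turan2 pair_graph_turan2 S])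
      (simp_all add: x_def y_def qform_scale h(1) distrib_right)
  have "card (pverts ?H) = 2 * m + 1"
    unfolding pverts_joins using fin by (subst card_insert_disjoint) (auto simp: card_image card_Plus card_turan2)
  then have c2: "2 \<le> card (pverts ?H)" using m by simp
  show ?thesis
  proof (rule second_eigenvalue_ge[OF pair_graph_vertex_join[OF pair_graph_turan2 pair_graph_turan2 S] c2])
    fix a b :: real
    show "a = 0 \<and> b = 0" if "(\<Sum>v\<in>pverts ?H. (a * x v + b * y v)\<^sup>2) = 0"
      using that h(2) unfolding norm by (simp add: sum_power2_eq_zero_iff)
    show "?s * (\<Sum>v\<in>pverts ?H. (a * x v + b * y v)\<^sup>2) \<le> qform (parcs ?H) (\<lambda>v. a * x v + b * y v)"
      unfolding norm qf by (simp add: algebra_simps)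
  qed
qed

lemma loop_test_vector:
  fixes s t :: nat and \<theta> :: real
  assumes fin: "finite A" "finite B" and disj: "A \<inter> B = {}" and card: "card A = t" "card B = s" and u: "u \<in> A"
    and s: "0 < s" and th: "0 < \<theta>" "(\<theta> + 1) * (s * t - \<theta>\<^sup>2) = s"
  obtains z where "qform (cbip A B) z = \<theta> * (\<Sum>v\<in>A \<union> B. (z v)\<^sup>2) + (z u)\<^sup>2" "z u = s * \<theta>"
    "0 < (\<Sum>v\<in>A \<union> B. (z v)\<^sup>2)"
proof -
  \<comment> \<open>The top eigenvector of the looped graph with denominators cleared.\<close>
  define z where "z v = (if v \<in> A then if v = u then s * \<theta> else s * (\<theta> + 1) else \<theta> * (\<theta> + 1))" for v
  have t: "1 \<le> t" using card u fin by (metis One_nat_def Suc_leI card_gt_0_iff empty_iff)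
  have zu: "z u = s * \<theta>" using u by (simp add: z_def)
  have "v \<notin> A" if "v \<in> B" for v using that disj by auto
  then have B: "(\<Sum>v\<in>B. z v) = s * (\<theta> * (\<theta> + 1))" "(\<Sum>v\<in>B. (z v)\<^sup>2) = s * (\<theta> * (\<theta> + 1))\<^sup>2"
    using card by (auto simp: z_def)
  have "(\<Sum>v\<in>A - {u}. z v) = (\<Sum>v\<in>A - {u}. s * (\<theta> + 1))"
    by (intro sum.cong) (auto simp: z_def)
  then have A: "(\<Sum>v\<in>A. z v) = s * \<theta> + (real t - 1) * (s * (\<theta> + 1))"
    using fin u card t zu by (simp add: sum.remove of_nat_diff)
  have "(\<Sum>v\<in>A - {u}. (z v)\<^sup>2) = (\<Sum>v\<in>A - {u}. (s * (\<theta> + 1))\<^sup>2)"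
    by (intro sum.cong) (auto simp: z_def)
  then have A2: "(\<Sum>v\<in>A. (z v)\<^sup>2) = (s * \<theta>)\<^sup>2 + (real t - 1) * (s * (\<theta> + 1))\<^sup>2"
    using fin u card t zu by (simp add: sum.remove of_nat_diff)
  \<comment> \<open>The eigenvalue equation at a vertex of \<open>B\<close>; it is the defining
    equation of \<open>\<theta>\<close> multiplied out.\<close>
  have key: "s * \<theta> + (real t - 1) * (s * (\<theta> + 1)) = \<theta> * (\<theta> * (\<theta> + 1))"
    using th(2) by (simp add: algebra_simps power2_eq_square)
  have q: "qform (cbip A B) z = 2 * (\<theta> * (\<theta> * (\<theta> + 1)) * (s * (\<theta> * (\<theta> + 1))))"
    unfolding qform_cbip[OF fin disj] A B key ..
  have n: "(\<Sum>v\<in>A \<union> B. (z v)\<^sup>2) = (s * \<theta>)\<^sup>2 + (real t - 1) * (s * (\<theta> + 1))\<^sup>2 + s * (\<theta> * (\<theta> + 1))\<^sup>2"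
    using fin disj by (simp add: sum.union_disjoint A2 B)
  have "\<theta> * ((s * \<theta>)\<^sup>2 + (real t - 1) * (s * (\<theta> + 1))\<^sup>2 + s * (\<theta> * (\<theta> + 1))\<^sup>2) + (s * \<theta>)\<^sup>2 =
      (s * \<theta> + (real t - 1) * (s * (\<theta> + 1))) * (s * \<theta> * (\<theta> + 1)) + \<theta> * (s * (\<theta> * (\<theta> + 1))\<^sup>2)"
    by (simp add: algebra_simps power2_eq_square)
  also have "\<dots> = qform (cbip A B) z"
    unfolding key q by (simp add: algebra_simps power2_eq_square)
  finally have "qform (cbip A B) z = \<theta> * (\<Sum>v\<in>A \<union> B. (z v)\<^sup>2) + (z u)\<^sup>2"
    unfolding n zu by simp
  moreover have "0 < (\<Sum>v\<in>A \<union> B. (z v)\<^sup>2)"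
    using fin u s th(1) zu by (intro sum_pos2[of _ u]) auto
  ultimately show ?thesis using that zu by blast
qed

text \<open>In each copy the form exceeds \<open>\<theta>\<close> times the norm by the square of
  the entry at the attached vertex. These entries agree, so together with the joining edge the
  excess is a multiple of \<open>(a + b)\<^sup>2\<close>. The two copies may be split differently,
  since \<open>u\<close> and \<open>v\<close> can lie in opposite classes when the parts have equal
  size.\<close>

lemma edge_join_eigenvalue_ge:
  fixes s t m :: nat and \<theta> :: real
  assumes T: "pverts (turan2 m) = A \<union> B" "parcs (turan2 m) = cbip A B"
      "pverts (turan2 m) = A' \<union> B'" "parcs (turan2 m) = cbip A' B'"
    and disj: "A \<inter> B = {}" "A' \<inter> B' = {}" and card: "card A = t" "card B = s" "card A' = t" "card B' = s"
    and u: "u \<in> A" and v: "v \<in> A'"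
    and s: "0 < s" and th: "0 < \<theta>" "(\<theta> + 1) * (s * t - \<theta>\<^sup>2) = s"
  shows "\<theta> \<le> graph_eigenvalue 2 (edge_join (turan2 m) u v (turan2 m))" (is "\<theta> \<le> graph_eigenvalue 2 ?H")
proof -
  let ?T = "turan2 m"
  have finT: "finite (pverts ?T)" using pair_graph_fin[OF pair_graph_turan2] by simp
  have fin: "finite A" "finite B" "finite A'" "finite B'" using finT T(1) T(3) by (metis finite_Un)+
  obtain z where z: "qform (cbip A B) z = \<theta> * (\<Sum>v\<in>A \<union> B. (z v)\<^sup>2) + (z u)\<^sup>2" "z u = s * \<theta>"
    "0 < (\<Sum>v\<in>A \<union> B. (z v)\<^sup>2)"
    by (rule loop_test_vector[OF fin(1,2) disj(1) card(1,2) u s th])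
  obtain z' where z': "qform (cbip A' B') z' = \<theta> * (\<Sum>v\<in>A' \<union> B'. (z' v)\<^sup>2) + (z' v)\<^sup>2" "z' v = s * \<theta>"
    "0 < (\<Sum>v\<in>A' \<union> B'. (z' v)\<^sup>2)"
    by (rule loop_test_vector[OF fin(3,4) disj(2) card(3,4) v s th])
  define c where "c = (\<Sum>v\<in>pverts ?T. (z v)\<^sup>2)"
  define d where "d = (\<Sum>v\<in>pverts ?T. (z' v)\<^sup>2)"
  have q: "qform (parcs ?T) z = \<theta> * c + (s * \<theta>)\<^sup>2" "0 < c"
    using z unfolding c_def T(1,2) by simp_all
  have q': "qform (parcs ?T) z' = \<theta> * d + (s * \<theta>)\<^sup>2" "0 < d"
    using z' unfolding d_def T(3,4) by simp_all
  define x where "x v = (case v of Inl p \<Rightarrow> z p | Inr p \<Rightarrow> 0)" for v :: "(nat + nat) + (nat + nat)"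
  define y where "y v = (case v of Inr p \<Rightarrow> z' p | Inl p \<Rightarrow> 0)" for v :: "(nat + nat) + (nat + nat)"
  have norm: "(\<Sum>v\<in>pverts ?H. (a * x v + b * y v)\<^sup>2) = a\<^sup>2 * c + b\<^sup>2 * d" for a b
    unfolding pverts_joins sum_sum_type[OF finT finT]
    by (simp add: x_def y_def power_mult_distrib c_def d_def flip: sum_distrib_left)
  have qf: "qform (parcs ?H) (\<lambda>v. a * x v + b * y v) =
      a\<^sup>2 * (\<theta> * c + (s * \<theta>)\<^sup>2) + b\<^sup>2 * (\<theta> * d + (s * \<theta>)\<^sup>2) + 2 * a * b * (s * \<theta>)\<^sup>2" for a b
    unfolding qform_edge_join[OF pair_graph_turan2 pair_graph_turan2]
    by (simp add: x_def y_def qform_scale q q' z(2) z'(2) power2_eq_square)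
  have pgH: "pair_graph ?H"
    using u v T(1,3) by (intro pair_graph_edge_join pair_graph_turan2) auto
  have "card (pverts ?H) = m + m"
    unfolding pverts_joins using finT by (simp add: card_Plus card_turan2)
  moreover have "1 \<le> m" using card_turan2[of m] u T(1) finT by (metis One_nat_def Suc_leI UnCI card_gt_0_iff empty_iff)
  ultimately have c2: "2 \<le> card (pverts ?H)" by simp
  show ?thesis
  proof (rule second_eigenvalue_ge[OF pgH c2])
    fix a b :: real
    show "a = 0 \<and> b = 0" if "(\<Sum>v\<in>pverts ?H. (a * x v + b * y v)\<^sup>2) = 0"
    proof -
      have "0 \<le> a\<^sup>2 * c" "0 \<le> b\<^sup>2 * d" using q(2) q'(2) by simp_all
      then have "a\<^sup>2 * c = 0" "b\<^sup>2 * d = 0" using that unfolding norm by linarith+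
      then show ?thesis using q(2) q'(2) by simp
    qed
    have "0 \<le> (a + b)\<^sup>2 * (s * \<theta>)\<^sup>2" by simp
    also have "\<dots> = a\<^sup>2 * (s * \<theta>)\<^sup>2 + b\<^sup>2 * (s * \<theta>)\<^sup>2 + 2 * a * b * (s * \<theta>)\<^sup>2"
      by (simp add: power2_sum distrib_right)
    finally show "\<theta> * (\<Sum>v\<in>pverts ?H. (a * x v + b * y v)\<^sup>2) \<le> qform (parcs ?H) (\<lambda>v. a * x v + b * y v)"
      unfolding norm qf by (simp add: distrib_left ac_simps)
  qed
qed

lemma vertex_join_iso:
  assumes G: "pair_graph G" and conn: "Digraph_Component.connected (with_proj G)"
    and P: "turan_copy (parcs G) m P" and N: "turan_copy (parcs G) m N" and m: "2 \<le> m"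
    and disj: "P \<inter> N = {}" and no: "parcs G \<inter> P \<times> N = {}" and V: "pverts G = insert z (P \<union> N)" "z \<notin> P \<union> N"
  shows "\<exists>H\<in>join_family (turan2 m) (turan2 m). digraph_iso (with_proj G) (with_proj H)"
proof -
  let ?T = "turan2 m" and ?E = "parcs G"
  have symE: "sym ?E" and irrE: "irrefl ?E" using G by (auto simp: pair_graph_iff)
  obtain f where f: "bij_betw f P (pverts ?T)"
    "\<And>p q. p \<in> P \<Longrightarrow> q \<in> P \<Longrightarrow> (p, q) \<in> ?E \<longleftrightarrow> (f p, f q) \<in> parcs ?T"
    by (rule turan_copy_bij[OF P m]) (rule that; assumption)
  obtain g where g: "bij_betw g N (pverts ?T)"
    "\<And>p q. p \<in> N \<Longrightarrow> q \<in> N \<Longrightarrow> (p, q) \<in> ?E \<longleftrightarrow> (g p, g q) \<in> parcs ?T"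
    by (rule turan_copy_bij[OF N m]) (rule that; assumption)
  define S where "S = f ` {v \<in> P. (z, v) \<in> ?E}"
  define S' where "S' = g ` {v \<in> N. (z, v) \<in> ?E}"
  have S: "S \<subseteq> pverts ?T" "S' \<subseteq> pverts ?T" using f(1) g(1) by (auto simp: S_def S'_def bij_betw_def)
  have memS: "f p \<in> S \<longleftrightarrow> (z, p) \<in> ?E" if "p \<in> P" for p
    using f(1) that by (auto simp: S_def bij_betw_def inj_on_def)
  have memS': "g p \<in> S' \<longleftrightarrow> (z, p) \<in> ?E" if "p \<in> N" for p
    using g(1) that by (auto simp: S'_def bij_betw_def inj_on_def)
  define H where "H = vertex_join ?T S S' ?T"
  define F where "F v = (if v \<in> P then Some (Inl (f v)) else if v \<in> N then Some (Inr (g v)) else None)" for v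
  have FP: "F v = Some (Inl (f v))" if "v \<in> P" for v using that by (simp add: F_def)
  have FN: "F v = Some (Inr (g v))" if "v \<in> N" for v using that disj by (auto simp: F_def)
  have Fz: "F z = None" using V by (simp add: F_def)
  have sw: "(p, q) \<in> ?E \<longleftrightarrow> (q, p) \<in> ?E" for p q using symE by (auto simp: sym_def)
  have pgH: "pair_graph H" unfolding H_def by (intro pair_graph_vertex_join pair_graph_turan2 S)
  have iso: "digraph_iso (with_proj G) (with_proj H)"
  proof (rule digraph_iso_pairI[OF G])
    have "bij_betw F P (Some ` Inl ` pverts ?T)"
    proof -
      have "F ` P = Some ` Inl ` f ` P" unfolding image_image using FP by (rule image_cong[OF refl])
      moreover have "inj_on F P" using bij_betw_imp_inj_on[OF f(1)] FP by (auto simp: inj_on_def)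
      ultimately show ?thesis using bij_betw_imp_surj_on[OF f(1)] by (simp add: bij_betw_def)
    qed
    moreover have "bij_betw F N (Some ` Inr ` pverts ?T)"
    proof -
      have "F ` N = Some ` Inr ` g ` N" unfolding image_image using FN by (rule image_cong[OF refl])
      moreover have "inj_on F N" using bij_betw_imp_inj_on[OF g(1)] FN by (auto simp: inj_on_def)
      ultimately show ?thesis using bij_betw_imp_surj_on[OF g(1)] by (simp add: bij_betw_def)
    qed
    ultimately have "bij_betw F (P \<union> N) (Some ` Inl ` pverts ?T \<union> Some ` Inr ` pverts ?T)"
      by (rule bij_betw_combine) auto
    moreover have "bij_betw F {z} {None}" using Fz by (simp add: bij_betw_def)
    ultimately have "bij_betw F (P \<union> N \<union> {z}) (Some ` Inl ` pverts ?T \<union> Some ` Inr ` pverts ?T \<union> {None})"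
      by (rule bij_betw_combine) auto
    moreover have "Some ` Inl ` pverts ?T \<union> Some ` Inr ` pverts ?T \<union> {None} = pverts H"
      by (auto simp: H_def pverts_joins)
    moreover have "P \<union> N \<union> {z} = pverts G" using V by auto
    ultimately show "bij_betw F (pverts G) (pverts H)" by simp
    show "parcs H \<subseteq> pverts H \<times> pverts H" using pair_graph_fin[OF pgH] by simp
    fix p q assume pq: "p \<in> pverts G" "q \<in> pverts G"
    have no': "(p, q) \<notin> ?E" "(q, p) \<notin> ?E" if "p \<in> P" "q \<in> N" for p q
      using no that sw by blast+
    have zz: "(z, z) \<notin> ?E" using irrE by (simp add: irrefl_def)
    consider "p \<in> P" | "p \<in> N" | "p = z" using pq V by auto
    then show "(p, q) \<in> ?E \<longleftrightarrow> (F p, F q) \<in> parcs H"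
    proof cases
      case 1
      consider "q \<in> P" | "q \<in> N" | "q = z" using pq V by auto
      then show ?thesis
        by cases (use 1 f(2) no' memS sw[of p z] in \<open>auto simp: H_def FP FN Fz\<close>)
    next
      case 2
      consider "q \<in> P" | "q \<in> N" | "q = z" using pq V by auto
      then show ?thesis
        by cases (use 2 g(2) no' memS' sw[of p z] in \<open>auto simp: H_def FP FN Fz\<close>)
    next
      case 3
      consider "q \<in> P" | "q \<in> N" | "q = z" using pq V by auto
      then show ?thesis
        by cases (use 3 memS memS' zz in \<open>auto simp: H_def FP FN Fz\<close>)
    qed
  qed
  then obtain h where h: "pre_digraph.digraph_isomorphism (with_proj G) h" "with_proj H = app_iso h (with_proj G)"
    by (auto simp: digraph_iso_def)
  \<comment> \<open>Membership in \<open>join_family\<close> requires connectedness, which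
    \<open>H\<close> inherits from \<open>G\<close>.\<close>
  have "Digraph_Component.connected (with_proj H)"
    unfolding h(2) by (rule wf_digraph.connectedI_app_iso[OF pair_graph_wf[OF G] conn h(1)])
  then have "H \<in> join_family ?T ?T"
    using S unfolding join_family_def H_def by blast
  then show ?thesis using iso by blast
qed

context sgraph
begin

text \<open>Equality makes \<open>P\<close> a Turan graph on exactly \<open>m\<close> vertices
  without arcs to \<open>N\<close>. As the graph is connected, some entry must be 0, so
  \<open>N\<close> also has at most \<open>m\<close> vertices and the same result applies to
  \<open>- x\<close>. The count then leaves room for a single zero.\<close>

lemma odd_extremal_structure:
  fixes x :: "'a \<Rightarrow> real"
  assumes conn: "\<And>S. S \<subseteq> V \<Longrightarrow> S \<noteq> {} \<Longrightarrow> (\<And>u v. (u, v) \<in> E \<Longrightarrow> u \<in> S \<Longrightarrow> v \<in> S) \<Longrightarrow> S = V"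
    and eig: "\<And>v. v \<in> V \<Longrightarrow> (\<Sum>w\<in>E `` {v}. x w) = r * x v"
    and nc: "\<not> has_cycle E (2 * k + 1)" and k: "1 \<le> k" "580 * k < m"
  defines "P \<equiv> {v \<in> V. 0 < x v}" and "N \<equiv> {v \<in> V. x v < 0}"
  assumes P: "P \<noteq> {}" "card P \<le> m" and N: "N \<noteq> {}" and card: "card V = 2 * m + 1"
    and r: "r = sqrt (real (m div 2) * real ((m + 1) div 2))"
  shows "turan_copy E m P \<and> turan_copy E m N \<and> E \<inter> P \<times> N = {} \<and> (\<exists>z. V = insert z (P \<union> N) \<and> z \<notin> P \<union> N)"
proof -
  have mV: "m \<le> card V" using card by simp
  have sub: "P \<subseteq> V" "N \<subseteq> V" "P \<inter> N = {}" by (auto simp: P_def N_def)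
  have fin: "finite P" "finite N" using finite_subset[OF sub(1) finV] finite_subset[OF sub(2) finV] by auto
  have cP: "turan_copy E m P" "E \<inter> P \<times> N = {}"
    using positive_part_turan(2)[OF eig nc k] P mV r unfolding P_def N_def by blast+
  have cardP: "card P = m" using turan_copy_card[OF cP(1)] .
  have "V \<noteq> P \<union> N"
  proof
    assume V: "V = P \<union> N"
    have "P = V"
    proof (rule conn)
      fix u v assume "(u, v) \<in> E" "u \<in> P"
      then show "v \<in> P" using cP(2) EV V by blast
    qed (use sub P in auto)
    then show False using sub N by auto
  qed
  then obtain z where z: "z \<in> V" "z \<notin> P \<union> N" using sub by auto
  have "card (insert z (P \<union> N)) \<le> card V" using z sub finV by (intro card_mono) auto
  moreover have "card (insert z (P \<union> N)) = Suc (card P + card N)"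
    using z fin sub(3) by (simp add: card_Un_disjoint)
  ultimately have cN: "card N \<le> m" using cardP card by simp
  have Nm: "{v \<in> V. 0 < - x v} = N" by (auto simp: N_def)
  have "turan_copy E m {v \<in> V. 0 < - x v} \<and> E \<inter> {v \<in> V. 0 < - x v} \<times> {v \<in> V. - x v < 0} = {}"
  proof (rule positive_part_turan(2)[OF _ nc k _ _ mV r])
    fix v assume "v \<in> V"
    then show "(\<Sum>w\<in>E `` {v}. - x w) = r * - x v" using eig by (simp add: sum_negf)
  qed (use Nm N cN in auto)
  then have tN: "turan_copy E m N" unfolding Nm by simp
  have "card (insert z (P \<union> N)) = card V"
    using z fin sub(3) turan_copy_card[OF tN] cardP card by (simp add: card_Un_disjoint)
  then have "insert z (P \<union> N) = V" using z sub finV by (intro card_subset_eq) auto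
  then show ?thesis using cP tN z by blast
qed

text \<open>Applied with one vertex less than half the order, this shows that in the even case
  neither sign class can be smaller than half.\<close>

lemma positive_part_small:
  fixes x :: "'a \<Rightarrow> real"
  assumes eig: "\<And>v. v \<in> V \<Longrightarrow> (\<Sum>w\<in>E `` {v}. x w) = r * x v"
    and nc: "\<not> has_cycle E (2 * k + 1)" and k: "1 \<le> k" "580 * k \<le> m"
  defines "P \<equiv> {v \<in> V. 0 < x v}"
  assumes P: "P \<noteq> {}" "card P \<le> m" and m: "m \<le> card V"
  shows "r \<le> m / 2"
proof -
  define N where "N = {v \<in> V. x v < 0}"
  have PV: "P \<subseteq> V" by (auto simp: P_def)
  then have finP: "finite P" using finV finite_subset by auto
  have pos: "0 < x v" if "v \<in> P" for v using that by (simp add: P_def)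
  have S: "0 < (\<Sum>v\<in>P. (x v)\<^sup>2)" using P(1) finP by (intro sum_pos zero_less_power pos) auto
  have "(\<Sum>(u, w)\<in>E \<inter> P \<times> N. x u * x w) \<le> 0"
    by (intro sum_nonpos) (auto simp: P_def N_def intro!: mult_nonneg_nonpos)
  then have "r * (\<Sum>v\<in>P. (x v)\<^sup>2) \<le> qform (E \<inter> P \<times> P) x"
    using positive_part_identity[OF eig] unfolding P_def N_def by simp
  also have "\<dots> \<le> m / 2 * (\<Sum>v\<in>P. (x v)\<^sup>2)" by (rule part_bound[OF PV P(2) m nc k])
  finally show ?thesis using S by simp
qed

text \<open>A squeeze: \<open>r\<close> times the mass of \<open>P\<close> is at most the form on
  \<open>P\<close> minus \<open>(x u)\<^sup>2\<close>, hence at most \<open>\<theta>\<close> times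
  this mass. Since \<open>\<theta> \<le> r\<close>, equality holds in each intermediate estimate,
  and each equality contributes one item of the conclusion.\<close>

lemma even_extremal_half:
  fixes s t :: nat and x :: "'a \<Rightarrow> real" and \<theta> :: real
  assumes eig: "\<And>v. v \<in> V \<Longrightarrow> (\<Sum>w\<in>E `` {v}. x w) = r * x v"
    and nc: "\<not> has_cycle E (2 * k + 1)" and k: "1 \<le> k" "580 * k < m"
  defines "P \<equiv> {v \<in> V. 0 < x v}" and "N \<equiv> {v \<in> V. x v < 0}"
  assumes P: "card P = m" and uv: "(u, v) \<in> E" "u \<in> P" "v \<in> N" and le: "x u \<le> - x v"
    and st: "s \<le> t" "t \<le> s + 1" "0 < s" "s + t = m"
    and th: "0 < \<theta>" "(\<theta> + 1) * (s * t - \<theta>\<^sup>2) = s" "s < \<theta> + 1" "m / 2 - 1 / 40 < \<theta>"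
    and r: "\<theta> \<le> r"
  shows "r = \<theta> \<and> - x v = x u \<and> E \<inter> P \<times> N = {(u, v)} \<and>
    (\<exists>A B. finite A \<and> finite B \<and> A \<inter> B = {} \<and> A \<union> B = P \<and> E \<inter> P \<times> P = cbip A B \<and>
      card A = t \<and> card B = s \<and> u \<in> A)"
proof -
  have PV: "P \<subseteq> V" by (auto simp: P_def)
  then have finP: "finite P" using finV finite_subset by auto
  have mV: "m \<le> card V" using P card_mono[OF finV PV] by simp
  have pos: "0 < x v" if "v \<in> P" for v using that by (simp add: P_def)
  have S: "0 < (\<Sum>v\<in>P. (x v)\<^sup>2)" using uv finP by (intro sum_pos zero_less_power pos) auto
  have finE: "finite (E \<inter> P \<times> N)"
    using finV by (intro finite_Int disjI2 finite_cartesian_product) (auto simp: P_def N_def)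
  have neg: "x p * x q < 0" if "(p, q) \<in> E \<inter> P \<times> N" for p q
    using that by (auto simp: P_def N_def mult_pos_neg)
  let ?c = "\<Sum>(p, q)\<in>E \<inter> P \<times> N. x p * x q"
  let ?c' = "\<Sum>(p, q)\<in>E \<inter> P \<times> N - {(u, v)}. x p * x q"
  \<comment> \<open>The arc from \<open>u\<close> to \<open>v\<close> is split off to play the loop;
    all other arcs from \<open>P\<close> to \<open>N\<close> only lower the sum.\<close>
  have "?c = (case (u, v) of (p, q) \<Rightarrow> x p * x q) + ?c'" using finE uv by (intro sum.remove) auto
  then have c: "?c = x u * x v + ?c'" by simp
  have c': "?c' \<le> 0" using neg by (intro sum_nonpos) (auto intro: less_imp_le)
  have xu: "0 < x u" using pos uv by simp
  have uu: "(x u)\<^sup>2 \<le> - (x u * x v)"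
    using mult_left_mono[OF le less_imp_le[OF xu]] by (simp add: power2_eq_square)
  have id: "qform (E \<inter> P \<times> P) x = r * (\<Sum>v\<in>P. (x v)\<^sup>2) - ?c"
    using positive_part_identity[OF eig] unfolding P_def N_def by blast
  have rS: "\<theta> * (\<Sum>v\<in>P. (x v)\<^sup>2) \<le> r * (\<Sum>v\<in>P. (x v)\<^sup>2)" using r S by (intro mult_right_mono) auto
  have "bipartite (E \<inter> P \<times> P)"
  proof (rule ccontr)
    assume nb: "\<not> ?thesis"
    have "qform (E \<inter> P \<times> P) x \<le> (m / 2 - 1 / 40) * (\<Sum>v\<in>P. (x v)\<^sup>2)"
      by (rule part_stability[OF PV _ mV nc k nb]) (use P in simp)
    moreover have "\<dots> < \<theta> * (\<Sum>v\<in>P. (x v)\<^sup>2)" using th(4) S by (intro mult_strict_right_mono)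
    moreover have "0 < (x u)\<^sup>2" using xu by simp
    ultimately show False using id rS c c' uu by linarith
  qed
  \<comment> \<open>The sides are named so that the looped vertex \<open>u\<close> lies in
    \<open>A\<close>.\<close>
  then obtain A B where AB: "finite A" "finite B" "A \<inter> B = {}" "A \<union> B = P" "E \<inter> P \<times> P \<subseteq> cbip A B"
    "card A + card B = card P" "u \<in> A"
  proof -
    obtain A B where AB: "finite A" "finite B" "A \<inter> B = {}" "A \<union> B = P" "E \<inter> P \<times> P \<subseteq> cbip A B"
      "card A + card B = card P"
      by (rule bipartite_part[OF \<open>bipartite (E \<inter> P \<times> P)\<close> PV]) (rule that; assumption)
    show ?thesis
    proof (cases "u \<in> A")
      case True
      then show ?thesis using that[OF AB] by blast
    next
      case False
      then have "u \<in> B" using AB(4) uv(2) by auto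
      then show ?thesis using that[of B A] AB by (simp add: cbip_commute Int_commute Un_commute)
    qed
  qed
  have card: "card A + card B = s + t" using AB(6) P st(4) by simp
  have posAB: "0 < x v" if "v \<in> A \<union> B" for v using pos that AB(4) by simp
  note lb = looped_bipartite_qform_bound[OF AB(1-3,5) card st(1-3) th(1-3), of x u, OF posAB AB(7)]
  have lb1: "qform (E \<inter> P \<times> P) x - (x u)\<^sup>2 \<le> \<theta> * (\<Sum>v\<in>P. (x v)\<^sup>2)"
    using lb(1) AB(4) by simp
  have lb2: "E \<inter> P \<times> P = cbip A B \<and> card A = t \<and> card B = s"
    if "qform (E \<inter> P \<times> P) x - (x u)\<^sup>2 = \<theta> * (\<Sum>v\<in>P. (x v)\<^sup>2)"
    using lb(2) that AB(4) by simp
  have eqs: "qform (E \<inter> P \<times> P) x - (x u)\<^sup>2 = \<theta> * (\<Sum>v\<in>P. (x v)\<^sup>2)"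
    "r * (\<Sum>v\<in>P. (x v)\<^sup>2) = \<theta> * (\<Sum>v\<in>P. (x v)\<^sup>2)" "?c' = 0" "(x u)\<^sup>2 = - (x u * x v)"
    using lb1 id rS c c' uu by linarith+
  have "r = \<theta>" using eqs(2) S by simp
  moreover have "x u * x u = x u * (- x v)" using eqs(4) by (simp add: power2_eq_square)
  then have "- x v = x u" using xu by (subst (asm) mult_cancel_left) auto
  moreover have "E \<inter> P \<times> N - {(u, v)} = {}"
  proof (rule ccontr)
    assume "\<not> ?thesis"
    then have "0 < (\<Sum>(p, q)\<in>E \<inter> P \<times> N - {(u, v)}. - (x p * x q))"
      using finE neg by (intro sum_pos) auto
    moreover have "(\<Sum>(p, q)\<in>E \<inter> P \<times> N - {(u, v)}. - (x p * x q)) = - ?c'"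
      by (simp add: case_prod_unfold sum_negf)
    ultimately show False using eqs(3) by simp
  qed
  then have "E \<inter> P \<times> N = {(u, v)}" using uv by blast
  ultimately show ?thesis using lb2[OF eqs(1)] AB by blast
qed

end

section \<open>The odd and the even case\<close>

lemma odd_cycles_free_imp_no_cycle:
  assumes "pair_graph G" "odd_cycles_free l k G" "1 \<le> k"
  shows "\<not> has_cycle (parcs G) (2 * k + 1)"
  using assms contains_cycle_graph[of G "2 * k + 1"]
  by (auto simp: odd_cycles_free_def forbidden_cycle_lengths_def)

lemma second_eigenvalue_odd:
  assumes G: "pair_graph G" and conn: "Digraph_Component.connected (with_proj G)"
    and nc: "\<not> has_cycle (parcs G) (2 * k + 1)" and k: "1 \<le> k" "580 * k < m"
    and card: "card (pverts G) = 2 * m + 1"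
  defines "\<tau> \<equiv> sqrt (real (m div 2) * real ((m + 1) div 2))"
  shows "graph_eigenvalue 2 G \<le> \<tau>"
    and "graph_eigenvalue 2 G = \<tau> \<longleftrightarrow>
      (\<exists>H\<in>join_family (turan2 m) (turan2 m). digraph_iso (with_proj G) (with_proj H))"
proof -
  interpret sgraph "pverts G" "parcs G" using sgraph_pair_graph[OF G] .
  have m2: "2 \<le> m" using k by linarith
  have c2: "2 \<le> card (pverts G)" using card m2 by simp
  have mV: "m \<le> card (pverts G)" using card by simp
  obtain x where eig: "\<And>v. v \<in> pverts G \<Longrightarrow> (\<Sum>w\<in>parcs G `` {v}. x w) = graph_eigenvalue 2 G * x v"
    and P: "{v \<in> pverts G. 0 < x v} \<noteq> {}" and N: "{v \<in> pverts G. x v < 0} \<noteq> {}"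
    and cP: "card {v \<in> pverts G. 0 < x v} \<le> m"
  proof -
    obtain y where y: "\<And>v. v \<in> pverts G \<Longrightarrow> (\<Sum>w\<in>parcs G `` {v}. y w) = graph_eigenvalue 2 G * y v"
      "{v \<in> pverts G. 0 < y v} \<noteq> {}" "{v \<in> pverts G. y v < 0} \<noteq> {}"
      by (rule second_eigenvector_both_signs[OF G c2 conn]) (rule that; assumption)
    show ?thesis
    proof (cases "card {v \<in> pverts G. 0 < y v} \<le> m")
      case True
      show ?thesis by (rule that[OF y True])
    next
      case False
      let ?P = "{v \<in> pverts G. 0 < y v}" and ?N = "{v \<in> pverts G. y v < 0}"
      have "card ?P + card ?N = card (?P \<union> ?N)"
        using finV by (intro card_Un_disjoint[symmetric]) auto
      also have "\<dots> \<le> card (pverts G)" using finV by (intro card_mono) auto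
      finally have "card ?N \<le> m" using False card by simp
      \<comment> \<open>Negating the eigenvector exchanges the classes, so the positive one may be
        assumed to have at most \<open>m\<close> vertices.\<close>
      then show ?thesis
        by (intro that[of "\<lambda>v. - y v"]) (use y in \<open>simp_all add: sum_negf\<close>)
    qed
  qed
  show "graph_eigenvalue 2 G \<le> \<tau>"
    unfolding \<tau>_def by (rule positive_part_turan(1)[OF eig nc k P cP mV])
  show "graph_eigenvalue 2 G = \<tau> \<longleftrightarrow>
      (\<exists>H\<in>join_family (turan2 m) (turan2 m). digraph_iso (with_proj G) (with_proj H))"
  proof
    assume r: "graph_eigenvalue 2 G = \<tau>"
    have str: "turan_copy (parcs G) m {v \<in> pverts G. 0 < x v} \<and> turan_copy (parcs G) m {v \<in> pverts G. x v < 0} \<and>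
      parcs G \<inter> {v \<in> pverts G. 0 < x v} \<times> {v \<in> pverts G. x v < 0} = {} \<and>
      (\<exists>z. pverts G = insert z ({v \<in> pverts G. 0 < x v} \<union> {v \<in> pverts G. x v < 0}) \<and>
        z \<notin> {v \<in> pverts G. 0 < x v} \<union> {v \<in> pverts G. x v < 0})"
      by (rule odd_extremal_structure[OF connected_closed_set[OF G conn] eig nc k P cP N card r[unfolded \<tau>_def]])
    then obtain z where z: "pverts G = insert z ({v \<in> pverts G. 0 < x v} \<union> {v \<in> pverts G. x v < 0})"
      "z \<notin> {v \<in> pverts G. 0 < x v} \<union> {v \<in> pverts G. x v < 0}" by (elim conjE exE)
    show "\<exists>H\<in>join_family (turan2 m) (turan2 m). digraph_iso (with_proj G) (with_proj H)"
      by (rule vertex_join_iso[OF G conn _ _ m2 _ _ z]) (use str in auto)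
  next
    assume "\<exists>H\<in>join_family (turan2 m) (turan2 m). digraph_iso (with_proj G) (with_proj H)"
    then obtain S T where ST: "S \<subseteq> pverts (turan2 m)" "T \<subseteq> pverts (turan2 m)"
      and iso: "digraph_iso (with_proj G) (with_proj (vertex_join (turan2 m) S T (turan2 m)))"
      by (auto simp: join_family_def)
    have "graph_eigenvalue 2 G = graph_eigenvalue 2 (vertex_join (turan2 m) S T (turan2 m))"
      by (rule second_eigenvalue_iso[OF G pair_graph_vertex_join[OF pair_graph_turan2 pair_graph_turan2 ST] c2 iso])
    then show "graph_eigenvalue 2 G = \<tau>"
      using vertex_join_eigenvalue_ge[OF ST m2] \<open>graph_eigenvalue 2 G \<le> \<tau>\<close> by (simp add: \<tau>_def)
  qed
qed

lemma edge_join_iso: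
  assumes G: "pair_graph G" and V: "pverts G = P \<union> N" "P \<inter> N = {}"
    and no: "parcs G \<inter> P \<times> N = {(u0, v0)}" and u0v0: "u0 \<in> P" "v0 \<in> N"
    and f: "bij_betw f P (pverts A)" "f u0 = u"
      "\<And>p q. p \<in> P \<Longrightarrow> q \<in> P \<Longrightarrow> (p, q) \<in> parcs G \<longleftrightarrow> (f p, f q) \<in> parcs A"
    and g: "bij_betw g N (pverts B)" "g v0 = v"
      "\<And>p q. p \<in> N \<Longrightarrow> q \<in> N \<Longrightarrow> (p, q) \<in> parcs G \<longleftrightarrow> (g p, g q) \<in> parcs B"
    and H: "pair_graph (edge_join A u v B)"
  shows "digraph_iso (with_proj G) (with_proj (edge_join A u v B))" (is "digraph_iso _ (with_proj ?H)")
proof -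
  have symE: "sym (parcs G)" using G by (auto simp: pair_graph_iff)
  define F where "F v = (if v \<in> P then Inl (f v) else Inr (g v))" for v
  have FP: "F v = Inl (f v)" if "v \<in> P" for v using that by (simp add: F_def)
  have FN: "F v = Inr (g v)" if "v \<in> N" for v using that V by (auto simp: F_def)
  have sw: "(p, q) \<in> parcs G \<longleftrightarrow> (q, p) \<in> parcs G" for p q using symE by (auto simp: sym_def)
  have cross: "(p, q) \<in> parcs G \<longleftrightarrow> f p = u \<and> g q = v" if "p \<in> P" "q \<in> N" for p q
  proof -
    have "f p = u \<longleftrightarrow> p = u0" "g q = v \<longleftrightarrow> q = v0"
      using f(1,2) g(1,2) u0v0 that by (auto simp: bij_betw_def inj_on_def)
    then show ?thesis using no that by blast
  qed
  show ?thesis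
  proof (rule digraph_iso_pairI[OF G])
    have "bij_betw F P (Inl ` pverts A)"
    proof -
      have "F ` P = Inl ` f ` P" unfolding image_image using FP by (rule image_cong[OF refl])
      moreover have "inj_on F P" using bij_betw_imp_inj_on[OF f(1)] FP by (auto simp: inj_on_def)
      ultimately show ?thesis using bij_betw_imp_surj_on[OF f(1)] by (simp add: bij_betw_def)
    qed
    moreover have "bij_betw F N (Inr ` pverts B)"
    proof -
      have "F ` N = Inr ` g ` N" unfolding image_image using FN by (rule image_cong[OF refl])
      moreover have "inj_on F N" using bij_betw_imp_inj_on[OF g(1)] FN by (auto simp: inj_on_def)
      ultimately show ?thesis using bij_betw_imp_surj_on[OF g(1)] by (simp add: bij_betw_def)
    qed
    ultimately have "bij_betw F (P \<union> N) (Inl ` pverts A \<union> Inr ` pverts B)"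
      by (rule bij_betw_combine) auto
    moreover have "Inl ` pverts A \<union> Inr ` pverts B = pverts ?H"
      by (simp add: pverts_joins Plus_def)
    ultimately show "bij_betw F (pverts G) (pverts ?H)" using V by simp
    show "parcs ?H \<subseteq> pverts ?H \<times> pverts ?H" using pair_graph_fin[OF H] by simp
    fix p q assume pq: "p \<in> pverts G" "q \<in> pverts G"
    consider "p \<in> P" "q \<in> P" | "p \<in> P" "q \<in> N" | "p \<in> N" "q \<in> P" | "p \<in> N" "q \<in> N" using pq V by auto
    then show "(p, q) \<in> parcs G \<longleftrightarrow> (F p, F q) \<in> parcs ?H"
      by cases (use f(3) g(3) cross sw[of p q] in \<open>auto simp: FP FN\<close>)
  qed
qed

lemma second_eigenvalue_even:
  fixes s t m :: nat
  assumes G: "pair_graph G" and conn: "Digraph_Component.connected (with_proj G)"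
    and nc: "\<not> has_cycle (parcs G) (2 * k + 1)" and k: "1 \<le> k" "580 * k + 1 < m"
    and card: "card (pverts G) = 2 * m"
    and st: "s \<le> t" "t \<le> s + 1" "s + t = m"
    and T: "pverts (turan2 m) = X \<union> Y" "parcs (turan2 m) = cbip X Y"
      "pverts (turan2 m) = X' \<union> Y'" "parcs (turan2 m) = cbip X' Y'"
    and disj: "X \<inter> Y = {}" "X' \<inter> Y' = {}"
    and cards: "card X = t" "card Y = s" "card X' = t" "card Y' = s"
    and u: "u \<in> X" and v: "v \<in> X'"
  shows "graph_eigenvalue 2 G \<le> graph_eigenvalue 2 (edge_join (turan2 m) u v (turan2 m))"
    and "graph_eigenvalue 2 G = graph_eigenvalue 2 (edge_join (turan2 m) u v (turan2 m)) \<longleftrightarrow>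
      digraph_iso (with_proj G) (with_proj (edge_join (turan2 m) u v (turan2 m)))"
proof -
  let ?T = "turan2 m" and ?V = "pverts G" and ?E = "parcs G"
  let ?H = "edge_join ?T u v ?T"
  let ?r = "graph_eigenvalue 2 G"
  interpret sgraph ?V ?E using sgraph_pair_graph[OF G] .
  have m2: "580 \<le> m" using k by linarith
  have s26: "26 \<le> s" using st m2 by linarith
  have s0: "0 < s" using s26 by simp
  have c2: "2 \<le> card ?V" using card m2 by simp
  have finT: "finite (pverts ?T)" using pair_graph_fin[OF pair_graph_turan2] by simp
  have finXY: "finite X" "finite Y" "finite X'" "finite Y'"
    using finT T(1) T(3) by (metis finite_Un)+
  have pgH: "pair_graph ?H"
    using u v T(1,3) by (intro pair_graph_edge_join pair_graph_turan2) auto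
  obtain \<theta> :: real where th: "0 < \<theta>" "(\<theta> + 1) * (s * t - \<theta>\<^sup>2) = s" "s < \<theta> + 1"
    "real (s + t) / 2 - 1 / 40 < \<theta>"
    by (rule loop_eigenvalue_exists[OF st(1,2) s26])
  have th4: "m / 2 - 1 / 40 < \<theta>" using th(4) st(3) by simp
  have lower: "\<theta> \<le> graph_eigenvalue 2 ?H"
    by (rule edge_join_eigenvalue_ge[OF T disj cards u v s0 th(1,2)])
  \<comment> \<open>This suffices for both claims: below \<open>\<theta>\<close> the inequality is
    strict because of \<open>lower\<close>, and equality with the joined graph entails
    \<open>\<theta> \<le> ?r\<close>.\<close>
  have main: "?r = \<theta> \<and> digraph_iso (with_proj G) (with_proj ?H)" if r: "\<theta> \<le> ?r"
  proof -
    obtain y where eig: "\<And>v. v \<in> ?V \<Longrightarrow> (\<Sum>w\<in>?E `` {v}. y w) = ?r * y v"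
      and PNne: "{v \<in> ?V. 0 < y v} \<noteq> {}" "{v \<in> ?V. y v < 0} \<noteq> {}"
      by (rule second_eigenvector_both_signs[OF G c2 conn]) (rule that; assumption)
    have eig': "(\<Sum>w\<in>?E `` {v}. - y w) = ?r * - y v" if "v \<in> ?V" for v
      using eig[OF that] by (simp add: sum_negf)
    define P where "P = {v \<in> ?V. 0 < y v}"
    define N where "N = {v \<in> ?V. y v < 0}"
    have P': "{v \<in> ?V. - y v < 0} = P" and N': "{v \<in> ?V. 0 < - y v} = N"
      by (auto simp: P_def N_def)
    have sub: "P \<subseteq> ?V" "N \<subseteq> ?V" "P \<inter> N = {}" by (auto simp: P_def N_def)
    have fin: "finite P" "finite N" using finite_subset[OF sub(1) finV] finite_subset[OF sub(2) finV] by auto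
    have m1: "580 * k \<le> m - 1" "m - 1 \<le> card ?V" using k card by linarith+
    have th_big: "\<not> ?r \<le> real (m - 1) / 2"
    proof -
      have "real (m - 1) / 2 \<le> m / 2 - 1 / 40" using m2 by (simp add: of_nat_diff divide_simps)
      then show ?thesis using th4 r by linarith
    qed
    \<comment> \<open>A class with at most \<open>m - 1\<close> vertices would give
      \<open>?r \<le> (m - 1) / 2\<close>, below \<open>\<theta>\<close>. Two classes of at least
      \<open>m\<close> vertices fill all \<open>2 * m\<close> of them, so no entry is 0.\<close>
    have "\<not> card P \<le> m - 1"
      using positive_part_small[OF eig nc k(1) m1(1) PNne(1) _ m1(2)] th_big unfolding P_def by blast
    moreover have "\<not> card N \<le> m - 1"
      using positive_part_small[OF eig' nc k(1) m1(1) _ _ m1(2)] th_big PNne(2) unfolding N' N_def[symmetric] by blast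
    moreover have "card P + card N = card (P \<union> N)" using fin sub(3) by (simp add: card_Un_disjoint)
    moreover have "card (P \<union> N) \<le> card ?V" using sub finV by (intro card_mono) auto
    ultimately have cards': "card P = m" "card N = m" "card (P \<union> N) = card ?V" using card by linarith+
    have V: "?V = P \<union> N" using cards'(3) sub finV by (intro card_subset_eq[symmetric]) auto
    obtain u0 v0 where e: "(u0, v0) \<in> ?E" "u0 \<in> P" "v0 \<in> N"
    proof -
      have "\<not> (\<forall>u v. (u, v) \<in> ?E \<longrightarrow> u \<in> P \<longrightarrow> v \<in> P)"
      proof
        assume cl: "\<forall>u v. (u, v) \<in> ?E \<longrightarrow> u \<in> P \<longrightarrow> v \<in> P"
        have "P = ?V" by (rule connected_closed_set[OF G conn sub(1)]) (use PNne(1) cl P_def in auto)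
        then show False using sub PNne(2) N_def by blast
      qed
      then show ?thesis using that EV V by blast
    qed
    have e': "(v0, u0) \<in> ?E" using e symE by (auto simp: sym_def)
    have k': "580 * k < m" using k by simp
    have halfP: "?r = \<theta> \<and> - y v0 = y u0 \<and> ?E \<inter> P \<times> N = {(u0, v0)} \<and>
      (\<exists>A B. finite A \<and> finite B \<and> A \<inter> B = {} \<and> A \<union> B = P \<and> ?E \<inter> P \<times> P = cbip A B \<and>
        card A = t \<and> card B = s \<and> u0 \<in> A)" if "y u0 \<le> - y v0"
      by (rule even_extremal_half[OF eig nc k(1) k' _ e(1) _ _ that st(1,2) s0 st(3) th(1-3) th4 r,
            folded P_def N_def]) (use cards'(1) e(2,3) in simp_all)
    have halfN: "?r = \<theta> \<and> - (- y u0) = - y v0 \<and> ?E \<inter> N \<times> P = {(v0, u0)} \<and>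
      (\<exists>A B. finite A \<and> finite B \<and> A \<inter> B = {} \<and> A \<union> B = N \<and> ?E \<inter> N \<times> N = cbip A B \<and>
        card A = t \<and> card B = s \<and> v0 \<in> A)" if "- y v0 \<le> - (- y u0)"
      by (rule even_extremal_half[OF eig' nc k(1) k' _ e' _ _ that st(1,2) s0 st(3) th(1-3) th4 r,
            unfolded P' N']) (use cards'(2) e(2,3) in simp_all)
    \<comment> \<open>One of the two inequalities holds, and its squeeze already yields equality of
      the absolute values; then the premise of the other half holds as well.\<close>
    have eq: "y u0 = - y v0" using halfP halfN by (cases "y u0 \<le> - y v0") auto
    obtain A B where AB: "finite A" "finite B" "A \<inter> B = {}" "A \<union> B = P" "?E \<inter> P \<times> P = cbip A B"
      "card A = t" "card B = s" "u0 \<in> A"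
      using conjunct2[OF conjunct2[OF conjunct2[OF halfP[OF eq_refl[OF eq]]]]]
      by (elim exE conjE) (rule that; assumption)
    have eq2: "- y v0 \<le> - (- y u0)" using eq by simp
    obtain A' B' where AB': "finite A'" "finite B'" "A' \<inter> B' = {}" "A' \<union> B' = N" "?E \<inter> N \<times> N = cbip A' B'"
      "card A' = t" "card B' = s" "v0 \<in> A'"
      using conjunct2[OF conjunct2[OF conjunct2[OF halfN[OF eq2]]]]
      by (elim exE conjE) (rule that; assumption)
    have cAX: "card A = card X" "card B = card Y" and cAX': "card A' = card X'" "card B' = card Y'"
      by (simp_all only: AB(6,7) AB'(6,7) cards)
    obtain f where f: "bij_betw f (A \<union> B) (X \<union> Y)" "f u0 = u"
      "\<And>p q. p \<in> A \<union> B \<Longrightarrow> q \<in> A \<union> B \<Longrightarrow> (p, q) \<in> cbip A B \<longleftrightarrow> (f p, f q) \<in> cbip X Y"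
      by (rule cbip_bij[OF AB(1,2) finXY(1,2) AB(3) disj(1) cAX AB(8) u]) (rule that; assumption)
    obtain g where g: "bij_betw g (A' \<union> B') (X' \<union> Y')" "g v0 = v"
      "\<And>p q. p \<in> A' \<union> B' \<Longrightarrow> q \<in> A' \<union> B' \<Longrightarrow> (p, q) \<in> cbip A' B' \<longleftrightarrow> (g p, g q) \<in> cbip X' Y'"
      by (rule cbip_bij[OF AB'(1,2) finXY(3,4) AB'(3) disj(2) cAX' AB'(8) v]) (rule that; assumption)
    have cross: "?E \<inter> P \<times> N = {(u0, v0)}" and rt: "?r = \<theta>" using halfP eq by auto
    have "digraph_iso (with_proj G) (with_proj ?H)"
    proof (rule edge_join_iso[where f = f and g = g, OF G V sub(3) cross e(2,3) _ f(2) _ _ g(2) _ pgH])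
      show "bij_betw f P (pverts ?T)" using f(1) AB(4) T(1) by simp
      show "bij_betw g N (pverts ?T)" using g(1) AB'(4) T(3) by simp
      show "(p, q) \<in> ?E \<longleftrightarrow> (f p, f q) \<in> parcs ?T" if "p \<in> P" "q \<in> P" for p q
      proof -
        have "(p, q) \<in> ?E \<longleftrightarrow> (p, q) \<in> cbip A B" using that AB(5) by blast
        then show ?thesis using f(3)[of p q] that AB(4) T(2) by simp
      qed
      show "(p, q) \<in> ?E \<longleftrightarrow> (g p, g q) \<in> parcs ?T" if "p \<in> N" "q \<in> N" for p q
      proof -
        have "(p, q) \<in> ?E \<longleftrightarrow> (p, q) \<in> cbip A' B'" using that AB'(5) by blast
        then show ?thesis using g(3)[of p q] that AB'(4) T(4) by simp
      qed
    qed
    then show ?thesis using rt by simp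
  qed
  show le: "?r \<le> graph_eigenvalue 2 ?H"
    using main lower by (cases "\<theta> \<le> ?r") auto
  show "?r = graph_eigenvalue 2 ?H \<longleftrightarrow> digraph_iso (with_proj G) (with_proj ?H)"
    using main lower second_eigenvalue_iso[OF G pgH c2] by auto
qed

lemma ceiling_quarter: "\<lceil>real (2 * m) / 4\<rceil> = int ((m + 1) div 2)"
proof -
  have "real (2 * m) / 4 \<le> real ((m + 1) div 2)" "real ((m + 1) div 2) - 1 < real (2 * m) / 4"
    by (cases "even m"; auto elim!: evenE oddE simp: field_simps)+
  then show ?thesis by (intro ceiling_unique) auto
qed

theorem theorem3p15:
  fixes G :: "'a pair_pre_digraph" and l k n :: nat
  assumes "1 \<le> l" and "l \<le> k"
    and "pair_graph G"
    and "Digraph_Component.connected (with_proj G)"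
    and "odd_cycles_free l k G"
    and "card (pverts G) = n"
    and "n \<ge> 640 * (2 * k + 1)"
  shows "(odd n \<longrightarrow>
      graph_eigenvalue 2 G \<le> graph_spectral_radius (turan2 ((n - 1) div 2)) \<and>
      (graph_eigenvalue 2 G = graph_spectral_radius (turan2 ((n - 1) div 2)) \<longleftrightarrow>
        (\<exists>H \<in> join_family (turan2 ((n - 1) div 2)) (turan2 ((n - 1) div 2)).
           digraph_iso (with_proj G) (with_proj H)) \<and>
        odd_cycles_free l k G)) \<and>
    (even n \<longrightarrow>
      (\<forall>X \<in> turan2_partition_sets (n div 2). \<forall>Y \<in> turan2_partition_sets (n div 2).
        \<forall>u \<in> X. \<forall>v \<in> Y.
          int (card X) = \<lceil>real n / 4\<rceil> \<longrightarrow> int (card Y) = \<lceil>real n / 4\<rceil> \<longrightarrow>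
          graph_eigenvalue 2 G
            \<le> graph_eigenvalue 2 (edge_join (turan2 (n div 2)) u v (turan2 (n div 2))) \<and>
          (graph_eigenvalue 2 G
            = graph_eigenvalue 2 (edge_join (turan2 (n div 2)) u v (turan2 (n div 2))) \<longleftrightarrow>
           digraph_iso (with_proj G)
             (with_proj (edge_join (turan2 (n div 2)) u v (turan2 (n div 2)))))))"
proof (intro conjI impI ballI)
  have k: "1 \<le> k" using assms(1,2) by simp
  note nc = odd_cycles_free_imp_no_cycle[OF assms(3,5) k]
  {
    assume "odd n"
    define m where "m = (n - 1) div 2"
    have n: "n = 2 * m + 1" using \<open>odd n\<close> by (auto simp: m_def elim!: oddE)
    have m: "580 * k < m" "2 \<le> m" using assms(7) n by auto
    have card: "card (pverts G) = 2 * m + 1" using assms(6) n by simp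
    note odd = second_eigenvalue_odd[OF assms(3,4) nc k m(1) card]
    show "graph_eigenvalue 2 G \<le> graph_spectral_radius (turan2 ((n - 1) div 2))"
      unfolding m_def[symmetric] turan2_spectral_radius[OF m(2)] by (rule odd(1))
    show "graph_eigenvalue 2 G = graph_spectral_radius (turan2 ((n - 1) div 2)) \<longleftrightarrow>
        (\<exists>H \<in> join_family (turan2 ((n - 1) div 2)) (turan2 ((n - 1) div 2)).
           digraph_iso (with_proj G) (with_proj H)) \<and>
        odd_cycles_free l k G"
      unfolding m_def[symmetric] turan2_spectral_radius[OF m(2)] using odd(2) assms(5) by blast
  next
    assume "even n"
    fix X Y u v
    assume X: "X \<in> turan2_partition_sets (n div 2)" and Y: "Y \<in> turan2_partition_sets (n div 2)"
      and u: "u \<in> X" and v: "v \<in> Y"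
      and cX: "int (card X) = \<lceil>real n / 4\<rceil>" and cY: "int (card Y) = \<lceil>real n / 4\<rceil>"
    define m where "m = n div 2"
    have n: "n = 2 * m" using \<open>even n\<close> by (simp add: m_def)
    have m: "580 * k + 1 < m" using assms(7) n by auto
    have card: "card (pverts G) = 2 * m" using assms(6) n by simp
    have cards: "card X = (m + 1) div 2" "card Y = (m + 1) div 2"
      using cX cY unfolding n ceiling_quarter by simp_all
    obtain X' where X': "pverts (turan2 m) = X \<union> X'" "parcs (turan2 m) = cbip X X'" "X \<inter> X' = {}"
      "finite X" "finite X'" "card X + card X' = m"
      using turan2_parts[OF X] unfolding m_def by metis
    obtain Y' where Y': "pverts (turan2 m) = Y \<union> Y'" "parcs (turan2 m) = cbip Y Y'" "Y \<inter> Y' = {}"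
      "finite Y" "finite Y'" "card Y + card Y' = m"
      using turan2_parts[OF Y] unfolding m_def by metis
    have cards': "card X' = m div 2" "card Y' = m div 2" using X'(6) Y'(6) cards by linarith+
    note even = second_eigenvalue_even[OF assms(3,4) nc k m card balanced_halves X'(1,2) Y'(1,2) X'(3) Y'(3)
        cards(1) cards'(1) cards(2) cards'(2) u v]
    show "graph_eigenvalue 2 G \<le> graph_eigenvalue 2 (edge_join (turan2 (n div 2)) u v (turan2 (n div 2)))"
      using even(1) unfolding m_def .
    show "graph_eigenvalue 2 G = graph_eigenvalue 2 (edge_join (turan2 (n div 2)) u v (turan2 (n div 2))) \<longleftrightarrow>
        digraph_iso (with_proj G) (with_proj (edge_join (turan2 (n div 2)) u v (turan2 (n div 2))))"
      using even(2) unfolding m_def .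
  }
qed

end
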